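(* Let $G$ be a compact quantum group and let $(N,\pi)$ be a quantum subgroup of $G$, with $\hat{\pi}:\mathcal{A}_G\to\mathcal{A}_N$ the restriction of $\pi$. The following are equivalent: (1) $(N,\pi)$ is normal; (2) $(N,\hat{\pi})$ is a-normal; (3) $(N,\hat{\pi})$ is left a-normal; (4) $(N,\hat{\pi})$ is right a-normal.
   Context: A compact quantum group $G$ is given by a Woronowicz $C^*$-algebra $A_G$ (a unital $C^*$-algebra with coproduct $\Delta_G$ in the sense of Woronowicz). All Woronowicz $C^*$-algebras are assumed full, i.e. the norm of $A_G$ restricted to $\mathcal{A}_G$ is the maximal $C^*$-norm. $\mathcal{A}_G$ is the canonical dense Hopf $*$-algebra of matrix coefficients of finite-dimensional representations of $G$, with counit $\varepsilon$ and antipode $S$; Sweedler notation $\Delta(a)=\sum a_{(1)}\otimes a_{(2)}$ is used. A finite-dimensional representation of $G$ of dimension $d$ is an invertible $v=(v_{ij})\in M_d(A_G)$ with $\Delta_G(v_{ij})=\sum_k v_{ik}\otimes v_{kj}$. A quantum subgroup of $G$ is a pair $(N,\pi)$ where $A_N$ is a Woronowicz $C^*$-algebra and $\pi:A_G\to A_N$ is a surjective $*$-homomorphism with $(\pi\otimes\pi)\Delta_G=\Delta_N\pi$; its restriction $\hat\pi:\mathcal{A}_G\to\mathcal{A}_N$ is a surjective Hopf $*$-algebra morphism. $(N,\pi)$ is normal if for every irreducible representation $u^\lambda$ of $G$ the multiplicity of the trivial representation of $N$ in $\pi(u^\lambda)=(\pi(u^\lambda_{ij}))$ is either $0$ or $\dim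 u^\lambda$ (equivalently, with $h_N$ the Haar state of $N$, the matrix $(h_N\pi(u^\lambda_{ij}))$ is either the identity or zero). Define the adjoint coactions $ad_l(a)=\sum a_{(2)}\otimes a_{(1)}S(a_{(3)})$ and $ad_r(a)=\sum a_{(2)}\otimes S(a_{(1)})a_{(3)}$ on $\mathcal{A}_G$. $(N,\hat\pi)$ is left a-normal if $ad_l(a)\in\ker(\hat\pi)\otimes\mathcal{A}_G$ for all $a\in\ker(\hat\pi)$, right a-normal if $ad_r(a)\in\ker(\hat\pi)\otimes\mathcal{A}_G$ for all $a\in\ker(\hat\pi)$, and a-normal if both hold. *)

theory Defs
  imports Complex_Main
begin

text \<open>
  Algebraic (Hopf *-algebra) model of compact quantum groups.
  A unital complex *-algebra is modelled on a type 'a of class ring_1 (providing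
  the ring operations) together with a complex scalar multiplication and a star.
  An element of the algebraic tensor product A (x) B is represented by a finite
  list of pairs [(x1,y1),...] standing for the sum of the elementary tensors
  x_i (x) y_i; two such lists denote the same tensor iff they agree against all
  pairs of linear functionals (the canonical injective embedding of A (x) B into
  the bilinear forms on the algebraic duals).  The coproduct is given by a
  chosen Sweedler representative  cop a  of Delta(a); all axioms are stated up to
  this tensor equality.
\<close>

record 'a hopf_data =
  sc  :: "complex \<Rightarrow> 'a \<Rightarrow> 'a"
  st  :: "'a \<Rightarrow> 'a"
  cop :: "'a \<Rightarrow> ('a \<times> 'a) list"           (* Sweedler representative of Delta *)
  cou :: "'a \<Rightarrow> complex"
  ant :: "'a \<Rightarrow> 'a"

definition lin_fun :: "('a::ring_1) hopf_data \<Rightarrow> ('a \<Rightarrow> complex) \<Rightarrow> bool" where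
  "lin_fun H f \<longleftrightarrow> (\<forall>x y. f (x + y) = f x + f y) \<and> (\<forall>c x. f (sc H c x) = c * f x)"

definition teq2 :: "('a::ring_1) hopf_data \<Rightarrow> ('b::ring_1) hopf_data \<Rightarrow>
    ('a \<times> 'b) list \<Rightarrow> ('a \<times> 'b) list \<Rightarrow> bool" where
  "teq2 HA HB L M \<longleftrightarrow> (\<forall>f g. lin_fun HA f \<longrightarrow> lin_fun HB g \<longrightarrow>
      sum_list (map (\<lambda>(x, y). f x * g y) L) = sum_list (map (\<lambda>(x, y). f x * g y) M))"

definition teq3 :: "('a::ring_1) hopf_data \<Rightarrow> ('a \<times> 'a \<times> 'a) list \<Rightarrow> ('a \<times> 'a \<times> 'a) list \<Rightarrow> bool" where
  "teq3 H L M \<longleftrightarrow> (\<forall>f g k. lin_fun H f \<longrightarrow> lin_fun H g \<longrightarrow> lin_fun H k \<longrightarrow>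
      sum_list (map (\<lambda>(x, y, z). f x * g y * k z) L) = sum_list (map (\<lambda>(x, y, z). f x * g y * k z) M))"

definition cop3 :: "('a::ring_1) hopf_data \<Rightarrow> 'a \<Rightarrow> ('a \<times> 'a \<times> 'a) list" where
  "cop3 H a = concat (map (\<lambda>(x, y). map (\<lambda>(x1, x2). (x1, x2, y)) (cop H x)) (cop H a))"

definition hopf_star_algebra :: "('a::ring_1) hopf_data \<Rightarrow> bool" where
  "hopf_star_algebra H \<longleftrightarrow>
     \<comment> \<open>complex algebra\<close>
     (\<forall>c d x. sc H (c + d) x = sc H c x + sc H d x) \<and>
     (\<forall>c x y. sc H c (x + y) = sc H c x + sc H c y) \<and>
     (\<forall>c d x. sc H (c * d) x = sc H c (sc H d x)) \<and>
     (\<forall>x. sc H 1 x = x) \<and>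
     (\<forall>c x y. sc H c x * y = sc H c (x * y)) \<and>
     (\<forall>c x y. x * sc H c y = sc H c (x * y)) \<and>
     \<comment> \<open>involution\<close>
     (\<forall>x y. st H (x + y) = st H x + st H y) \<and>
     (\<forall>c x. st H (sc H c x) = sc H (cnj c) (st H x)) \<and>
     (\<forall>x y. st H (x * y) = st H y * st H x) \<and>
     (\<forall>x. st H (st H x) = x) \<and>
     \<comment> \<open>coproduct: unital *-homomorphism A -> A (x) A, coassociative\<close>
     (\<forall>x y. teq2 H H (cop H (x + y)) (cop H x @ cop H y)) \<and>
     (\<forall>c x. teq2 H H (cop H (sc H c x)) (map (\<lambda>(a, b). (sc H c a, b)) (cop H x))) \<and>
     (\<forall>x y. teq2 H H (cop H (x * y))
               (concat (map (\<lambda>(a, b). map (\<lambda>(a', b'). (a * a', b * b')) (cop H y)) (cop H x)))) \<and>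
     teq2 H H (cop H 1) [(1, 1)] \<and>
     (\<forall>x. teq2 H H (cop H (st H x)) (map (\<lambda>(a, b). (st H a, st H b)) (cop H x))) \<and>
     (\<forall>x. teq3 H (cop3 H x)
               (concat (map (\<lambda>(a, b). map (\<lambda>(b1, b2). (a, b1, b2)) (cop H b)) (cop H x)))) \<and>
     \<comment> \<open>counit: unital *-homomorphism A -> C\<close>
     lin_fun H (cou H) \<and>
     (\<forall>x y. cou H (x * y) = cou H x * cou H y) \<and> cou H 1 = 1 \<and>
     (\<forall>x. cou H (st H x) = cnj (cou H x)) \<and>
     (\<forall>x. sum_list (map (\<lambda>(a, b). sc H (cou H a) b) (cop H x)) = x) \<and>
     (\<forall>x. sum_list (map (\<lambda>(a, b). sc H (cou H b) a) (cop H x)) = x) \<and>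
     \<comment> \<open>antipode: linear, m(S (x) id)Delta = m(id (x) S)Delta = epsilon(.)1\<close>
     (\<forall>x y. ant H (x + y) = ant H x + ant H y) \<and>
     (\<forall>c x. ant H (sc H c x) = sc H c (ant H x)) \<and>
     (\<forall>x. sum_list (map (\<lambda>(a, b). ant H a * b) (cop H x)) = sc H (cou H x) 1) \<and>
     (\<forall>x. sum_list (map (\<lambda>(a, b). a * ant H b) (cop H x)) = sc H (cou H x) 1)"

definition is_corep :: "('a::ring_1) hopf_data \<Rightarrow> nat \<Rightarrow> (nat \<Rightarrow> nat \<Rightarrow> 'a) \<Rightarrow> bool" where
  "is_corep H d v \<longleftrightarrow>
     (\<forall>i<d. \<forall>j<d. teq2 H H (cop H (v i j)) (map (\<lambda>k. (v i k, v k j)) [0..<d]))"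

definition representation :: "('a::ring_1) hopf_data \<Rightarrow> nat \<Rightarrow> (nat \<Rightarrow> nat \<Rightarrow> 'a) \<Rightarrow> bool" where
  "representation H d v \<longleftrightarrow> is_corep H d v \<and>
     (\<exists>w. \<forall>i<d. \<forall>j<d.
        (\<Sum>k<d. v i k * w k j) = (if i = j then 1 else 0) \<and>
        (\<Sum>k<d. w i k * v k j) = (if i = j then 1 else 0))"

definition unitary_rep :: "('a::ring_1) hopf_data \<Rightarrow> nat \<Rightarrow> (nat \<Rightarrow> nat \<Rightarrow> 'a) \<Rightarrow> bool" where
  "unitary_rep H d v \<longleftrightarrow> is_corep H d v \<and>
     (\<forall>i<d. \<forall>j<d.
        (\<Sum>k<d. st H (v k i) * v k j) = (if i = j then 1 else 0) \<and>
        (\<Sum>k<d. v i k * st H (v j k)) = (if i = j then 1 else 0))"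

text \<open>Irreducible: d > 0 and no invariant subspace other than 0 and C^d.  A subspace W
  of C^d with an idempotent P onto W is invariant iff (I - P) v P = 0.\<close>
definition irreducible_rep :: "('a::ring_1) hopf_data \<Rightarrow> nat \<Rightarrow> (nat \<Rightarrow> nat \<Rightarrow> 'a) \<Rightarrow> bool" where
  "irreducible_rep H d v \<longleftrightarrow> representation H d v \<and> 0 < d \<and>
     (\<forall>P :: nat \<Rightarrow> nat \<Rightarrow> complex.
        (\<forall>i<d. \<forall>j<d. (\<Sum>k<d. P i k * P k j) = P i j) \<longrightarrow>
        (\<forall>i<d. \<forall>j<d. (\<Sum>k<d. \<Sum>l<d.
              sc H (((if i = k then 1 else 0) - P i k) * P l j) (v k l)) = 0) \<longrightarrow>
        (\<forall>i<d. \<forall>j<d. P i j = 0) \<or> (\<forall>i<d. \<forall>j<d. P i j = (if i = j then 1 else 0)))"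

inductive_set lin_span :: "('a::ring_1) hopf_data \<Rightarrow> 'a set \<Rightarrow> 'a set" for H S where
  span_zero: "0 \<in> lin_span H S"
| span_base: "x \<in> S \<Longrightarrow> x \<in> lin_span H S"
| span_add: "x \<in> lin_span H S \<Longrightarrow> y \<in> lin_span H S \<Longrightarrow> x + y \<in> lin_span H S"
| span_scale: "x \<in> lin_span H S \<Longrightarrow> sc H c x \<in> lin_span H S"

text \<open>CQG algebra (Dijkhuizen--Koornwinder): a Hopf *-algebra spanned by the matrix
  coefficients of its finite-dimensional unitary corepresentations.  These are exactly
  the dense Hopf *-algebras of compact quantum groups.\<close>
definition cqg_algebra :: "('a::ring_1) hopf_data \<Rightarrow> bool" where
  "cqg_algebra H \<longleftrightarrow> hopf_star_algebra H \<and>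
     lin_span H {v i j | v d i j. unitary_rep H d v \<and> i < d \<and> j < d} = UNIV"

definition haar_state :: "('a::ring_1) hopf_data \<Rightarrow> ('a \<Rightarrow> complex) \<Rightarrow> bool" where
  "haar_state H h \<longleftrightarrow> lin_fun H h \<and> h 1 = 1 \<and>
     (\<forall>x. Im (h (st H x * x)) = 0 \<and> 0 \<le> Re (h (st H x * x))) \<and>
     (\<forall>x. sum_list (map (\<lambda>(a, b). sc H (h a) b) (cop H x)) = sc H (h x) 1) \<and>
     (\<forall>x. sum_list (map (\<lambda>(a, b). sc H (h b) a) (cop H x)) = sc H (h x) 1)"

definition haar :: "('a::ring_1) hopf_data \<Rightarrow> 'a \<Rightarrow> complex" where
  "haar H = (THE h. haar_state H h)"

text \<open>Quantum subgroup (N, pi) at the level of the dense Hopf *-algebras: pi-hat is a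
  surjective unital *-homomorphism intertwining the coproducts.\<close>
definition quantum_subgroup ::
    "('a::ring_1) hopf_data \<Rightarrow> ('b::ring_1) hopf_data \<Rightarrow> ('a \<Rightarrow> 'b) \<Rightarrow> bool" where
  "quantum_subgroup G N p \<longleftrightarrow> surj p \<and>
     (\<forall>x y. p (x + y) = p x + p y) \<and> (\<forall>c x. p (sc G c x) = sc N c (p x)) \<and>
     (\<forall>x y. p (x * y) = p x * p y) \<and> p 1 = 1 \<and> (\<forall>x. p (st G x) = st N (p x)) \<and>
     (\<forall>x. teq2 N N (map (\<lambda>(a, b). (p a, p b)) (cop G x)) (cop N (p x)))"

definition normal_qsg :: "('a::ring_1) hopf_data \<Rightarrow> ('b::ring_1) hopf_data \<Rightarrow> ('a \<Rightarrow> 'b) \<Rightarrow> bool" where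
  "normal_qsg G N p \<longleftrightarrow>
     (\<forall>d v. irreducible_rep G d v \<longrightarrow>
        (\<forall>i<d. \<forall>j<d. haar N (p (v i j)) = (if i = j then 1 else 0)) \<or>
        (\<forall>i<d. \<forall>j<d. haar N (p (v i j)) = 0))"

definition ad_l :: "('a::ring_1) hopf_data \<Rightarrow> 'a \<Rightarrow> ('a \<times> 'a) list" where
  "ad_l H a = map (\<lambda>(a1, a2, a3). (a2, a1 * ant H a3)) (cop3 H a)"

definition ad_r :: "('a::ring_1) hopf_data \<Rightarrow> 'a \<Rightarrow> ('a \<times> 'a) list" where
  "ad_r H a = map (\<lambda>(a1, a2, a3). (a2, ant H a1 * a3)) (cop3 H a)"

definition in_ker_tensor :: "('a::ring_1) hopf_data \<Rightarrow> ('a \<Rightarrow> 'b::zero) \<Rightarrow> ('a \<times> 'a) list \<Rightarrow> bool" where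
  "in_ker_tensor G p L \<longleftrightarrow> (\<exists>M. (\<forall>(x, y) \<in> set M. p x = 0) \<and> teq2 G G L M)"

definition left_a_normal :: "('a::ring_1) hopf_data \<Rightarrow> ('a \<Rightarrow> 'b::zero) \<Rightarrow> bool" where
  "left_a_normal G p \<longleftrightarrow> (\<forall>a. p a = 0 \<longrightarrow> in_ker_tensor G p (ad_l G a))"

definition right_a_normal :: "('a::ring_1) hopf_data \<Rightarrow> ('a \<Rightarrow> 'b::zero) \<Rightarrow> bool" where
  "right_a_normal G p \<longleftrightarrow> (\<forall>a. p a = 0 \<longrightarrow> in_ker_tensor G p (ad_r G a))"

definition a_normal :: "('a::ring_1) hopf_data \<Rightarrow> ('a \<Rightarrow> 'b::zero) \<Rightarrow> bool" where
  "a_normal G p \<longleftrightarrow> left_a_normal G p \<and> right_a_normal G p"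

end

theory Submission
  imports Defs "HOL-Analysis.Analysis"
begin

text \<open>
  Let \<open>h\<close> be the Haar state of \<open>N\<close> and put \<open>P = (h p (v i j))\<close> for a representation \<open>v\<close> of \<open>G\<close>; this is an
  idempotent matrix. The map \<open>\<Theta> a = h p (a\<^sub>2) a\<^sub>1 S(a\<^sub>3)\<close> sends \<open>v\<close> to \<open>v P v\<^sup>-\<^sup>1\<close>, so normality says exactly that
  \<open>\<Theta> a = h p (a) 1\<close> for all \<open>a\<close>. If \<open>N\<close> is left a-normal, \<open>\<Theta>\<close> vanishes on the kernel of \<open>p\<close>, in particular on the
  entries of \<open>P v - P\<close>; hence \<open>P v P = P v\<close>, and irreducibility of \<open>v\<close> forces \<open>P = 0\<close> or \<open>P = 1\<close>. Conversely, if
  \<open>\<Theta> = h p (\<cdot>) 1\<close> and \<open>p a = 0\<close>, then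
  \<open>h p (c a\<^sub>2) a\<^sub>1 S(a\<^sub>3) = S(c\<^sub>1) \<Theta>(c\<^sub>2 a) c\<^sub>3 = S(c\<^sub>1) h p (c\<^sub>2 a) c\<^sub>3 = 0\<close> for all \<open>c\<close>, and nondegeneracy of \<open>h\<close> gives
  \<open>p (a\<^sub>2) \<otimes> a\<^sub>1 S(a\<^sub>3) = 0\<close>. The right-handed case is the mirror image.

  The Haar state of a CQG algebra is obtained by orthogonal projection in the finite-dimensional algebras
  \<open>{f(u)}\<close> of matrices of a unitary representation \<open>u\<close>, and complete reducibility by averaging idempotents with it.
\<close>

section \<open>Complex matrices\<close>

text \<open>\<open>haar N\<close> is a definite description whose predicate includes positivity, so
  normality cannot be evaluated before existence, uniqueness and positivity of the invariant
  functional are known. All three must come from the algebra and its unitary corepresentations. The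
  order is: existence and uniqueness, then nondegeneracy from invariance and the inverse antipode,
  then positivity with the help of nondegeneracy. Normality speaks of irreducible representations
  only, while the identity for \<Theta> is required on the whole algebra; complete reducibility
  bridges the two. The factor \<open>c\<close> in \<open>h p (c a\<^sub>2)\<close> is what turns a
  scalar identity into the vanishing of a tensor: the Haar state of N tests
  \<open>p (a\<^sub>2)\<close> against all \<open>p c\<close>, and the antipode moves
  \<open>c\<close> out of the way. Since tensors are lists compared through products of functionals,
  each axiom is first transferred to arbitrary bilinear maps.\<close>

lemma sum_delta:
  fixes f :: "'i \<Rightarrow> 'r::semiring_1"
  assumes "finite I"
  shows "(\<Sum>i\<in>I. f i * (if i = j then 1 else 0)) = (if j \<in> I then f j else 0)"
    and "(\<Sum>i\<in>I. f i * (if j = i then 1 else 0)) = (if j \<in> I then f j else 0)"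
    and "(\<Sum>i\<in>I. (if i = j then 1 else 0) * f i) = (if j \<in> I then f j else 0)"
    and "(\<Sum>i\<in>I. (if j = i then 1 else 0) * f i) = (if j \<in> I then f j else 0)"
proof -
  have "f i * (if i = j then 1 else 0) = (if i = j then f i else 0)"
    "f i * (if j = i then 1 else 0) = (if j = i then f i else 0)"
    "(if i = j then 1 else 0) * f i = (if i = j then f i else 0)"
    "(if j = i then 1 else 0) * f i = (if j = i then f i else 0)" for i by auto
  then show "(\<Sum>i\<in>I. f i * (if i = j then 1 else 0)) = (if j \<in> I then f j else 0)"
    "(\<Sum>i\<in>I. f i * (if j = i then 1 else 0)) = (if j \<in> I then f j else 0)"
    "(\<Sum>i\<in>I. (if i = j then 1 else 0) * f i) = (if j \<in> I then f j else 0)"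
    "(\<Sum>i\<in>I. (if j = i then 1 else 0) * f i) = (if j \<in> I then f j else 0)"
    using assms by simp_all
qed

text \<open>Gram-Schmidt by induction on \<open>I\<close>: the elements of \<open>W\<close>
  vanishing at the new coordinate form a subspace \<open>W0\<close> covered by the induction
  hypothesis, and \<open>W\<close> exceeds \<open>W0\<close> by at most one direction. Only
  coordinates in \<open>I\<close> are compared, so \<open>W\<close> may live in an
  infinite-dimensional function space.\<close>

lemma orthogonal_projection_exists:
  fixes W :: "('i \<Rightarrow> complex) set"
  assumes "finite I" and "(\<lambda>_. 0) \<in> W"
    and "\<And>x y. x \<in> W \<Longrightarrow> y \<in> W \<Longrightarrow> (\<lambda>i. x i + y i) \<in> W"
    and "\<And>c x. x \<in> W \<Longrightarrow> (\<lambda>i. c * x i) \<in> W"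
  shows "\<exists>w\<in>W. \<forall>z\<in>W. (\<Sum>i\<in>I. (v i - w i) * cnj (z i)) = 0"
  using assms
proof (induction I arbitrary: W v rule: finite_induct)
  case empty
  then show ?case by auto
next
  case (insert i I)
  define W0 where "W0 = {w \<in> W. w i = 0}"
  have W0: "\<exists>w\<in>W0. \<forall>z\<in>W0. (\<Sum>i\<in>I. (v i - w i) * cnj (z i)) = 0" for v
    by (rule insert.IH) (use insert.prems in \<open>auto simp: W0_def\<close>)
  show ?case
  proof (cases "\<forall>w\<in>W. w i = 0")
    case True
    then have "W0 = W" by (auto simp: W0_def)
    with W0[of v] obtain w where w: "w \<in> W" "\<forall>z\<in>W. (\<Sum>i\<in>I. (v i - w i) * cnj (z i)) = 0" by auto
    with True insert.hyps show ?thesis by (intro bexI[OF _ w(1)]) auto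
  next
    case False
    then obtain w1 where w1: "w1 \<in> W" "w1 i \<noteq> 0" by auto
    from W0[of w1] obtain w0 where w0: "w0 \<in> W0"
      and w0o: "\<And>z. z \<in> W0 \<Longrightarrow> (\<Sum>i\<in>I. (w1 i - w0 i) * cnj (z i)) = 0" by auto
    \<comment> \<open>The component of \<open>w1\<close> orthogonal to \<open>W0\<close>; its
      \<open>i\<close>-th coordinate is still nonzero. The factor \<open>-1\<close> is spelled out
      so that closure under addition and scaling applies.\<close>
    define w' where "w' = (\<lambda>j. w1 j + (-1) * w0 j)"
    have w'W: "w' \<in> W" unfolding w'_def
      by (intro insert.prems w1) (use w0 in \<open>auto simp: W0_def\<close>)
    have w'i: "w' i \<noteq> 0" using w1 w0 by (auto simp: w'_def W0_def)
    have w'o: "(\<Sum>j\<in>insert i I. w' j * cnj (z j)) = 0" if "z \<in> W0" for z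
      using w0o[OF that] that insert.hyps by (simp add: w'_def W0_def)
    have w'o2: "(\<Sum>j\<in>insert i I. z j * cnj (w' j)) = 0" if "z \<in> W0" for z
    proof -
      have "(\<Sum>j\<in>insert i I. z j * cnj (w' j)) = cnj (\<Sum>j\<in>insert i I. w' j * cnj (z j))"
        by (simp add: mult.commute del: sum.insert)
      then show ?thesis using w'o[OF that] by simp
    qed
    define n where "n = (\<Sum>j\<in>insert i I. w' j * cnj (w' j))"
    have "n = complex_of_real (\<Sum>j\<in>insert i I. (cmod (w' j))\<^sup>2)"
      unfolding n_def of_real_sum by (intro sum.cong refl) (metis complex_norm_square)
    moreover have "(\<Sum>j\<in>insert i I. (cmod (w' j))\<^sup>2) > 0"
      using insert.hyps w'i by (intro sum_pos2[of _ i]) auto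
    ultimately have n0: "n \<noteq> 0" by (metis less_irrefl of_real_eq_0_iff)
    from W0[of v] obtain v0 where v0: "v0 \<in> W0"
      and v0o: "\<And>z. z \<in> W0 \<Longrightarrow> (\<Sum>i\<in>I. (v i - v0 i) * cnj (z i)) = 0" by auto
    \<comment> \<open>Fourier coefficient of \<open>v\<close> along \<open>w'\<close>: after
      subtracting \<open>v0 + t w'\<close> the remainder is orthogonal to \<open>W0\<close> and to
      \<open>w'\<close>.\<close>
    define t where "t = (\<Sum>j\<in>insert i I. v j * cnj (w' j)) / n"
    define w where "w = (\<lambda>j. v0 j + t * w' j)"
    have wW: "w \<in> W" unfolding w_def
      by (intro insert.prems w'W) (use v0 in \<open>auto simp: W0_def\<close>)
    have "(\<Sum>j\<in>insert i I. (v j - w j) * cnj (z j)) = 0" if z: "z \<in> W" for z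
    proof -
      define s where "s = z i / w' i"
      define z0 where "z0 = (\<lambda>j. z j + (-s) * w' j)"
      have z0: "z0 \<in> W0"
        using w'i insert.prems(2)[OF z insert.prems(3)[OF w'W, of "-s"]]
        by (auto simp: W0_def z0_def s_def)
      have 1: "(\<Sum>j\<in>insert i I. (v j - v0 j) * cnj (z0 j)) = 0"
        using v0o[OF z0] z0 insert.hyps by (simp add: W0_def)
      have "(\<Sum>j\<in>insert i I. (v j - w j) * cnj (z j))
          = (\<Sum>j\<in>insert i I. (v j - v0 j) * cnj (z0 j)) - t * (\<Sum>j\<in>insert i I. w' j * cnj (z0 j))
            + cnj s * ((\<Sum>j\<in>insert i I. v j * cnj (w' j)) - (\<Sum>j\<in>insert i I. v0 j * cnj (w' j))
               - t * (\<Sum>j\<in>insert i I. w' j * cnj (w' j)))"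
        unfolding sum_distrib_left sum_subtractf[symmetric] sum.distrib[symmetric]
        by (intro sum.cong refl) (simp add: w_def z0_def algebra_simps)
      also have "\<dots> = 0"
        using n0 by (simp only: 1 w'o[OF z0] w'o2[OF v0] n_def[symmetric]) (simp add: t_def)
      finally show ?thesis .
    qed
    with wW show ?thesis by blast
  qed
qed

text \<open>Column \<open>j\<close> of \<open>T\<close> is the projection of the \<open>j\<close>-th
  unit vector onto \<open>W\<close>. Orthogonality of the residue to \<open>w\<close> reads off the
  coordinate \<open>w j\<close>; with another column in place of \<open>w\<close> it says that
  \<open>T\<close> is its adjoint times itself, hence hermitian.\<close>

lemma orthogonal_projection_matrix:
  fixes W :: "('i \<Rightarrow> complex) set"
  assumes fin: "finite I" and W: "(\<lambda>_. 0) \<in> W"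
    "\<And>x y. x \<in> W \<Longrightarrow> y \<in> W \<Longrightarrow> (\<lambda>i. x i + y i) \<in> W"
    "\<And>c x. x \<in> W \<Longrightarrow> (\<lambda>i. c * x i) \<in> W"
  obtains T where "\<And>j. (\<lambda>i. T i j) \<in> W"
    and "\<And>w i. w \<in> W \<Longrightarrow> i \<in> I \<Longrightarrow> (\<Sum>j\<in>I. T i j * w j) = w i"
    and "\<And>i j. i \<in> I \<Longrightarrow> j \<in> I \<Longrightarrow> T j i = cnj (T i j)"
proof -
  have proj: "\<exists>w\<in>W. \<forall>z\<in>W. (\<Sum>i\<in>I. (v i - w i) * cnj (z i)) = 0" for v
    by (rule orthogonal_projection_exists[OF fin W(1)]) (rule W; assumption)+
  have "\<forall>j. \<exists>w\<in>W. \<forall>z\<in>W. (\<Sum>i\<in>I. ((if i = j then 1 else 0) - w i) * cnj (z i)) = 0"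
    by (rule allI) (rule proj)
  then have "\<forall>j. \<exists>w. w \<in> W \<and> (\<forall>z\<in>W. (\<Sum>i\<in>I. ((if i = j then 1 else 0) - w i) * cnj (z i)) = 0)"
    by blast
  from choice[OF this] obtain t where tW: "\<And>j. t j \<in> W"
    and t: "\<And>j z. z \<in> W \<Longrightarrow> (\<Sum>i\<in>I. ((if i = j then 1 else 0) - t j i) * cnj (z i)) = 0" by blast
  define T where "T = (\<lambda>i j. t j i)"
  have *: "cnj (w j) = (\<Sum>i\<in>I. T i j * cnj (w i))" if "w \<in> W" "j \<in> I" for w j
  proof -
    have "(\<Sum>i\<in>I. (if i = j then 1 else 0) * cnj (w i)) = (\<Sum>i\<in>I. T i j * cnj (w i))"
      using t[OF that(1), of j] by (simp add: T_def left_diff_distrib sum_subtractf)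
    moreover have "(\<Sum>i\<in>I. (if i = j then 1 else 0) * cnj (w i)) = cnj (w j)"
      using that(2) fin by (simp add: sum_delta)
    ultimately show ?thesis by simp
  qed
  have col: "(\<lambda>i. T i j) \<in> W" for j using tW by (simp add: T_def)
  have herm: "T j i = cnj (T i j)" if "i \<in> I" "j \<in> I" for i j
  proof -
    have a: "cnj (T j i) = (\<Sum>k\<in>I. T k j * cnj (T k i))" by (rule *[OF col that(2)])
    have b: "cnj (T i j) = (\<Sum>k\<in>I. T k i * cnj (T k j))" by (rule *[OF col that(1)])
    have "T j i = cnj (\<Sum>k\<in>I. T k j * cnj (T k i))" by (simp only: a[symmetric] complex_cnj_cnj)
    also have "\<dots> = (\<Sum>k\<in>I. T k i * cnj (T k j))"
      by (simp only: cnj_sum complex_cnj_mult complex_cnj_cnj mult.commute)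
    finally show ?thesis by (simp only: b)
  qed
  have "(\<Sum>j\<in>I. T i j * w j) = w i" if "w \<in> W" "i \<in> I" for w i
  proof -
    have "w i = cnj (\<Sum>j\<in>I. T j i * cnj (w j))" by (simp only: *[OF that, symmetric] complex_cnj_cnj)
    also have "\<dots> = (\<Sum>j\<in>I. cnj (T j i) * w j)" by simp
    also have "\<dots> = (\<Sum>j\<in>I. T i j * w j)" by (intro sum.cong refl) (simp only: herm[OF _ that(2)])
    finally show ?thesis by simp
  qed
  with col herm show ?thesis using that by blast
qed

text \<open>First-order condition at a minimum: for nonzero \<open>a\<close>, the step
  \<open>t = -a/c\<close> brings the value down to at most \<open>-a^2/c\<close>. The choice
  \<open>\<bar>b\<bar> + 1\<close> keeps \<open>c\<close> positive and above
  \<open>b\<close>.\<close>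

lemma quadratic_nonneg_imp_linear_zero:
  fixes a b :: real
  assumes "\<And>t. 0 \<le> 2 * t * a + t\<^sup>2 * b"
  shows "a = 0"
proof (rule ccontr)
  assume "a \<noteq> 0"
  define c where "c = \<bar>b\<bar> + 1"
  have c: "c > 0" "b \<le> c" by (auto simp: c_def)
  have "0 \<le> 2 * (-a/c) * a + (-a/c)\<^sup>2 * b" using assms .
  also have "\<dots> \<le> 2 * (-a/c) * a + (-a/c)\<^sup>2 * c"
    using c by (intro add_left_mono mult_left_mono) auto
  also have "\<dots> = - (a\<^sup>2 / c)" using c by (simp add: field_simps power2_eq_square)
  also have "\<dots> < 0" using c \<open>a \<noteq> 0\<close> by simp
  finally show False by simp
qed

text \<open>Variational argument: the form \<open>q\<close> attains its minimum \<open>m\<close> on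
  the unit sphere, \<open>m\<close> is negative because \<open>q\<close> is negative somewhere, and
  a minimizer is an eigenvector for \<open>m\<close>.\<close>

lemma hermitian_negative_eigenvalue:
  fixes Y :: "nat \<Rightarrow> nat \<Rightarrow> complex"
  assumes herm: "\<And>i j. i < d \<Longrightarrow> j < d \<Longrightarrow> Y j i = cnj (Y i j)"
    and neg: "Re (\<Sum>i<d. \<Sum>j<d. cnj (z i) * Y i j * z j) < 0"
  obtains m :: real and x where "m < 0" "\<exists>i<d. x i \<noteq> 0"
    "\<And>i. i < d \<Longrightarrow> (\<Sum>j<d. Y i j * x j) = of_real m * x i"
proof -
  define q where "q = (\<lambda>z. Re (\<Sum>i<d. \<Sum>j<d. cnj (z i) * Y i j * z j))"
  define n where "n = (\<lambda>z :: nat \<Rightarrow> complex. \<Sum>i<d. (cmod (z i))\<^sup>2)"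
  \<comment> \<open>Vectors are functions on all of \<open>nat\<close>; pinning the coordinates from
    \<open>d\<close> on to 0 places the sphere inside a product of compact sets.\<close>
  define B :: "nat \<Rightarrow> complex set" where "B = (\<lambda>i. if i < d then cball (0::complex) 1 else {0})"
  define K where "K = PiE UNIV B \<inter> {z. n z = 1}"
  have cont: "continuous_on UNIV n" "continuous_on UNIV q"
    unfolding n_def q_def
    by (intro continuous_on_sum continuous_on_power continuous_on_norm continuous_on_Re continuous_on_mult
        continuous_on_cnj continuous_on_const continuous_on_product_coordinates)+
  have "compactin (product_topology (\<lambda>i. euclidean) UNIV) (PiE UNIV B)"
    by (subst compactin_PiE) (simp add: B_def compact_cball)
  then have "compact (PiE UNIV B)" by (simp add: euclidean_product_topology)
  moreover have "closed {z. n z = 1}"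
    by (rule closed_Collect_eq) (use cont in auto)
  ultimately have cK: "compact K" unfolding K_def by (rule compact_Int_closed)
  have scale: "q (\<lambda>i. if i < d then of_real c * x i else 0) = c\<^sup>2 * q x"
    "n (\<lambda>i. if i < d then of_real c * x i else 0) = c\<^sup>2 * n x" for c x
  proof -
    have "(\<Sum>i<d. \<Sum>j<d. cnj (if i < d then of_real c * x i else 0) * Y i j *
          (if j < d then of_real c * x j else 0))
        = of_real (c\<^sup>2) * (\<Sum>i<d. \<Sum>j<d. cnj (x i) * Y i j * x j)"
      unfolding sum_distrib_left by (intro sum.cong refl) (simp add: power2_eq_square)
    moreover have "Re (of_real r * w) = r * Re w" for r w by simp
    ultimately show "q (\<lambda>i. if i < d then of_real c * x i else 0) = c\<^sup>2 * q x"
      unfolding q_def by (simp only:)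
    show "n (\<lambda>i. if i < d then of_real c * x i else 0) = c\<^sup>2 * n x"
      unfolding n_def sum_distrib_left by (intro sum.cong refl) (simp add: norm_mult power_mult_distrib)
  qed
  have n_nonneg: "n x \<ge> 0" for x unfolding n_def by (intro sum_nonneg) auto
  have n0: "q x = 0" if "n x = 0" for x
  proof -
    have "x i = 0" if "i < d" for i
      using \<open>n x = 0\<close> that unfolding n_def by (subst (asm) sum_nonneg_eq_0_iff) auto
    then show ?thesis unfolding q_def by simp
  qed
  have normalize: "\<exists>y\<in>K. q x = n x * q y" if "n x \<noteq> 0" for x
  proof -
    define c where "c = 1 / sqrt (n x)"
    define y where "y = (\<lambda>i. if i < d then of_real c * x i else 0)"
    have c2: "c\<^sup>2 * n x = 1" using that n_nonneg[of x] by (simp add: c_def power_divide)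
    have ny: "n y = 1" using scale(2)[of c x] c2 by (simp add: y_def)
    have "cmod (y i) \<le> 1" if "i < d" for i
    proof -
      have "(cmod (y i))\<^sup>2 \<le> n y" unfolding n_def by (rule member_le_sum) (use that in auto)
      with ny show ?thesis by (metis one_power2 abs_norm_cancel abs_square_le_1)
    qed
    then have "y \<in> K" using ny by (auto simp: K_def B_def y_def)
    moreover have "q x = n x * q y" using scale(1)[of c x] c2 by (simp add: y_def mult.commute)
    ultimately show ?thesis by blast
  qed
  have "n z \<noteq> 0" using n0[of z] neg by (auto simp: q_def)
  from normalize[OF this] obtain y0 where y0: "y0 \<in> K" "q z = n z * q y0" by blast
  obtain x where x: "x \<in> K" and xmin: "\<And>y. y \<in> K \<Longrightarrow> q x \<le> q y"
    using continuous_attains_inf[OF cK, of q] y0 cont(2) continuous_on_subset by blast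
  define m where "m = q x"
  have "m < 0"
  proof -
    have "n z * q y0 < 0" using neg y0 by (simp add: q_def)
    then have "q y0 < 0" using n_nonneg[of z] by (simp add: mult_less_0_iff)
    with xmin[OF y0(1)] show ?thesis by (simp add: m_def)
  qed
  have bound: "m * n y \<le> q y" for y
  proof (cases "n y = 0")
    case False
    from normalize[OF this] obtain y' where "y' \<in> K" "q y = n y * q y'" by blast
    with xmin[of y'] n_nonneg[of y] show ?thesis
      by (metis m_def mult.commute mult_left_mono)
  qed (use n0 in simp)
  have nx: "n x = 1" using x by (simp add: K_def)
  \<comment> \<open>The residual of the eigenvalue equation. Varying the minimizer in this very
    direction makes the first-order term \<open>2 t n w\<close>, so minimality forces
    \<open>n w = 0\<close>.\<close>
  define w where "w = (\<lambda>i. (\<Sum>j<d. Y i j * x j) - of_real m * x i)"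
  have expand: "q (\<lambda>i. x i + of_real t * w i) - m * n (\<lambda>i. x i + of_real t * w i)
      = 2 * t * n w + t\<^sup>2 * (q w - m * n w)" for t
  proof -
    define b where "b = (\<lambda>u v. (\<Sum>i<d. \<Sum>j<d. cnj (u i) * Y i j * v j) - of_real m * (\<Sum>i<d. cnj (u i) * v i))"
    have qb: "q u - m * n u = Re (b u u)" for u
    proof -
      have "(\<Sum>i<d. cnj (u i) * u i) = of_real (n u)"
        unfolding n_def of_real_sum by (intro sum.cong refl) (metis complex_norm_square mult.commute)
      then show ?thesis by (simp add: b_def q_def)
    qed
    have add: "b (\<lambda>i. x i + of_real t * w i) (\<lambda>i. x i + of_real t * w i)
      = b x x + of_real t * b x w + of_real t * b w x + of_real (t\<^sup>2) * b w w"
    proof -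
      have 1: "(\<Sum>i<d. \<Sum>j<d. cnj (x i + of_real t * w i) * Y i j * (x j + of_real t * w j))
        = (\<Sum>i<d. \<Sum>j<d. cnj (x i) * Y i j * x j) + of_real t * (\<Sum>i<d. \<Sum>j<d. cnj (x i) * Y i j * w j)
          + of_real t * (\<Sum>i<d. \<Sum>j<d. cnj (w i) * Y i j * x j)
          + of_real (t\<^sup>2) * (\<Sum>i<d. \<Sum>j<d. cnj (w i) * Y i j * w j)"
        unfolding sum_distrib_left sum.distrib[symmetric]
        by (intro sum.cong refl) (simp add: algebra_simps power2_eq_square)
      have 2: "(\<Sum>i<d. cnj (x i + of_real t * w i) * (x i + of_real t * w i))
        = (\<Sum>i<d. cnj (x i) * x i) + of_real t * (\<Sum>i<d. cnj (x i) * w i)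
          + of_real t * (\<Sum>i<d. cnj (w i) * x i) + of_real (t\<^sup>2) * (\<Sum>i<d. cnj (w i) * w i)"
        unfolding sum_distrib_left sum.distrib[symmetric]
        by (intro sum.cong refl) (simp add: algebra_simps power2_eq_square)
      show ?thesis unfolding b_def 1 2 by (simp add: algebra_simps)
    qed
    have bw: "b u x = (\<Sum>i<d. cnj (u i) * w i)" for u
      unfolding b_def w_def sum_distrib_left right_diff_distrib sum_subtractf
      by (simp add: mult_ac)
    have b_sym: "b u v = cnj (b v u)" for u v
    proof -
      have "cnj (\<Sum>i<d. \<Sum>j<d. cnj (v i) * Y i j * u j) = (\<Sum>i<d. \<Sum>j<d. cnj (u j) * Y j i * v i)"
        unfolding cnj_sum
      proof (intro sum.cong refl)
        fix i j assume "i \<in> {..<d}" "j \<in> {..<d}"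
        then have Y: "Y j i = cnj (Y i j)" by (intro herm) auto
        show "cnj (cnj (v i) * Y i j * u j) = cnj (u j) * Y j i * v i"
          unfolding Y by simp
      qed
      also have "\<dots> = (\<Sum>i<d. \<Sum>j<d. cnj (u i) * Y i j * v j)" by (rule sum.swap)
      finally have 1: "(\<Sum>i<d. \<Sum>j<d. cnj (u i) * Y i j * v j) = cnj (\<Sum>i<d. \<Sum>j<d. cnj (v i) * Y i j * u j)"
        by (rule sym)
      have 2: "(\<Sum>i<d. cnj (u i) * v i) = cnj (\<Sum>i<d. cnj (v i) * u i)"
        unfolding cnj_sum by (intro sum.cong refl) simp
      show ?thesis unfolding b_def 1 2 by (simp only: complex_cnj_diff complex_cnj_mult complex_cnj_complex_of_real)
    qed
    have bwx: "b w x = of_real (n w)"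
      unfolding bw n_def of_real_sum by (intro sum.cong refl) (metis complex_norm_square mult.commute)
    have bxw: "b x w = of_real (n w)" by (subst b_sym) (simp add: bwx)
    have bxx: "Re (b x x) = 0" using qb[of x] nx by (simp add: m_def)
    show ?thesis unfolding qb add by (simp add: bwx bxw bxx)
  qed
  have "0 \<le> 2 * t * n w + t\<^sup>2 * (q w - m * n w)" for t
    using bound[of "\<lambda>i. x i + of_real t * w i"] expand[of t] by simp
  then have nw: "n w = 0" by (rule quadratic_nonneg_imp_linear_zero)
  have w0: "w i = 0" if "i < d" for i
    using nw that unfolding n_def by (subst (asm) sum_nonneg_eq_0_iff) auto
  have "\<exists>i<d. x i \<noteq> 0"
  proof (rule ccontr)
    assume "\<not> ?thesis"
    then have "n x = 0" by (simp add: n_def)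
    with nx show False by simp
  qed
  moreover have "(\<Sum>j<d. Y i j * x j) = of_real m * x i" if "i < d" for i
    using w0[OF that] by (simp add: w_def)
  ultimately show thesis using that \<open>m < 0\<close> by blast
qed

text \<open>A factorization of \<open>E\<close> through an index set of least cardinality has an injective left and a
  surjective right factor; idempotency then forces \<open>K J = 1\<close>.\<close>
lemma idempotent_rank_factorization:
  fixes E :: "nat \<Rightarrow> nat \<Rightarrow> complex"
  assumes idem: "\<And>i j. i < d \<Longrightarrow> j < d \<Longrightarrow> (\<Sum>k<d. E i k * E k j) = E i j"
    and not1: "\<exists>i<d. \<exists>j<d. E i j \<noteq> (if i = j then 1 else 0)"
  obtains k J K where "k < d"
    "\<And>i j. i < d \<Longrightarrow> j < d \<Longrightarrow> E i j = (\<Sum>a<k. J i a * K a j)"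
    "\<And>a b. a < k \<Longrightarrow> b < k \<Longrightarrow> (\<Sum>i<d. K a i * J i b) = (if a = b then 1 else 0)"
proof -
  \<comment> \<open>Factorizations are indexed by arbitrary finite sets, so an index can be deleted
    without relabelling; the passage to \<open>{..<k}\<close> comes last.\<close>
  define Q where "Q = (\<lambda>A :: nat set. \<lambda>J K. finite A \<and> (\<forall>i<d. \<forall>j<d. E i j = (\<Sum>a\<in>A. J i a * K a j)))"
  \<comment> \<open>A relation among the columns of \<open>J\<close> that involves column
    \<open>m\<close> expresses it by the others; its contribution is absorbed into
    \<open>K\<close>.\<close>
  have reduceJ: "\<exists>K'. Q (A - {m}) J K'" if QA: "Q A J K" "m \<in> A" "x m \<noteq> 0"
    "\<And>i. i < d \<Longrightarrow> (\<Sum>a\<in>A. J i a * x a) = 0" for A J K m x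
  proof -
    have fin: "finite A" using QA(1) by (simp add: Q_def)
    have "E i j = (\<Sum>a\<in>A-{m}. J i a * (K a j - x a / x m * K m j))" if ij: "i < d" "j < d" for i j
    proof -
      have "(\<Sum>a\<in>A-{m}. J i a * x a) = - (J i m * x m)"
        using QA(4)[of i] ij \<open>m \<in> A\<close> fin by (simp add: sum_diff1)
      then have "(\<Sum>a\<in>A-{m}. J i a * x a) * (K m j / x m) = - (J i m * K m j)"
        using \<open>x m \<noteq> 0\<close> by simp
      then have "(\<Sum>a\<in>A-{m}. J i a * (x a / x m * K m j)) = - (J i m * K m j)"
        unfolding sum_distrib_right by (simp add: mult_ac)
      moreover have "E i j = J i m * K m j + (\<Sum>a\<in>A-{m}. J i a * K a j)"
        using \<open>Q A J K\<close> ij \<open>m \<in> A\<close> fin by (simp add: Q_def sum.remove)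
      ultimately show ?thesis by (simp add: right_diff_distrib sum_subtractf)
    qed
    with fin show ?thesis unfolding Q_def by auto
  qed
  have reduceK: "\<exists>J'. Q (A - {m}) J' K" if QA: "Q A J K" "m \<in> A" "x m \<noteq> 0"
    "\<And>j. j < d \<Longrightarrow> (\<Sum>a\<in>A. x a * K a j) = 0" for A J K m x
  proof -
    have fin: "finite A" using QA(1) by (simp add: Q_def)
    have "E i j = (\<Sum>a\<in>A-{m}. (J i a - J i m * (x a / x m)) * K a j)" if ij: "i < d" "j < d" for i j
    proof -
      have "(\<Sum>a\<in>A-{m}. x a * K a j) = - (x m * K m j)"
        using QA(4)[of j] ij \<open>m \<in> A\<close> fin by (simp add: sum_diff1)
      then have "(J i m / x m) * (\<Sum>a\<in>A-{m}. x a * K a j) = - (J i m * K m j)"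
        using \<open>x m \<noteq> 0\<close> by simp
      then have "(\<Sum>a\<in>A-{m}. J i m * (x a / x m) * K a j) = - (J i m * K m j)"
        unfolding sum_distrib_left by (simp add: mult_ac)
      moreover have "E i j = J i m * K m j + (\<Sum>a\<in>A-{m}. J i a * K a j)"
        using \<open>Q A J K\<close> ij \<open>m \<in> A\<close> fin by (simp add: Q_def sum.remove)
      ultimately show ?thesis by (simp add: left_diff_distrib sum_subtractf)
    qed
    with fin show ?thesis unfolding Q_def by auto
  qed
  define P where "P = (\<lambda>n. \<exists>A J K. card A = n \<and> Q A J K)"
  obtain p r where pr: "p < d" "r < d" "E p r \<noteq> (if p = r then 1 else 0)" using not1 by blast
  have Q0: "Q {..<d} E (\<lambda>a j. if a = j then 1 else 0)" by (simp add: Q_def sum_delta)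
  \<comment> \<open>Column \<open>r\<close> of \<open>1 - E\<close>: idempotency puts it into the
    kernel of \<open>E\<close>, and it is nonzero at \<open>p\<close>. So the trivial factorization
    through \<open>d\<close> indices can be shortened, which is the source of
    \<open>k < d\<close>.\<close>
  define x where "x = (\<lambda>i. (if i = r then 1 else 0) - E i r)"
  have "x p \<noteq> 0" using pr by (auto simp: x_def)
  moreover have "(\<Sum>a<d. E i a * x a) = 0" if "i < d" for i
    using idem[OF that pr(2)] pr(2) by (simp add: x_def right_diff_distrib sum_subtractf sum_delta)
  ultimately obtain K0 where "Q ({..<d} - {p}) E K0" using reduceJ[OF Q0, of p x] pr by auto
  then have "P (d - 1)" unfolding P_def using pr by (intro exI[of _ "{..<d}-{p}"]) auto
  define k where "k = (LEAST n. P n)"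
  have "P k" unfolding k_def using \<open>P (d - 1)\<close> by (rule LeastI)
  have "k < d" using Least_le[of P, OF \<open>P (d - 1)\<close>] pr by (simp add: k_def)
  obtain A J K where A: "card A = k" "Q A J K" using \<open>P k\<close> by (auto simp: P_def)
  have finA: "finite A" using A by (simp add: Q_def)
  have least: "\<not> Q (A - {m}) J' K'" if "m \<in> A" for m J' K'
  proof
    assume "Q (A - {m}) J' K'"
    then have "P (card (A - {m}))" unfolding P_def by blast
    then have "k \<le> card (A - {m})" unfolding k_def by (rule Least_le)
    moreover have "card (A - {m}) < k" using A that finA by (metis card_Diff1_less)
    ultimately show False by simp
  qed
  have injJ: "x m = 0" if "\<And>i. i < d \<Longrightarrow> (\<Sum>a\<in>A. J i a * x a) = 0" "m \<in> A" for x m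
    using reduceJ[OF A(2) that(2) _ that(1)] least[OF that(2)] by blast
  have surjK: "x m = 0" if "\<And>j. j < d \<Longrightarrow> (\<Sum>a\<in>A. x a * K a j) = 0" "m \<in> A" for x m
    using reduceK[OF A(2) that(2) _ that(1)] least[OF that(2)] by blast
  have KJ: "(\<Sum>i<d. K a i * J i b) = (if a = b then 1 else 0)" if ab: "a \<in> A" "b \<in> A" for a b
  proof -
    \<comment> \<open>\<open>M = K J - 1\<close> satisfies \<open>J M K = E E - E = 0\<close>;
      injectivity of \<open>J\<close> and surjectivity of \<open>K\<close> cancel the outer
      factors.\<close>
    define M where "M = (\<lambda>a b. (\<Sum>i<d. K a i * J i b) - (if a = b then 1 else 0))"
    have "(\<Sum>b\<in>A. M a b * K b j) = 0" if "j < d" "a \<in> A" for j a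
    proof (rule injJ[OF _ that(2)])
      fix i assume "i < d"
      have E: "E i' j' = (\<Sum>a\<in>A. J i' a * K a j')" if "i' < d" "j' < d" for i' j'
        using A that by (simp add: Q_def)
      have "(\<Sum>l<d. E i l * E l j) = (\<Sum>l<d. (\<Sum>a\<in>A. J i a * K a l) * (\<Sum>b\<in>A. J l b * K b j))"
        using \<open>i < d\<close> \<open>j < d\<close> by (intro sum.cong refl) (simp add: E)
      also have "\<dots> = (\<Sum>l<d. \<Sum>a\<in>A. \<Sum>b\<in>A. J i a * (K a l * J l b) * K b j)"
        unfolding sum_product by (intro sum.cong refl) (simp add: mult_ac)
      also have "\<dots> = (\<Sum>a\<in>A. \<Sum>b\<in>A. \<Sum>l<d. J i a * (K a l * J l b) * K b j)"
        by (rule trans[OF sum.swap sum.cong[OF refl sum.swap]])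
      also have "\<dots> = (\<Sum>a\<in>A. J i a * (\<Sum>b\<in>A. (\<Sum>l<d. K a l * J l b) * K b j))"
        by (simp add: sum_distrib_left sum_distrib_right mult_ac)
      finally have 1: "(\<Sum>a\<in>A. J i a * (\<Sum>b\<in>A. (\<Sum>l<d. K a l * J l b) * K b j)) = E i j"
        using idem[OF \<open>i < d\<close> \<open>j < d\<close>] by simp
      have 2: "(\<Sum>b\<in>A. M a b * K b j) = (\<Sum>b\<in>A. (\<Sum>l<d. K a l * J l b) * K b j) - K a j"
        if "a \<in> A" for a
        using that finA by (simp add: M_def left_diff_distrib sum_subtractf sum_delta)
      have "(\<Sum>a\<in>A. J i a * (\<Sum>b\<in>A. M a b * K b j))
        = (\<Sum>a\<in>A. J i a * ((\<Sum>b\<in>A. (\<Sum>l<d. K a l * J l b) * K b j) - K a j))"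
        using 2 by simp
      also have "\<dots> = E i j - E i j"
        using 1 E[OF \<open>i < d\<close> \<open>j < d\<close>] by (simp add: right_diff_distrib sum_subtractf)
      finally show "(\<Sum>a\<in>A. J i a * (\<Sum>b\<in>A. M a b * K b j)) = 0" by simp
    qed
    then have "M a b = 0" using surjK[of "M a" b] ab by blast
    then show ?thesis by (simp add: M_def)
  qed
  obtain f where f: "bij_betw f {0..<k} A" using ex_bij_betw_nat_finite[OF finA] A by auto
  then have f': "bij_betw f {..<k} A" by (simp add: lessThan_atLeast0)
  show thesis
  proof (rule that[OF \<open>k < d\<close>])
    show "E i j = (\<Sum>a<k. J i (f a) * K (f a) j)" if "i < d" "j < d" for i j
      using A that sum.reindex_bij_betw[OF f', of "\<lambda>a. J i a * K a j"] by (simp add: Q_def)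
    show "(\<Sum>i<d. K (f a) i * J i (f b)) = (if a = b then 1 else 0)" if "a < k" "b < k" for a b
      using f' that by (auto simp: KJ bij_betw_def inj_on_def)
  qed
qed

section \<open>Tensors and corepresentations of Hopf *-algebras\<close>

definition linmap :: "('a::ring_1) hopf_data \<Rightarrow> (complex \<Rightarrow> 'c \<Rightarrow> 'c) \<Rightarrow> ('a \<Rightarrow> 'c::ab_group_add) \<Rightarrow> bool" where
  "linmap H s F \<longleftrightarrow> (\<forall>x y. F (x + y) = F x + F y) \<and> (\<forall>c x. F (sc H c x) = s c (F x))"

text \<open>The scalar multiplication of the target is a parameter, so that one notion covers
  complex-valued and algebra-valued maps.\<close>

definition bilin :: "('a::ring_1) hopf_data \<Rightarrow> ('b::ring_1) hopf_data \<Rightarrow> (complex \<Rightarrow> 'c \<Rightarrow> 'c)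
    \<Rightarrow> ('a \<Rightarrow> 'b \<Rightarrow> 'c::ab_group_add) \<Rightarrow> bool" where
  "bilin H K s \<beta> \<longleftrightarrow> (\<forall>y. linmap H s (\<lambda>x. \<beta> x y)) \<and> (\<forall>x. linmap K s (\<beta> x))"

text \<open>For bilinear \<open>\<beta>\<close> this is the induced linear map on the tensor
  product, evaluated at the tensor that \<open>L\<close> represents.\<close>

definition tsum :: "('a \<Rightarrow> 'b \<Rightarrow> 'c::comm_monoid_add) \<Rightarrow> ('a \<times> 'b) list \<Rightarrow> 'c" where
  "tsum \<beta> L = sum_list (map (\<lambda>(x, y). \<beta> x y) L)"

lemma lin_fun_iff: "lin_fun H f \<longleftrightarrow> linmap H (*) f"
  by (simp add: lin_fun_def linmap_def)

lemma linmap_add: "linmap H s F \<Longrightarrow> F (x + y) = F x + F y"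
  by (simp add: linmap_def)

lemma linmap_sc: "linmap H s F \<Longrightarrow> F (sc H c x) = s c (F x)"
  by (simp add: linmap_def)

lemma linmap_0: "linmap H s F \<Longrightarrow> F 0 = 0"
  using linmap_add[of H s F 0 0] by simp

lemma linmap_minus: "linmap H s F \<Longrightarrow> F (- x) = - F x"
  using linmap_add[of H s F x "- x"] linmap_0[of H s F] by (simp add: eq_neg_iff_add_eq_0 add.commute)

lemma linmap_diff: "linmap H s F \<Longrightarrow> F (x - y) = F x - F y"
  using linmap_add[of H s F x "- y"] linmap_minus[of H s F y] by simp

lemma linmap_sum: "linmap H s F \<Longrightarrow> F (\<Sum>i\<in>I. g i) = (\<Sum>i\<in>I. F (g i))"
  by (induction I rule: infinite_finite_induct) (simp_all add: linmap_0 linmap_add)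

lemma tsum_Nil [simp]: "tsum \<beta> [] = 0"
  and tsum_Cons [simp]: "tsum \<beta> ((x, y) # L) = \<beta> x y + tsum \<beta> L"
  and tsum_append: "tsum \<beta> (L @ M) = tsum \<beta> L + tsum \<beta> M"
  by (simp_all add: tsum_def)

lemma linmap_tsum: "linmap H s F \<Longrightarrow> F (tsum \<beta> L) = tsum (\<lambda>x y. F (\<beta> x y)) L"
  by (induction L) (auto simp: linmap_0 linmap_add)

lemma tsum_add: "tsum (\<lambda>x y. \<beta> x y + \<gamma> x y) L = tsum \<beta> L + tsum \<gamma> L"
  by (induction L) (auto simp: add_ac)

lemma tsum_sum: "tsum (\<lambda>x y. \<Sum>i\<in>I. \<beta> i x y) L = (\<Sum>i\<in>I. tsum (\<beta> i) L)"
  by (induction L) (auto simp: sum.distrib)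

lemma tsum_0: "tsum (\<lambda>x y. 0) L = 0"
  by (induction L) auto

lemma tsum_mult_left: "tsum (\<lambda>x y. c * \<beta> x y) L = c * tsum \<beta> L" for c :: "'c::ring"
  by (induction L) (auto simp: distrib_left)

lemma tsum_mult_right: "tsum (\<lambda>x y. \<beta> x y * c) L = tsum \<beta> L * c" for c :: "'c::ring"
  by (induction L) (auto simp: distrib_right)

lemma tsum_map: "tsum \<beta> (map (\<lambda>(x, y). (f x y, g x y)) L) = tsum (\<lambda>x y. \<beta> (f x y) (g x y)) L"
  by (induction L) auto

lemma tsum_concat_map:
  "tsum \<beta> (concat (map (\<lambda>(x, y). M x y) L)) = tsum (\<lambda>x y. tsum \<beta> (M x y)) L"
  by (induction L) (auto simp: tsum_append)

lemma tsum_map_upt: "tsum \<beta> (map (\<lambda>k. (f k, g k)) [0..<d]) = (\<Sum>k<d. \<beta> (f k) (g k))"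
  by (induction d) (auto simp: tsum_append)

lemma bilin_left: "bilin H K s \<beta> \<Longrightarrow> linmap H s (\<lambda>x. \<beta> x y)"
  and bilin_right: "bilin H K s \<beta> \<Longrightarrow> linmap K s (\<beta> x)"
  by (simp_all add: bilin_def)

lemma teq2_tsum:
  "teq2 H K L M \<longleftrightarrow> (\<forall>f g. linmap H (*) f \<longrightarrow> linmap K (*) g \<longrightarrow>
     tsum (\<lambda>x y. f x * g y) L = tsum (\<lambda>x y. f x * g y) M)"
  by (simp add: teq2_def lin_fun_iff tsum_def)

lemma vector_space_complex: "vector_space ((*) :: complex \<Rightarrow> complex \<Rightarrow> complex)"
  by unfold_locales (auto simp: algebra_simps)

section \<open>Matrices over the algebra and corepresentations\<close>

lemma mat_cancel_right:
  fixes u :: "'i \<Rightarrow> 'i \<Rightarrow> 'r::ring_1"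
  assumes "finite I" "l \<in> I"
    and "\<And>j l. j \<in> I \<Longrightarrow> l \<in> I \<Longrightarrow> (\<Sum>k\<in>I. u j k * w k l) = (if j = l then 1 else 0)"
  shows "(\<Sum>k\<in>I. (\<Sum>j\<in>I. a j * u j k) * w k l) = a l"
proof -
  have "(\<Sum>k\<in>I. (\<Sum>j\<in>I. a j * u j k) * w k l) = (\<Sum>j\<in>I. a j * (\<Sum>k\<in>I. u j k * w k l))"
    by (simp add: sum_distrib_left sum_distrib_right mult.assoc) (rule sum.swap)
  also have "\<dots> = a l" using assms by (simp add: sum_delta cong: sum.cong)
  finally show ?thesis .
qed

lemma mat_cancel_left:
  fixes u :: "'i \<Rightarrow> 'i \<Rightarrow> 'r::ring_1"
  assumes "finite I" "j \<in> I"
    and "\<And>j l. j \<in> I \<Longrightarrow> l \<in> I \<Longrightarrow> (\<Sum>k\<in>I. w j k * u k l) = (if j = l then 1 else 0)"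
  shows "(\<Sum>k\<in>I. w j k * (\<Sum>l\<in>I. u k l * a l)) = a j"
proof -
  have "(\<Sum>k\<in>I. w j k * (\<Sum>l\<in>I. u k l * a l)) = (\<Sum>l\<in>I. (\<Sum>k\<in>I. w j k * u k l) * a l)"
    by (simp add: sum_distrib_left sum_distrib_right mult.assoc) (rule sum.swap)
  also have "\<dots> = a j" using assms by (simp add: sum_delta cong: sum.cong)
  finally show ?thesis .
qed

text \<open>Arbitrary finite index sets allow the tensor product of two corepresentations to be
  indexed by pairs.\<close>

definition corep :: "('a::ring_1) hopf_data \<Rightarrow> 'i set \<Rightarrow> ('i \<Rightarrow> 'i \<Rightarrow> 'a) \<Rightarrow> bool" where
  "corep H I v \<longleftrightarrow> finite I \<and> (\<forall>i\<in>I. \<forall>j\<in>I. \<forall>f g. linmap H (*) f \<longrightarrow> linmap H (*) g \<longrightarrow>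
      tsum (\<lambda>x y. f x * g y) (cop H (v i j)) = (\<Sum>k\<in>I. f (v i k) * g (v k j)))"

lemma corep_finite: "corep H I v \<Longrightarrow> finite I"
  by (simp add: corep_def)

lemma is_corep_iff: "is_corep H d v \<longleftrightarrow> corep H {..<d} v"
  by (auto simp: is_corep_def corep_def teq2_tsum tsum_map_upt)

definition direct_sum :: "nat \<Rightarrow> (nat \<Rightarrow> nat \<Rightarrow> 'a) \<Rightarrow> (nat \<Rightarrow> nat \<Rightarrow> 'a) \<Rightarrow> nat \<Rightarrow> nat \<Rightarrow> 'a::zero" where
  "direct_sum m u v i j = (if i < m \<and> j < m then u i j else if m \<le> i \<and> m \<le> j then v (i - m) (j - m) else 0)"

lemma direct_sum_simps [simp]:
  "i < m \<Longrightarrow> j < m \<Longrightarrow> direct_sum m u v i j = u i j"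
  "direct_sum m u v (m + i) (m + j) = v i j"
  "i < m \<Longrightarrow> direct_sum m u v i (m + j) = 0"
  "j < m \<Longrightarrow> direct_sum m u v (m + i) j = 0"
  by (simp_all add: direct_sum_def)

lemma sum_lessThan_add: "(\<Sum>k<m + n. f k) = (\<Sum>k<m. f k) + (\<Sum>k<n. f (m + k))"
  for f :: "nat \<Rightarrow> 'c::comm_monoid_add"
  by (induction n) (simp_all add: add_ac)

lemma less_add_cases:
  fixes i m n :: nat
  assumes "i < m + n"
  obtains "i < m" | i' where "i = m + i'" "i' < n"
  using assms by (metis add_less_cancel_left le_Suc_ex not_le)

locale hopf_alg =
  fixes H :: "('a::ring_1) hopf_data"
  assumes hopf: "hopf_star_algebra H"
begin

abbreviation "scl \<equiv> sc H"
abbreviation "star \<equiv> st H"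
abbreviation "S \<equiv> ant H"
abbreviation "eps \<equiv> cou H"
abbreviation "functional \<equiv> linmap H ((*) :: complex \<Rightarrow> complex \<Rightarrow> complex)"
abbreviation "cs a \<beta> \<equiv> tsum \<beta> (cop H a)"

lemma sc_add_left: "scl (c + d) x = scl c x + scl d x"
  and sc_add_right: "scl c (x + y) = scl c x + scl c y"
  and sc_sc: "scl c (scl d x) = scl (c * d) x"
  and sc_1: "scl 1 x = x"
  and sc_mult_left: "scl c x * y = scl c (x * y)"
  and sc_mult_right: "x * scl c y = scl c (x * y)"
  and star_add: "star (x + y) = star x + star y"
  and star_sc: "star (scl c x) = scl (cnj c) (star x)"
  and star_mult: "star (x * y) = star y * star x"
  and star_star: "star (star x) = x"
  and S_add: "S (x + y) = S x + S y"
  and S_sc: "S (scl c x) = scl c (S x)"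
  using hopf by (simp_all add: hopf_star_algebra_def)

sublocale vs: vector_space scl
  by unfold_locales (simp_all add: sc_add_left sc_add_right sc_sc sc_1)

lemma S_linmap: "linmap H scl S"
  by (simp add: linmap_def S_add S_sc)

lemma eps_functional: "functional eps"
  and eps_mult: "eps (x * y) = eps x * eps y"
  and eps_1: "eps 1 = 1"
  and eps_star: "eps (star x) = cnj (eps x)"
  and cs_eps_left: "cs x (\<lambda>a b. scl (eps a) b) = x"
  and cs_S_left: "cs x (\<lambda>a b. S a * b) = scl (eps x) 1"
  and cs_S_right: "cs x (\<lambda>a b. a * S b) = scl (eps x) 1"
  using hopf by (simp_all add: hopf_star_algebra_def tsum_def lin_fun_iff)

lemma star_0: "star 0 = 0"
  using star_add[of 0 0] by simp

lemma star_sum: "star (\<Sum>i\<in>I. f i) = (\<Sum>i\<in>I. star (f i))"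
  by (induction I rule: infinite_finite_induct) (simp_all add: star_0 star_add)

lemma star_tsum: "star (tsum \<beta> L) = tsum (\<lambda>x y. star (\<beta> x y)) L"
  by (induction L) (auto simp: star_0 star_add)

lemma star_1: "star 1 = 1"
  using star_mult[of 1 "star 1"] star_star[of 1] by simp

text \<open>The counit detects scalars, because it sends \<open>1\<close> to 1.\<close>

lemma sc_eq_0: "scl c 1 = 0 \<Longrightarrow> c = 0"
  using linmap_sc[OF eps_functional, of c 1] linmap_0[OF eps_functional] by (simp add: eps_1)

lemma sc_inj: "scl c 1 = scl d 1 \<Longrightarrow> c = d"
  using sc_eq_0[of "c - d"] by (simp add: vs.scale_left_diff_distrib)

lemma functional_representation:
  assumes "vs.independent B" "vs.span B = UNIV"
  shows "functional (\<lambda>x. vs.representation B x b)"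
  using assms by (simp add: linmap_def vs.representation_add vs.representation_scale)

text \<open>A nonzero vector extends to a basis, and its own coordinate is a functional that does
  not kill it.\<close>

lemma separating:
  assumes "\<And>f. functional f \<Longrightarrow> f x = 0"
  shows "x = 0"
proof (rule ccontr)
  assume "x \<noteq> 0"
  then have ind: "vs.independent {x}" by simp
  define B where "B = vs.extend_basis {x}"
  have B: "vs.independent B" "vs.span B = UNIV" "x \<in> B"
    using vs.independent_extend_basis[OF ind] vs.span_extend_basis[OF ind] vs.extend_basis_superset[OF ind]
    by (auto simp: B_def)
  have "vs.representation B x x = 0" by (rule assms) (rule functional_representation[OF B(1,2)])
  then show False using vs.representation_basis[OF B(1,3)] by simp
qed

lemma separating_eq: "(\<And>f. functional f \<Longrightarrow> f x = f y) \<Longrightarrow> x = y"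
  using separating[of "x - y"] by (simp add: linmap_diff)

text \<open>Finitely many vectors involve finitely many members of a Hamel basis, whose coordinates
  are globally defined functionals.\<close>

lemma finite_coordinates:
  assumes "finite Y"
  obtains B \<phi> where "finite B" "\<And>b. functional (\<phi> b)" "\<And>y. y \<in> Y \<Longrightarrow> (\<Sum>b\<in>B. scl (\<phi> b y) b) = y"
proof -
  define E where "E = vs.extend_basis {}"
  have E: "vs.independent E" "vs.span E = UNIV"
    using vs.independent_extend_basis[of "{}"] vs.span_extend_basis[of "{}"] by (auto simp: E_def vs.independent_empty)
  define B where "B = (\<Union>y\<in>Y. {b. vs.representation E y b \<noteq> 0})"
  have fin: "finite B" unfolding B_def using assms vs.finite_representation by blast
  have "(\<Sum>b\<in>B. scl (vs.representation E y b) b) = y" if "y \<in> Y" for y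
  proof -
    have "(\<Sum>b\<in>B. scl (vs.representation E y b) b) = (\<Sum>b | vs.representation E y b \<noteq> 0. scl (vs.representation E y b) b)"
      by (rule sum.mono_neutral_right[OF fin]) (use that in \<open>auto simp: B_def\<close>)
    also have "\<dots> = y" by (rule vs.sum_nonzero_representation_eq) (use E in auto)
    finally show ?thesis .
  qed
  with fin functional_representation[OF E] that[of B "\<lambda>b y. vs.representation E y b"] show ?thesis by blast
qed

end

text \<open>Tensor equality only tests products \<open>f x * g y\<close>. Expanding the first legs
  in finite coordinates reduces a bilinear map to finitely many slices in the second algebra, and
  functionals separate those.\<close>

lemma teq2_bilin:
  assumes "hopf_alg H" "hopf_alg K" and teq: "teq2 H K L M" and \<beta>: "bilin H K s \<beta>"
  shows "tsum \<beta> L = tsum \<beta> M"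
proof -
  interpret A: hopf_alg H by fact
  interpret B: hopf_alg K by fact
  have cut: "tsum (\<lambda>x y. sc K (f x) y) L = tsum (\<lambda>x y. sc K (f x) y) M" if f: "A.functional f" for f
  proof (rule B.separating_eq)
    fix g assume g: "B.functional g"
    show "g (tsum (\<lambda>x y. sc K (f x) y) L) = g (tsum (\<lambda>x y. sc K (f x) y) M)"
      using teq f g by (simp add: linmap_tsum[OF g] linmap_sc[OF g] teq2_tsum)
  qed
  obtain B \<phi> where B: "finite B" and \<phi>: "\<And>b. A.functional (\<phi> b)"
    and exp: "\<And>x. x \<in> fst ` (set L \<union> set M) \<Longrightarrow> (\<Sum>b\<in>B. sc H (\<phi> b x) b) = x"
    using A.finite_coordinates[of "fst ` (set L \<union> set M)"] by blast
  have *: "tsum \<beta> L' = (\<Sum>b\<in>B. \<beta> b (tsum (\<lambda>x y. sc K (\<phi> b x) y) L'))"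
    if "set L' \<subseteq> set L \<union> set M" for L'
    using that
  proof (induction L')
    case Nil
    then show ?case by (simp add: linmap_0[OF bilin_right[OF \<beta>]])
  next
    case (Cons a L')
    obtain x y where a: "a = (x, y)" by force
    have "x \<in> fst ` (set L \<union> set M)" using Cons.prems a by force
    then have "\<beta> x y = \<beta> (\<Sum>b\<in>B. sc H (\<phi> b x) b) y" by (simp only: exp)
    also have "\<dots> = (\<Sum>b\<in>B. \<beta> b (sc K (\<phi> b x) y))"
      by (simp add: linmap_sum[OF bilin_left[OF \<beta>]] linmap_sc[OF bilin_left[OF \<beta>]] linmap_sc[OF bilin_right[OF \<beta>]])
    finally show ?case using Cons by (simp add: a linmap_add[OF bilin_right[OF \<beta>]] sum.distrib)
  qed
  show ?thesis using *[of L] *[of M] cut[OF \<phi>] by simp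
qed

context hopf_alg
begin

lemma cs_linmap:
  assumes "vector_space s" "bilin H H s \<beta>"
  shows "linmap H s (\<lambda>a. cs a \<beta>)"
proof -
  interpret V: vector_space s by fact
  have "cs (x + y) \<beta> = cs x \<beta> + cs y \<beta>" for x y
  proof -
    have "teq2 H H (cop H (x + y)) (cop H x @ cop H y)" using hopf by (simp add: hopf_star_algebra_def)
    from teq2_bilin[OF hopf_alg_axioms hopf_alg_axioms this assms(2)] show ?thesis by (simp add: tsum_append)
  qed
  moreover have "cs (scl c x) \<beta> = s c (cs x \<beta>)" for c x
  proof -
    have "teq2 H H (cop H (scl c x)) (map (\<lambda>(a, b). (scl c a, b)) (cop H x))"
      using hopf by (simp add: hopf_star_algebra_def)
    from teq2_bilin[OF hopf_alg_axioms hopf_alg_axioms this assms(2)]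
    have "cs (scl c x) \<beta> = tsum (\<lambda>a b. s c (\<beta> a b)) (cop H x)"
      by (simp add: tsum_map linmap_sc[OF bilin_left[OF assms(2)]])
    also have "tsum (\<lambda>a b. s c (\<beta> a b)) L = s c (tsum \<beta> L)" for L
      by (induction L) (auto simp: V.scale_right_distrib)
    finally show ?thesis .
  qed
  ultimately show ?thesis by (simp add: linmap_def)
qed

lemma cs_functional: "bilin H H (*) \<beta> \<Longrightarrow> functional (\<lambda>a. cs a \<beta>)"
  by (rule cs_linmap[OF vector_space_complex])

lemma cs_mult:
  assumes "bilin H H s \<beta>"
  shows "cs (x * y) \<beta> = cs x (\<lambda>a b. cs y (\<lambda>a' b'. \<beta> (a * a') (b * b')))"
proof -
  have "teq2 H H (cop H (x * y))
      (concat (map (\<lambda>(a, b). map (\<lambda>(a', b'). (a * a', b * b')) (cop H y)) (cop H x)))"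
    using hopf by (simp add: hopf_star_algebra_def)
  from teq2_bilin[OF hopf_alg_axioms hopf_alg_axioms this assms] show ?thesis
    by (simp add: tsum_concat_map tsum_map)
qed

lemma cs_1:
  assumes "bilin H H s \<beta>"
  shows "cs 1 \<beta> = \<beta> 1 1"
proof -
  have "teq2 H H (cop H 1) [(1, 1)]" using hopf by (simp add: hopf_star_algebra_def)
  from teq2_bilin[OF hopf_alg_axioms hopf_alg_axioms this assms] show ?thesis by simp
qed

lemma cs_star:
  assumes "bilin H H s \<beta>"
  shows "cs (star x) \<beta> = cs x (\<lambda>a b. \<beta> (star a) (star b))"
proof -
  have "teq2 H H (cop H (star x)) (map (\<lambda>(a, b). (star a, star b)) (cop H x))"
    using hopf by (simp add: hopf_star_algebra_def)
  from teq2_bilin[OF hopf_alg_axioms hopf_alg_axioms this assms] show ?thesis by (simp add: tsum_map)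
qed

lemma cs_corep:
  assumes v: "corep H I v" and \<beta>: "bilin H H s \<beta>" and ij: "i \<in> I" "j \<in> I"
  shows "cs (v i j) \<beta> = (\<Sum>k\<in>I. \<beta> (v i k) (v k j))"
proof -
  obtain xs where xs: "set xs = I" "distinct xs" using finite_distinct_list[OF corep_finite[OF v]] by blast
  have map: "tsum \<gamma> (map (\<lambda>k. (v i k, v k j)) xs) = (\<Sum>k\<in>I. \<gamma> (v i k) (v k j))"
    for \<gamma> :: "'a \<Rightarrow> 'a \<Rightarrow> 'd::comm_monoid_add"
    using xs by (simp add: tsum_def o_def sum_list_distinct_conv_sum_set)
  have "teq2 H H (cop H (v i j)) (map (\<lambda>k. (v i k, v k j)) xs)"
    unfolding teq2_tsum map using v ij by (simp add: corep_def)
  from teq2_bilin[OF hopf_alg_axioms hopf_alg_axioms this \<beta>] map[of \<beta>] show ?thesis by simp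
qed

lemma bilin_functional_prod: "functional f \<Longrightarrow> functional g \<Longrightarrow> bilin H H (*) (\<lambda>x y. f x * g y)"
  by (simp add: bilin_def linmap_def algebra_simps)

lemma corep_prod:
  assumes u: "corep H I u" and v: "corep H J v"
  shows "corep H (I \<times> J) (\<lambda>p q. u (fst p) (fst q) * v (snd p) (snd q))"
proof -
  have "cs (u i j * v k l) (\<lambda>x y. f x * g y) = (\<Sum>p\<in>I \<times> J. f (u i (fst p) * v k (snd p)) * g (u (fst p) j * v (snd p) l))"
    if "i \<in> I" "j \<in> I" "k \<in> J" "l \<in> J" "functional f" "functional g" for i j k l f g
  proof -
    have 1: "bilin H H (*) (\<lambda>a' b'. f (a * a') * g (b * b'))" for a b
      using that(5,6) by (simp add: bilin_def linmap_def distrib_left distrib_right sc_mult_right)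
    have 2: "bilin H H (*) (\<lambda>a b. \<Sum>m\<in>J. f (a * v k m) * g (b * v m l))"
      using that(5,6) by (simp add: bilin_def linmap_def distrib_left distrib_right sc_mult_left sum.distrib
        sum_distrib_left mult_ac)
    have "cs (u i j * v k l) (\<lambda>x y. f x * g y) = cs (u i j) (\<lambda>a b. \<Sum>m\<in>J. f (a * v k m) * g (b * v m l))"
      by (simp add: cs_mult[OF bilin_functional_prod[OF that(5,6)]] cs_corep[OF v 1 that(3,4)])
    also have "\<dots> = (\<Sum>n\<in>I. \<Sum>m\<in>J. f (u i n * v k m) * g (u n j * v m l))"
      by (rule cs_corep[OF u 2 that(1,2)])
    also have "\<dots> = (\<Sum>p\<in>I \<times> J. f (u i (fst p) * v k (snd p)) * g (u (fst p) j * v (snd p) l))"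
      by (simp add: sum.cartesian_product split_def)
    finally show ?thesis .
  qed
  then show ?thesis using u v by (auto simp: corep_def)
qed

lemma corep_star:
  assumes "corep H I v"
  shows "corep H I (\<lambda>i j. star (v i j))"
proof -
  have "cs (star (v i j)) (\<lambda>x y. f x * g y) = (\<Sum>k\<in>I. f (star (v i k)) * g (star (v k j)))"
    if ij: "i \<in> I" "j \<in> I" and f: "functional f" and g: "functional g" for i j f g
  proof -
    \<comment> \<open>\<open>star\<close> is antilinear; the outer conjugation makes these
      functionals complex linear again.\<close>
    define f' g' where "f' = (\<lambda>x. cnj (f (star x)))" and "g' = (\<lambda>x. cnj (g (star x)))"
    have "functional f'" "functional g'"
      using f g by (simp_all add: linmap_def f'_def g'_def star_add star_sc)
    then have "cs (v i j) (\<lambda>x y. f' x * g' y) = (\<Sum>k\<in>I. f' (v i k) * g' (v k j))"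
      using assms ij by (simp add: corep_def)
    then have "cnj (cs (v i j) (\<lambda>x y. f' x * g' y)) = cnj (\<Sum>k\<in>I. f' (v i k) * g' (v k j))" by simp
    moreover have "cnj (tsum (\<lambda>x y. f' x * g' y) L) = tsum (\<lambda>x y. f (star x) * g (star y)) L" for L
      by (induction L) (auto simp: f'_def g'_def)
    ultimately show ?thesis
      by (simp add: cs_star[OF bilin_functional_prod[OF f g]] f'_def g'_def)
  qed
  then show ?thesis using corep_finite[OF assms] by (simp add: corep_def)
qed

lemma corep_counit:
  assumes v: "corep H I v" and "i \<in> I" "j \<in> I"
  shows "(\<Sum>k\<in>I. scl (eps (v i k)) (v k j)) = v i j"
    and "(\<Sum>k\<in>I. S (v i k) * v k j) = scl (eps (v i j)) 1"
    and "(\<Sum>k\<in>I. v i k * S (v k j)) = scl (eps (v i j)) 1"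
proof -
  have "bilin H H scl (\<lambda>a b. scl (eps a) b)"
    using eps_functional by (simp add: bilin_def linmap_def sc_add_left sc_add_right sc_sc mult.commute)
  from cs_corep[OF v this assms(2,3)] show "(\<Sum>k\<in>I. scl (eps (v i k)) (v k j)) = v i j"
    by (simp add: cs_eps_left)
  have "bilin H H scl (\<lambda>a b. S a * b)"
    by (simp add: bilin_def linmap_def S_add S_sc distrib_left distrib_right sc_mult_left sc_mult_right)
  from cs_corep[OF v this assms(2,3)] show "(\<Sum>k\<in>I. S (v i k) * v k j) = scl (eps (v i j)) 1"
    by (simp add: cs_S_left)
  have "bilin H H scl (\<lambda>a b. a * S b)"
    by (simp add: bilin_def linmap_def S_add S_sc distrib_left distrib_right sc_mult_left sc_mult_right)
  from cs_corep[OF v this assms(2,3)] show "(\<Sum>k\<in>I. v i k * S (v k j)) = scl (eps (v i j)) 1"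
    by (simp add: cs_S_right)
qed

text \<open>Invertibility is expressed by the counit, so that no inverse matrix has to be carried
  along: it is \<open>S\<close> applied entrywise.\<close>

definition invertible_corep :: "'i set \<Rightarrow> ('i \<Rightarrow> 'i \<Rightarrow> 'a) \<Rightarrow> bool" where
  "invertible_corep I v \<longleftrightarrow> corep H I v \<and> (\<forall>i\<in>I. \<forall>j\<in>I. eps (v i j) = (if i = j then 1 else 0))"

lemma invertible_corepD:
  assumes "invertible_corep I v" 
  shows "corep H I v" "finite I"
    and "i \<in> I \<Longrightarrow> j \<in> I \<Longrightarrow> eps (v i j) = (if i = j then 1 else 0)"
    and "i \<in> I \<Longrightarrow> j \<in> I \<Longrightarrow> (\<Sum>k\<in>I. S (v i k) * v k j) = (if i = j then 1 else 0)"
    and "i \<in> I \<Longrightarrow> j \<in> I \<Longrightarrow> (\<Sum>k\<in>I. v i k * S (v k j)) = (if i = j then 1 else 0)"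
  using assms corep_counit[of I v i j] corep_finite[of H I v]
  by (auto simp: invertible_corep_def sc_1)

text \<open>The counit law reads \<open>eps(v) v = v\<close>, so cancelling an invertible
  \<open>v\<close> leaves \<open>eps(v) = 1\<close>. Conversely, under \<open>eps(v) = 1\<close> the
  antipode law makes \<open>S(v)\<close> the inverse.\<close>

lemma representation_iff:
  "representation H d v \<longleftrightarrow> invertible_corep {..<d} v"
proof
  assume rep: "representation H d v"
  then have v: "corep H {..<d} v" by (simp add: representation_def is_corep_iff)
  obtain w where w: "\<And>i j. i < d \<Longrightarrow> j < d \<Longrightarrow> (\<Sum>k<d. v i k * w k j) = (if i = j then 1 else 0)"
    using rep by (auto simp: representation_def)
  have "eps (v i j) = (if i = j then 1 else 0)" if ij: "i < d" "j < d" for i j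
  proof -
    have "(\<Sum>l<d. (\<Sum>k<d. scl (eps (v i k)) 1 * v k l) * w l j) = scl (eps (v i j)) 1"
      by (rule mat_cancel_right) (use w ij in auto)
    moreover have "(\<Sum>k<d. scl (eps (v i k)) 1 * v k l) = v i l" if "l < d" for l
      using corep_counit(1)[OF v, of i l] ij that by (simp add: sc_mult_left)
    ultimately have "scl (eps (v i j)) 1 = (if i = j then 1 else 0)" using w[OF ij] by simp
    then show ?thesis using sc_inj[of "eps (v i j)" "if i = j then 1 else 0"] by (auto simp: sc_1 split: if_splits)
  qed
  with v show "invertible_corep {..<d} v" by (simp add: invertible_corep_def)
next
  assume v: "invertible_corep {..<d} v"
  then show "representation H d v" unfolding representation_def is_corep_iff
    using invertible_corepD[OF v] by (intro conjI exI[of _ "\<lambda>i j. S (v i j)"]) auto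
qed

lemma unitary_invertible: "unitary_rep H d u \<Longrightarrow> invertible_corep {..<d} u"
  unfolding representation_iff[symmetric] unitary_rep_def representation_def
  by (intro conjI exI[of _ "\<lambda>i j. star (u j i)"]) auto

lemma unitary_orth:
  assumes "unitary_rep H d u" "i < d" "j < d"
  shows "(\<Sum>k<d. star (u k i) * u k j) = (if i = j then 1 else 0)"
    and "(\<Sum>k<d. u i k * star (u j k)) = (if i = j then 1 else 0)"
  using assms by (auto simp: unitary_rep_def)

text \<open>\<open>S(u)\<close> and the adjoint of \<open>u\<close> are both inverse to
  \<open>u\<close>.\<close>

lemma S_unitary:
  assumes u: "unitary_rep H d u" and ij: "i < d" "j < d"
  shows "S (u i j) = star (u j i)"
proof -
  have "(\<Sum>k<d. (\<Sum>l<d. S (u i l) * u l k) * star (u j k)) = S (u i j)"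
    by (rule mat_cancel_right) (use unitary_orth[OF u] ij in auto)
  moreover have "(\<Sum>l<d. S (u i l) * u l k) = (if i = k then 1 else 0)" if "k < d" for k
    using invertible_corepD(4)[OF unitary_invertible[OF u], of i k] ij that by simp
  ultimately have "S (u i j) = (\<Sum>k<d. (if i = k then 1 else 0) * star (u j k))" by simp
  then show ?thesis using ij by (simp add: sum_delta)
qed

lemma unitary_direct_sum:
  assumes u: "unitary_rep H m u" and v: "unitary_rep H n v"
  shows "unitary_rep H (m + n) (direct_sum m u v)"
proof -
  have cu: "corep H {..<m} u" and cv: "corep H {..<n} v"
    using u v by (simp_all add: unitary_rep_def is_corep_iff)
  have z: "functional f \<Longrightarrow> f 0 = 0" for f by (rule linmap_0)
  have c0: "cs 0 (\<lambda>x y. f x * g y) = 0" if "functional f" "functional g" for f g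
    by (rule linmap_0[OF cs_functional[OF bilin_functional_prod[OF that]]])
  have "corep H {..<m + n} (direct_sum m u v)"
    unfolding corep_def
    by (auto simp: sum_lessThan_add c0 z elim!: less_add_cases) (use cu cv in \<open>auto simp: corep_def\<close>)
  moreover have "(\<Sum>k<m + n. star (direct_sum m u v k i) * direct_sum m u v k j) = (if i = j then 1 else 0)"
     "(\<Sum>k<m + n. direct_sum m u v i k * star (direct_sum m u v j k)) = (if i = j then 1 else 0)"
     if "i < m + n" "j < m + n" for i j
    using that unitary_orth[OF u] unitary_orth[OF v]
    by (auto simp: sum_lessThan_add star_0 elim!: less_add_cases)
  ultimately show ?thesis by (simp add: unitary_rep_def is_corep_iff)
qed

end

section \<open>CQG algebras and invariant functionals\<close>

locale cqg_alg = hopf_alg +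
  assumes coefficients_span: "lin_span H {v i j | v d i j. unitary_rep H d v \<and> i < d \<and> j < d} = UNIV"
begin

lemma coefficient_induct [case_names zero coef add scale]:
  assumes "P 0" and "\<And>d u i j. unitary_rep H d u \<Longrightarrow> i < d \<Longrightarrow> j < d \<Longrightarrow> P (u i j)"
    and "\<And>x y. P x \<Longrightarrow> P y \<Longrightarrow> P (x + y)" and "\<And>c x. P x \<Longrightarrow> P (scl c x)"
  shows "P a"
proof -
  have "a \<in> lin_span H {v i j | v d i j. unitary_rep H d v \<and> i < d \<and> j < d}"
    by (simp add: coefficients_span)
  then show ?thesis by (induction rule: lin_span.induct) (use assms in auto)
qed

lemma linmap_eq_on_coefficients:
  assumes "linmap H s F" "linmap H s G"
    and "\<And>d u i j. unitary_rep H d u \<Longrightarrow> i < d \<Longrightarrow> j < d \<Longrightarrow> F (u i j) = G (u i j)"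
  shows "F a = G a"
  by (induction a rule: coefficient_induct)
     (use assms(3) in \<open>auto simp: linmap_0[OF assms(1)] linmap_0[OF assms(2)] linmap_add[OF assms(1)]
        linmap_add[OF assms(2)] linmap_sc[OF assms(1)] linmap_sc[OF assms(2)]\<close>)

text \<open>Direct sums merge several coefficients into a single one between two vectors. The
  rank-one shape of the weights is what allows the positivity proof to split off
  \<open>\<eta>\<close>.\<close>

lemma elementary_coefficient:
  obtains d u \<xi> \<eta> where "unitary_rep H d u" "a = (\<Sum>i<d. \<Sum>j<d. scl (\<xi> i * \<eta> j) (u i j))"
proof -
  have "\<exists>d u \<xi> \<eta>. unitary_rep H d u \<and> a = (\<Sum>i<d. \<Sum>j<d. scl (\<xi> i * \<eta> j) (u i j))"
  proof (induction a rule: coefficient_induct)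
    case zero
    have "unitary_rep H 0 (\<lambda>_ _. 0)" by (simp add: unitary_rep_def is_corep_def)
    then show ?case by (intro exI) auto
  next
    case (coef d u i j)
    have "(\<Sum>k<d. \<Sum>l<d. scl ((if k = i then 1 else 0) * (if l = j then 1 else 0)) (u k l))
      = (\<Sum>k<d. \<Sum>l<d. if l = j then (if k = i then u k l else 0) else 0)"
      by (intro sum.cong refl) (simp add: sc_1)
    also have "\<dots> = u i j" using coef by (simp add: sum.delta)
    finally show ?case using coef(1)
      by (intro exI[of _ d] exI[of _ u] exI[of _ "\<lambda>k. if k = i then 1 else 0"]
          exI[of _ "\<lambda>l. if l = j then 1 else 0"] conjI) (simp_all only:)
  next
    case (add x y)
    then obtain m u \<xi> \<eta> n v \<xi>' \<eta>' where u: "unitary_rep H m u" "x = (\<Sum>i<m. \<Sum>j<m. scl (\<xi> i * \<eta> j) (u i j))"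
      and v: "unitary_rep H n v" "y = (\<Sum>i<n. \<Sum>j<n. scl (\<xi>' i * \<eta>' j) (v i j))" by blast
    \<comment> \<open>Concatenated vectors: the mixed terms meet only the zero off-diagonal blocks
      of the direct sum.\<close>
    let ?\<xi> = "\<lambda>i. if i < m then \<xi> i else \<xi>' (i - m)"
    let ?\<eta> = "\<lambda>i. if i < m then \<eta> i else \<eta>' (i - m)"
    have "x + y = (\<Sum>i<m + n. \<Sum>j<m + n. scl (?\<xi> i * ?\<eta> j) (direct_sum m u v i j))"
      by (simp add: sum_lessThan_add u v)
    with unitary_direct_sum[OF u(1) v(1)] show ?case by (intro exI conjI)
  next
    case (scale c x)
    then obtain d u \<xi> \<eta> where u: "unitary_rep H d u" "x = (\<Sum>i<d. \<Sum>j<d. scl (\<xi> i * \<eta> j) (u i j))" by blast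
    then have "scl c x = (\<Sum>i<d. \<Sum>j<d. scl ((c * \<xi> i) * \<eta> j) (u i j))"
      by (simp add: vs.scale_sum_right sc_sc mult.assoc)
    with u(1) show ?case by (intro exI[of _ d] exI[of _ u] exI[of _ "\<lambda>i. c * \<xi> i"] exI[of _ \<eta>]) simp
  qed
  with that show thesis by blast
qed

section \<open>The antipode of a CQG algebra\<close>

text \<open>For coefficients of \<open>u\<close> and \<open>v\<close>, the matrix of all
  \<open>S (u i j * v k l)\<close> is a left inverse of the tensor product of \<open>u\<close> and
  \<open>v\<close>. Cancelling \<open>v\<close> and then \<open>u\<close> from the right leaves the
  reversed product.\<close>

lemma S_mult: "S (x * y) = S y * S x"
proof -
  have lin1: "linmap H scl (\<lambda>y. S (x * y))" "linmap H scl (\<lambda>y. S y * S x)"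
    "linmap H scl (\<lambda>x. S (x * y))" "linmap H scl (\<lambda>x. S y * S x)" for x y
    by (simp_all add: linmap_def distrib_left distrib_right S_add S_sc sc_mult_left sc_mult_right)
  have coef: "S (u i j * v k l) = S (v k l) * S (u i j)"
    if u: "unitary_rep H d u" and v: "unitary_rep H e v" and ij: "i < d" "j < d" and kl: "k < e" "l < e"
    for d u e v i j k l
  proof -
    note U = invertible_corepD[OF unitary_invertible[OF u]]
    note V = invertible_corepD[OF unitary_invertible[OF v]]
    have prod: "(\<Sum>q<d. \<Sum>r<e. S (u i q * v k r) * (u q m * v r n)) = (if i = m \<and> k = n then 1 else 0)"
      if "m < d" "n < e" for m n
    proof -
      have "(\<Sum>p\<in>{..<d}\<times>{..<e}. S (u i (fst p) * v k (snd p)) * (u (fst p) m * v (snd p) n)) = scl (eps (u i m * v k n)) 1"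
        using corep_counit(2)[OF corep_prod[OF U(1) V(1)], of "(i,k)" "(m,n)"] ij kl that by simp
      then show ?thesis using ij kl that
        by (simp add: sum.cartesian_product split_def eps_mult U(3) V(3) sc_1)
    qed
    have 1: "(\<Sum>q<d. S (u i q * v k r) * u q m) = (if i = m then S (v k r) else 0)" if "m < d" "r < e" for m r
    proof -
      have "(\<Sum>n<e. (\<Sum>r<e. (\<Sum>q<d. S (u i q * v k r) * u q m) * v r n) * S (v n r)) = (\<Sum>q<d. S (u i q * v k r) * u q m)"
        by (rule mat_cancel_right) (use V(5) that in auto)
      moreover have "(\<Sum>r<e. (\<Sum>q<d. S (u i q * v k r) * u q m) * v r n) = (if i = m then (if k = n then 1 else 0) else 0)" if "n < e" for n
      proof -
        have "(\<Sum>r<e. (\<Sum>q<d. S (u i q * v k r) * u q m) * v r n) = (\<Sum>q<d. \<Sum>r<e. S (u i q * v k r) * (u q m * v r n))"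
          unfolding sum_distrib_right mult.assoc by (rule sum.swap)
        then show ?thesis using prod[OF \<open>m < d\<close> that] by simp
      qed
      ultimately have "(\<Sum>q<d. S (u i q * v k r) * u q m) = (\<Sum>n<e. (if i = m then (if k = n then 1 else 0) else 0) * S (v n r))"
        by simp
      then show ?thesis using kl by (simp add: sum_delta)
    qed
    have "(\<Sum>m<d. (\<Sum>q<d. S (u i q * v k l) * u q m) * S (u m j)) = S (u i j * v k l)"
      by (rule mat_cancel_right) (use U(5) ij in auto)
    moreover have "(\<Sum>m<d. (\<Sum>q<d. S (u i q * v k l) * u q m) * S (u m j)) = (\<Sum>m<d. if i = m then S (v k l) * S (u m j) else 0)"
      using 1 kl by (intro sum.cong refl) simp
    ultimately show ?thesis using ij by (simp add: sum.delta)
  qed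
  have "S (u i j * y) = S y * S (u i j)" if u: "unitary_rep H d u" "i < d" "j < d" for d u i j
    by (rule linmap_eq_on_coefficients[where F = "\<lambda>y. S (u i j * y)" and G = "\<lambda>y. S y * S (u i j)", OF lin1(1,2)])
       (rule coef[OF u(1) _ u(2,3)])
  then show ?thesis
    by (rule linmap_eq_on_coefficients[where F = "\<lambda>x. S (x * y)" and G = "\<lambda>x. S y * S x", OF lin1(3,4)])
qed

text \<open>For unitary \<open>u\<close> the entries of \<open>S(u)\<close> are stars of transposed
  entries, so the compatibility of the coproduct with \<open>star\<close> produces the flip.\<close>

lemma cs_S:
  assumes s: "vector_space s" and \<beta>: "bilin H H s \<beta>"
  shows "cs (S a) \<beta> = cs a (\<lambda>x y. \<beta> (S y) (S x))"
proof -
  have b2: "bilin H H s (\<lambda>x y. \<beta> (S y) (S x))"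
    using \<beta> by (simp add: bilin_def linmap_def S_add S_sc)
  have "linmap H s (\<lambda>a. cs (S a) \<beta>)"
    using cs_linmap[OF s \<beta>] by (simp add: linmap_def S_add S_sc)
  moreover have "cs (S (u i j)) \<beta> = cs (u i j) (\<lambda>x y. \<beta> (S y) (S x))"
    if u: "unitary_rep H d u" and ij: "i < d" "j < d" for d u i j
  proof -
    have c: "corep H {..<d} u" using u by (simp add: unitary_rep_def is_corep_iff)
    show ?thesis using ij
      by (simp add: S_unitary[OF u] cs_corep[OF corep_star[OF c] \<beta>] cs_corep[OF c b2])
  qed
  ultimately show ?thesis
    by (rule linmap_eq_on_coefficients[where F = "\<lambda>a. cs (S a) \<beta>" and G = "\<lambda>a. cs a (\<lambda>x y. \<beta> (S y) (S x))",
        OF _ cs_linmap[OF s b2]])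
qed

text \<open>The contragredient: the transpose compensates for the reversal of the coproduct by
  \<open>S\<close>.\<close>

lemma corep_S:
  assumes "corep H I v"
  shows "corep H I (\<lambda>i j. S (v j i))"
proof -
  have "cs (S (v j i)) (\<lambda>x y. f x * g y) = (\<Sum>k\<in>I. f (S (v k i)) * g (S (v j k)))"
    if "i \<in> I" "j \<in> I" and f: "functional f" and g: "functional g" for i j f g
  proof -
    have "bilin H H (*) (\<lambda>x y. f (S y) * g (S x))"
      using f g by (simp add: bilin_def linmap_def S_add S_sc algebra_simps)
    from cs_corep[OF assms this that(2,1)] show ?thesis
      by (simp add: cs_S[OF vector_space_complex bilin_functional_prod[OF f g]])
  qed
  then show ?thesis using corep_finite[OF assms] by (simp add: corep_def)
qed

text \<open>The inverse of the antipode in a Hopf *-algebra.\<close>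

definition S_inv :: "'a \<Rightarrow> 'a" where "S_inv a = star (S (star a))"

lemma S_inv_linmap: "linmap H scl S_inv"
  by (simp add: linmap_def S_inv_def star_add star_sc S_add S_sc)

lemma S_inv_S: "S_inv (S a) = a"
proof (rule linmap_eq_on_coefficients[where G = "\<lambda>a. a"])
  show "linmap H scl (\<lambda>a. S_inv (S a))"
    using S_inv_linmap by (simp add: linmap_def S_add S_sc)
qed (simp_all add: linmap_def S_unitary S_inv_def star_star)

text \<open>This is the star of the antipode law for \<open>star a\<close>.\<close>

lemma cs_S_inv: "cs a (\<lambda>x y. S_inv y * x) = scl (eps a) 1"
proof -
  have "bilin H H scl (\<lambda>a b. a * S b)"
    by (simp add: bilin_def linmap_def S_add S_sc distrib_left distrib_right sc_mult_left sc_mult_right)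
  from cs_star[OF this, of a] have "cs a (\<lambda>x y. star x * S (star y)) = scl (cnj (eps a)) 1"
    by (simp add: cs_S_right eps_star)
  then have "star (cs a (\<lambda>x y. star x * S (star y))) = scl (eps a) 1"
    by (simp add: star_sc star_1)
  then show ?thesis by (simp add: star_tsum star_mult star_star S_inv_def)
qed

section \<open>Invariant functionals: uniqueness and local version\<close>

text \<open>\<open>haar_state\<close> minus positivity, which \<open>invariant_positive\<close>
  derives from this property.\<close>

definition invariant :: "('a \<Rightarrow> complex) \<Rightarrow> bool" where
  "invariant h \<longleftrightarrow> functional h \<and> h 1 = 1 \<and>
     (\<forall>a. cs a (\<lambda>x y. scl (h x) y) = scl (h a) 1) \<and> (\<forall>a. cs a (\<lambda>x y. scl (h y) x) = scl (h a) 1)"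

lemma bilin_left_slice: "functional h \<Longrightarrow> bilin H H scl (\<lambda>x y. scl (h x) y)"
  and bilin_right_slice: "functional h \<Longrightarrow> bilin H H scl (\<lambda>x y. scl (h y) x)"
  by (simp_all add: bilin_def linmap_def sc_add_left sc_add_right sc_sc mult.commute)

lemma invariant_corep:
  assumes "invariant h" "corep H I v" "i \<in> I" "j \<in> I"
  shows "(\<Sum>k\<in>I. scl (h (v i k)) (v k j)) = scl (h (v i j)) 1"
    and "(\<Sum>k\<in>I. scl (h (v k j)) (v i k)) = scl (h (v i j)) 1"
  using assms cs_corep[OF assms(2) bilin_left_slice[of h] assms(3,4)]
    cs_corep[OF assms(2) bilin_right_slice[of h] assms(3,4)]
  by (simp_all add: invariant_def)

lemma invariant_corep_functional:
  assumes h: "invariant h" and v: "corep H I v" "i \<in> I" "j \<in> I" and f: "functional f"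
  shows "(\<Sum>k\<in>I. h (v i k) * f (v k j)) = h (v i j) * f 1"
    and "(\<Sum>k\<in>I. f (v i k) * h (v k j)) = f 1 * h (v i j)"
  using arg_cong[OF invariant_corep(1)[OF h v], of f] arg_cong[OF invariant_corep(2)[OF h v], of f]
  by (simp_all add: linmap_sum[OF f] linmap_sc[OF f] mult.commute)

text \<open>The convolution of \<open>h\<close> and \<open>k\<close> collapses to \<open>h\<close>
  by invariance of \<open>h\<close> and to \<open>k\<close> by invariance of
  \<open>k\<close>.\<close>

lemma invariant_unique:
  assumes "invariant h" "invariant k"
  shows "h = k"
proof
  have lin: "functional h" "functional k" using assms by (simp_all add: invariant_def)
  show "h a = k a" for a
  proof (rule linmap_eq_on_coefficients[OF lin])
    fix d u i j assume u: "unitary_rep H d u" "i < d" "j < (d::nat)"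
    have c: "corep H {..<d} u" using u by (simp add: unitary_rep_def is_corep_iff)
    have "h (u i j) = (\<Sum>l<d. h (u i l) * k (u l j))"
      using invariant_corep_functional(1)[OF assms(1) c _ _ lin(2), of i j] u assms(2) by (simp add: invariant_def)
    also have "\<dots> = k (u i j)"
      using invariant_corep_functional(2)[OF assms(2) c _ _ lin(1), of i j] u assms(1) by (simp add: invariant_def)
    finally show "h (u i j) = k (u i j)" .
  qed
qed

text \<open>The conjugate of \<open>h (star a)\<close> is again an invariant functional of
  \<open>a\<close>, so uniqueness applies.\<close>

lemma invariant_star:
  assumes "invariant h"
  shows "h (star a) = cnj (h a)"
proof -
  define k where "k = (\<lambda>a. cnj (h (star a)))"
  have h: "functional h" using assms by (simp add: invariant_def)
  have k: "functional k" using h by (simp add: k_def linmap_def star_add star_sc)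
  have "cs a (\<lambda>x y. scl (k x) y) = scl (k a) 1" "cs a (\<lambda>x y. scl (k y) x) = scl (k a) 1" for a
  proof -
    have "star (cs (star a) (\<lambda>x y. scl (h x) y)) = scl (k a) 1"
      "star (cs (star a) (\<lambda>x y. scl (h y) x)) = scl (k a) 1"
      using assms by (simp_all add: invariant_def star_sc star_1 k_def)
    then show "cs a (\<lambda>x y. scl (k x) y) = scl (k a) 1" "cs a (\<lambda>x y. scl (k y) x) = scl (k a) 1"
      by (simp_all add: cs_star[OF bilin_left_slice[OF h]] cs_star[OF bilin_right_slice[OF h]] star_tsum star_sc star_star k_def)
  qed
  then have "invariant k" using k assms by (simp add: invariant_def k_def star_1)
  from fun_cong[OF invariant_unique[OF assms this], of "star a"] show ?thesis by (simp add: k_def star_star)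
qed

text \<open>Invariance on the coefficients of a single representation, a finite-dimensional problem
  that determines the values there. The global functional is glued from such pieces.\<close>

definition invariant_on :: "('a \<Rightarrow> complex) \<Rightarrow> nat \<Rightarrow> (nat \<Rightarrow> nat \<Rightarrow> 'a) \<Rightarrow> bool" where
  "invariant_on f d u \<longleftrightarrow> functional f \<and> f 1 = 1 \<and> (\<forall>i<d. \<forall>j<d.
     (\<Sum>k<d. scl (f (u i k)) (u k j)) = scl (f (u i j)) 1 \<and> (\<Sum>k<d. scl (f (u k j)) (u i k)) = scl (f (u i j)) 1)"

lemma invariant_on_unique:
  assumes f: "invariant_on f d u" and g: "invariant_on g d u" and ij: "i < d" "j < d"
  shows "f (u i j) = g (u i j)"
proof -
  have F: "functional f" "f 1 = 1" and G: "functional g" "g 1 = 1" using f g by (simp_all add: invariant_on_def)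
  have "f (u i j) = g (scl (f (u i j)) 1)" using linmap_sc[OF G(1)] G(2) by simp
  also have "\<dots> = g (\<Sum>k<d. scl (f (u i k)) (u k j))" using f ij by (simp add: invariant_on_def)
  also have "\<dots> = f (\<Sum>k<d. scl (g (u k j)) (u i k))"
    by (simp add: linmap_sum[OF F(1)] linmap_sum[OF G(1)] linmap_sc[OF F(1)] linmap_sc[OF G(1)] mult.commute)
  also have "\<dots> = f (scl (g (u i j)) 1)" using g ij by (simp add: invariant_on_def)
  also have "\<dots> = g (u i j)" using linmap_sc[OF F(1)] F(2) by simp
  finally show ?thesis .
qed

text \<open>One functional can thus serve several representations at once: solve the problem on
  their direct sum.\<close>

lemma invariant_on_direct_sum:
  assumes "invariant_on f (m + n) (direct_sum m u v)"
  shows "invariant_on f m u" "invariant_on f n v"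
proof -
  have f: "functional f" "f 1 = 1"
    and inv: "\<And>i j. i < m + n \<Longrightarrow> j < m + n \<Longrightarrow> (\<Sum>k<m + n. scl (f (direct_sum m u v i k)) (direct_sum m u v k j)) = scl (f (direct_sum m u v i j)) 1"
     "\<And>i j. i < m + n \<Longrightarrow> j < m + n \<Longrightarrow> (\<Sum>k<m + n. scl (f (direct_sum m u v k j)) (direct_sum m u v i k)) = scl (f (direct_sum m u v i j)) 1"
    using assms by (auto simp: invariant_on_def)
  show "invariant_on f m u"
    unfolding invariant_on_def
  proof (intro conjI allI impI)
    fix i j assume "i < m" "j < m"
    then show "(\<Sum>k<m. scl (f (u i k)) (u k j)) = scl (f (u i j)) 1"
      "(\<Sum>k<m. scl (f (u k j)) (u i k)) = scl (f (u i j)) 1"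
      using inv[of i j] by (simp_all add: sum_lessThan_add linmap_0[OF f(1)])
  qed (use f in auto)
  show "invariant_on f n v"
    using f inv(1)[of "m + i" "m + j" for i j] inv(2)[of "m + i" "m + j" for i j]
    by (simp add: invariant_on_def sum_lessThan_add linmap_0[OF f(1)])
qed

end

section \<open>Existence of the invariant functional\<close>

context cqg_alg
begin

text \<open>The product of the dual algebra; on a unitary \<open>u\<close> it becomes multiplication
  of the complex matrices \<open>f(u)\<close>.\<close>

definition conv :: "('a \<Rightarrow> complex) \<Rightarrow> ('a \<Rightarrow> complex) \<Rightarrow> 'a \<Rightarrow> complex" where
  "conv f g a = cs a (\<lambda>x y. f x * g y)"

lemma conv:
  assumes "functional f" "functional g"
  shows "functional (conv f g)" "conv f g 1 = f 1 * g 1"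
    and "unitary_rep H d u \<Longrightarrow> i < d \<Longrightarrow> j < d \<Longrightarrow> conv f g (u i j) = (\<Sum>k<d. f (u i k) * g (u k j))"
proof -
  note b = bilin_functional_prod[OF assms]
  show "functional (conv f g)" using cs_functional[OF b] by (simp add: conv_def[abs_def])
  show "conv f g 1 = f 1 * g 1" using cs_1[OF b] by (simp add: conv_def)
  show "conv f g (u i j) = (\<Sum>k<d. f (u i k) * g (u k j))" if "unitary_rep H d u" "i < d" "j < d"
    using cs_corep[OF _ b, of "{..<d}" u i j] that by (simp add: conv_def unitary_rep_def is_corep_iff)
qed

text \<open>The involution of the dual algebra; on a unitary \<open>u\<close> it takes the matrix
  \<open>f(u)\<close> to its adjoint.\<close>

definition sharp :: "('a \<Rightarrow> complex) \<Rightarrow> 'a \<Rightarrow> complex" where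
  "sharp f a = cnj (f (star (S a)))"

lemma sharp:
  assumes "functional f"
  shows "functional (sharp f)"
    and "unitary_rep H d u \<Longrightarrow> i < d \<Longrightarrow> j < d \<Longrightarrow> sharp f (u i j) = cnj (f (u j i))"
  using assms by (simp_all add: sharp_def linmap_def S_add S_sc star_add star_sc S_unitary star_star)

text \<open>The functionals \<open>f\<close> with \<open>f 1 = 1\<close> give an affine space of matrices \<open>f (u)\<close> that is closed
  under products and adjoints; its point closest to \<open>0\<close> absorbs all the others.\<close>

lemma invariant_on_exists:
  assumes u: "unitary_rep H d u"
  obtains f where "invariant_on f d u"
proof -
  define W where "W = {\<lambda>p :: nat \<times> nat. g (u (fst p) (snd p)) | g. functional g \<and> g 1 = 0}"
  have "\<exists>w\<in>W. \<forall>z\<in>W. (\<Sum>p\<in>{..<d}\<times>{..<d}. (eps (u (fst p) (snd p)) - w p) * cnj (z p)) = 0"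
  proof (rule orthogonal_projection_exists)
    show "(\<lambda>_. 0) \<in> W" unfolding W_def by (rule CollectI, rule exI[of _ "\<lambda>_. 0"]) (simp add: linmap_def)
    fix x y c assume "x \<in> W"
    then obtain g where g: "x = (\<lambda>p. g (u (fst p) (snd p)))" "functional g" "g 1 = 0" by (auto simp: W_def)
    show "(\<lambda>p. c * x p) \<in> W" unfolding W_def
      by (rule CollectI, rule exI[of _ "\<lambda>a. c * g a"]) (use g in \<open>simp add: linmap_def algebra_simps\<close>)
    assume "y \<in> W"
    then obtain k where k: "y = (\<lambda>p. k (u (fst p) (snd p)))" "functional k" "k 1 = 0" by (auto simp: W_def)
    show "(\<lambda>p. x p + y p) \<in> W" unfolding W_def
      by (rule CollectI, rule exI[of _ "\<lambda>a. g a + k a"]) (use g k in \<open>simp add: linmap_def algebra_simps\<close>)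
  qed simp
  then obtain w where "w \<in> W"
    and w: "\<And>z. z \<in> W \<Longrightarrow> (\<Sum>p\<in>{..<d}\<times>{..<d}. (eps (u (fst p) (snd p)) - w p) * cnj (z p)) = 0"
    by blast
  then obtain g where g: "functional g" "g 1 = 0" and w_def: "w = (\<lambda>p. g (u (fst p) (snd p)))"
    by (auto simp: W_def)
  have orth: "(\<Sum>p\<in>{..<d}\<times>{..<d}. (eps (u (fst p) (snd p)) - g (u (fst p) (snd p))) * cnj (k (u (fst p) (snd p)))) = 0"
    if "functional k" "k 1 = 0" for k
  proof -
    have "(\<lambda>p. k (u (fst p) (snd p))) \<in> W" using that by (auto simp: W_def)
    from w[OF this] show ?thesis by (simp only: w_def)
  qed
  \<comment> \<open>\<open>eps\<close> is a point of the affine space and \<open>g\<close> matches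
    its component along the directions \<open>W\<close>, so \<open>f\<close> is the point closest to
    0.\<close>
  define f where "f = (\<lambda>a. eps a - g a)"
  have f: "functional f" "f 1 = 1"
    using g eps_functional by (simp_all add: f_def linmap_def algebra_simps eps_1)
  have orth: "(\<Sum>i<d. \<Sum>j<d. f (u i j) * cnj (k (u i j))) = 0" if "functional k" "k 1 = 0" for k
    using orth[OF that] by (simp add: f_def sum.cartesian_product split_def)
  have zero: "k (u i j) = 0" if "(\<Sum>i<d. \<Sum>j<d. k (u i j) * cnj (k (u i j))) = 0" "i < d" "j < d" for k :: "'a \<Rightarrow> complex" and i j
  proof -
    have eq: "of_real (\<Sum>i<d. \<Sum>j<d. (cmod (k (u i j)))\<^sup>2) = (\<Sum>i<d. \<Sum>j<d. k (u i j) * cnj (k (u i j)))"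
      unfolding of_real_sum by (intro sum.cong refl) (rule complex_norm_square)
    have "(\<Sum>i<d. \<Sum>j<d. (cmod (k (u i j)))\<^sup>2) = 0"
      using trans[OF eq that(1)] by (simp only: of_real_eq_0_iff)
    then have "(\<Sum>j<d. (cmod (k (u i j)))\<^sup>2) = 0"
      by (subst (asm) sum_nonneg_eq_0_iff) (use that in \<open>auto intro: sum_nonneg\<close>)
    then show ?thesis by (subst (asm) sum_nonneg_eq_0_iff) (use that in auto)
  qed
  \<comment> \<open>Let \<open>z\<close> be the difference of the product \<open>k f\<close> and
    \<open>f\<close>. It vanishes at \<open>1\<close>, so \<open>\<langle>z, z\<rangle> = \<langle>k
    f, z\<rangle> = \<langle>f, sharp k z\<rangle> = 0\<close>, as \<open>sharp k z\<close> vanishes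
    at \<open>1\<close> too. The other product is treated alike.\<close>
  have abs1: "conv k f (u i j) = f (u i j)" "conv f k (u i j) = f (u i j)"
    if k: "functional k" "k 1 = 1" and ij: "i < d" "j < d" for k i j
  proof -
    note K = sharp[OF k(1)]
    have K1: "sharp k 1 = 1"
    proof -
      have "S 1 = 1" using cs_S_left[of 1] cs_1[of scl "\<lambda>a b. S a * b"]
        by (simp add: bilin_def linmap_def S_add S_sc distrib_left distrib_right sc_mult_left sc_mult_right eps_1 sc_1)
      then show ?thesis by (simp add: sharp_def star_1 k)
    qed
    define z where "z = (\<lambda>a. conv k f a - f a)"
    have z: "functional z" "z 1 = 0"
      using conv[OF k(1) f(1)] f k by (simp_all add: z_def linmap_def algebra_simps)
    have "(\<Sum>i<d. \<Sum>j<d. z (u i j) * cnj (z (u i j)))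
       = (\<Sum>i<d. \<Sum>j<d. conv k f (u i j) * cnj (z (u i j)))"
      using orth[OF z] by (simp add: z_def left_diff_distrib sum_subtractf)
    also have "\<dots> = (\<Sum>i<d. \<Sum>j<d. \<Sum>m<d. k (u i m) * f (u m j) * cnj (z (u i j)))"
      by (simp add: conv(3)[OF k(1) f(1) u] sum_distrib_right)
    also have "\<dots> = (\<Sum>j<d. \<Sum>m<d. \<Sum>i<d. k (u i m) * f (u m j) * cnj (z (u i j)))"
      by (rule trans[OF sum.swap sum.cong[OF refl sum.swap]])
    also have "\<dots> = (\<Sum>m<d. \<Sum>j<d. \<Sum>i<d. k (u i m) * f (u m j) * cnj (z (u i j)))"
      by (rule sum.swap)
    also have "\<dots> = (\<Sum>m<d. \<Sum>j<d. f (u m j) * cnj (conv (sharp k) z (u m j)))"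
      by (intro sum.cong refl) (simp add: conv(3)[OF K(1) z(1) u] K(2)[OF u] sum_distrib_left mult_ac)
    also have "\<dots> = 0" by (rule orth) (simp_all add: conv[OF K(1) z(1)] z)
    finally have "z (u i j) = 0" using zero ij by blast
    then show "conv k f (u i j) = f (u i j)" by (simp add: z_def)
    define z where "z = (\<lambda>a. conv f k a - f a)"
    have z: "functional z" "z 1 = 0"
      using conv[OF f(1) k(1)] f k by (simp_all add: z_def linmap_def algebra_simps)
    have "(\<Sum>i<d. \<Sum>j<d. z (u i j) * cnj (z (u i j)))
       = (\<Sum>i<d. \<Sum>j<d. conv f k (u i j) * cnj (z (u i j)))"
      using orth[OF z] by (simp add: z_def left_diff_distrib sum_subtractf)
    also have "\<dots> = (\<Sum>i<d. \<Sum>j<d. \<Sum>m<d. f (u i m) * k (u m j) * cnj (z (u i j)))"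
      by (simp add: conv(3)[OF f(1) k(1) u] sum_distrib_right)
    also have "\<dots> = (\<Sum>i<d. \<Sum>m<d. \<Sum>j<d. f (u i m) * k (u m j) * cnj (z (u i j)))"
      by (intro sum.cong[OF refl] sum.swap)
    also have "\<dots> = (\<Sum>i<d. \<Sum>m<d. f (u i m) * cnj (conv z (sharp k) (u i m)))"
      by (intro sum.cong refl) (simp add: conv(3)[OF z(1) K(1) u] K(2)[OF u] sum_distrib_left mult_ac)
    also have "\<dots> = 0" by (rule orth) (simp_all add: conv[OF z(1) K(1)] z)
    finally have "z (u i j) = 0" using zero ij by blast
    then show "conv f k (u i j) = f (u i j)" by (simp add: z_def)
  qed
  have abs: "(\<Sum>m<d. k (u i m) * f (u m j)) = k 1 * f (u i j)" "(\<Sum>m<d. f (u i m) * k (u m j)) = k 1 * f (u i j)"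
    if k: "functional k" and ij: "i < d" "j < d" for k i j
  proof -
    \<comment> \<open>A multiple of \<open>eps\<close>, whose matrix on \<open>u\<close> is the
      identity, normalizes an arbitrary functional to the value 1 at \<open>1\<close>.\<close>
    define k' where "k' = (\<lambda>a. k a + (1 - k 1) * eps a)"
    have k': "functional k'" "k' 1 = 1"
      using k eps_functional by (simp_all add: k'_def linmap_def algebra_simps eps_1)
    have e: "eps (u i j) = (if i = j then 1 else 0)" if "i < d" "j < d" for i j
      using invertible_corepD(3)[OF unitary_invertible[OF u]] that by simp
    have "(\<Sum>m<d. k' (u i m) * f (u m j)) = f (u i j)" "(\<Sum>m<d. f (u i m) * k' (u m j)) = f (u i j)"
      using abs1[OF k' ij] conv(3)[OF k'(1) f(1) u ij] conv(3)[OF f(1) k'(1) u ij] by auto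
    moreover have "(\<Sum>m<d. k' (u i m) * f (u m j)) = (\<Sum>m<d. k (u i m) * f (u m j)) + (1 - k 1) * (\<Sum>m<d. (if i = m then 1 else 0) * f (u m j))"
      "(\<Sum>m<d. f (u i m) * k' (u m j)) = (\<Sum>m<d. f (u i m) * k (u m j)) + (1 - k 1) * (\<Sum>m<d. f (u i m) * (if m = j then 1 else 0))"
      unfolding sum_distrib_left sum.distrib[symmetric]
      using ij by (auto intro!: sum.cong simp: k'_def e algebra_simps)
    ultimately show "(\<Sum>m<d. k (u i m) * f (u m j)) = k 1 * f (u i j)" "(\<Sum>m<d. f (u i m) * k (u m j)) = k 1 * f (u i j)"
      using ij by (simp_all add: sum_delta algebra_simps)
  qed
  have "invariant_on f d u" unfolding invariant_on_def
  proof (intro conjI allI impI f)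
    fix i j assume ij: "i < d" "j < d"
    show "(\<Sum>k<d. scl (f (u i k)) (u k j)) = scl (f (u i j)) 1"
    proof (rule separating_eq)
      fix k assume k: "functional k"
      show "k (\<Sum>k<d. scl (f (u i k)) (u k j)) = k (scl (f (u i j)) 1)"
        using abs(2)[OF k ij] by (simp add: linmap_sum[OF k] linmap_sc[OF k])
    qed
    show "(\<Sum>k<d. scl (f (u k j)) (u i k)) = scl (f (u i j)) 1"
    proof (rule separating_eq)
      fix k assume k: "functional k"
      show "k (\<Sum>k<d. scl (f (u k j)) (u i k)) = k (scl (f (u i j)) 1)"
        using abs(1)[OF k ij] by (simp add: linmap_sum[OF k] linmap_sc[OF k] mult.commute)
    qed
  qed
  then show thesis by (rule that)
qed

text \<open>Each \<open>a\<close> is assigned a representation having it among its coefficients and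
  an invariant functional there, whose value at \<open>a\<close> becomes \<open>h a\<close>.
  Different elements are compared on direct sums, where uniqueness makes the local functionals
  agree.\<close>

lemma invariant_exists: "\<exists>h. invariant h"
proof -
  have "\<forall>a. \<exists>t. unitary_rep H (fst t) (fst (snd t)) \<and>
      a = (\<Sum>i<fst t. \<Sum>j<fst t. scl (fst (snd (snd t)) i * snd (snd (snd t)) j) (fst (snd t) i j))"
  proof
    fix a
    obtain d u \<xi> \<eta> where "unitary_rep H d u" "a = (\<Sum>i<d. \<Sum>j<d. scl (\<xi> i * \<eta> j) (u i j))"
      by (rule elementary_coefficient)
    then show "\<exists>t. unitary_rep H (fst t) (fst (snd t)) \<and>
      a = (\<Sum>i<fst t. \<Sum>j<fst t. scl (fst (snd (snd t)) i * snd (snd (snd t)) j) (fst (snd t) i j))"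
      by (intro exI[of _ "(d, u, \<xi>, \<eta>)"]) simp
  qed
  from choice[OF this] obtain t where t: "\<And>a. unitary_rep H (fst (t a)) (fst (snd (t a)))"
      "\<And>a. a = (\<Sum>i<fst (t a). \<Sum>j<fst (t a). scl (fst (snd (snd (t a))) i * snd (snd (snd (t a))) j) (fst (snd (t a)) i j))"
    by blast
  define D U X E where "D = (\<lambda>a. fst (t a))" and "U = (\<lambda>a. fst (snd (t a)))"
    and "X = (\<lambda>a. fst (snd (snd (t a))))" and "E = (\<lambda>a. snd (snd (snd (t a))))"
  have U: "\<And>a. unitary_rep H (D a) (U a)"
    and exp: "\<And>a. a = (\<Sum>i<D a. \<Sum>j<D a. scl (X a i * E a j) (U a i j))"
    unfolding D_def U_def X_def E_def by (rule t)+
  have "\<exists>f. invariant_on f (D a) (U a)" for a using invariant_on_exists[OF U] by blast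
  then obtain F where F: "\<And>a. invariant_on (F a) (D a) (U a)" by metis
  define h where "h = (\<lambda>a. F a a)"
  have h: "h a = f a" if f: "invariant_on f (D a) (U a)" for a f
  proof -
    have lin: "functional f" "functional (F a)" using f F by (simp_all add: invariant_on_def)
    have "F a (\<Sum>i<D a. \<Sum>j<D a. scl (X a i * E a j) (U a i j)) = f (\<Sum>i<D a. \<Sum>j<D a. scl (X a i * E a j) (U a i j))"
      using invariant_on_unique[OF F f]
      by (simp add: linmap_sum[OF lin(1)] linmap_sum[OF lin(2)] linmap_sc[OF lin(1)] linmap_sc[OF lin(2)])
    then show ?thesis using exp[of a] by (simp add: h_def)
  qed
  have common: "\<exists>f. invariant_on f k w \<and> invariant_on f (D a) (U a) \<and> invariant_on f (D b) (U b)"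
    if w: "unitary_rep H k w" for k w a b
  proof -
    obtain f where "invariant_on f (k + (D a + D b)) (direct_sum k w (direct_sum (D a) (U a) (U b)))"
      using invariant_on_exists[OF unitary_direct_sum[OF w unitary_direct_sum[OF U U]]] by blast
    from invariant_on_direct_sum[OF this] invariant_on_direct_sum[of f "D a" "D b"] show ?thesis by blast
  qed
  have lin: "functional h"
    unfolding linmap_def
  proof (intro conjI allI)
    fix x y c
    obtain f where f: "invariant_on f (D x) (U x)" "invariant_on f (D y) (U y)" "invariant_on f (D (x + y)) (U (x + y))"
      using common[OF U] by blast
    then have "functional f" by (simp add: invariant_on_def)
    then show "h (x + y) = h x + h y" using f by (simp add: h linmap_add)
    obtain f where f: "invariant_on f (D x) (U x)" "invariant_on f (D (scl c x)) (U (scl c x))"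
      using common[OF U] by blast
    then have "functional f" by (simp add: invariant_on_def)
    then show "h (scl c x) = c * h x" using f by (simp add: h linmap_sc)
  qed
  have inv: "invariant_on h d u" if u: "unitary_rep H d u" for d u
  proof -
    have h1: "h 1 = 1" using F[of 1] by (simp add: h_def invariant_on_def)
    obtain f where f: "invariant_on f d u" using invariant_on_exists[OF u] by blast
    have e: "h (u i j) = f (u i j)" if "i < d" "j < d" for i j
    proof -
      obtain g where "invariant_on g d u" "invariant_on g (D (u i j)) (U (u i j))" using common[OF u] by blast
      then show ?thesis using invariant_on_unique[OF f _ that] by (simp add: h)
    qed
    show ?thesis unfolding invariant_on_def
    proof (intro conjI allI impI lin h1)
      fix i j assume ij: "i < d" "j < d"
      have "(\<Sum>k<d. scl (h (u i k)) (u k j)) = (\<Sum>k<d. scl (f (u i k)) (u k j))"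
        "(\<Sum>k<d. scl (h (u k j)) (u i k)) = (\<Sum>k<d. scl (f (u k j)) (u i k))"
        using ij by (auto intro!: sum.cong simp: e)
      then show "(\<Sum>k<d. scl (h (u i k)) (u k j)) = scl (h (u i j)) 1"
        "(\<Sum>k<d. scl (h (u k j)) (u i k)) = scl (h (u i j)) 1"
        using f ij by (simp_all add: invariant_on_def e)
    qed
  qed
  have "invariant h" unfolding invariant_def
  proof (intro conjI allI lin)
    show "h 1 = 1" using F[of 1] by (simp add: h_def invariant_on_def)
    have l: "linmap H scl (\<lambda>a. scl (h a) 1)" using lin by (simp add: linmap_def sc_add_left sc_sc)
    fix a
    show "cs a (\<lambda>x y. scl (h x) y) = scl (h a) 1"
    proof (rule linmap_eq_on_coefficients[where F = "\<lambda>a. cs a (\<lambda>x y. scl (h x) y)" and G = "\<lambda>a. scl (h a) 1", OF _ l])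
      show "linmap H scl (\<lambda>a. cs a (\<lambda>x y. scl (h x) y))"
        by (rule cs_linmap[OF vs.vector_space_axioms bilin_left_slice[OF lin]])
      fix d u i j assume u: "unitary_rep H d u" "i < d" "j < d"
      then show "cs (u i j) (\<lambda>x y. scl (h x) y) = scl (h (u i j)) 1"
        using inv[OF u(1)] cs_corep[OF _ bilin_left_slice[OF lin], of "{..<d}" u i j]
        by (simp add: invariant_on_def unitary_rep_def is_corep_iff)
    qed
    show "cs a (\<lambda>x y. scl (h y) x) = scl (h a) 1"
    proof (rule linmap_eq_on_coefficients[where F = "\<lambda>a. cs a (\<lambda>x y. scl (h y) x)" and G = "\<lambda>a. scl (h a) 1", OF _ l])
      show "linmap H scl (\<lambda>a. cs a (\<lambda>x y. scl (h y) x))"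
        by (rule cs_linmap[OF vs.vector_space_axioms bilin_right_slice[OF lin]])
      fix d u i j assume u: "unitary_rep H d u" "i < d" "j < d"
      then show "cs (u i j) (\<lambda>x y. scl (h y) x) = scl (h (u i j)) 1"
        using inv[OF u(1)] cs_corep[OF _ bilin_right_slice[OF lin], of "{..<d}" u i j]
        by (simp add: invariant_on_def unitary_rep_def is_corep_iff)
    qed
  qed
  then show ?thesis by blast
qed

end

section \<open>Nondegeneracy and positivity\<close>

lemma tsum_cong:
  assumes "\<And>x y. (x, y) \<in> set L \<Longrightarrow> \<beta> x y = \<gamma> x y"
  shows "tsum \<beta> L = tsum \<gamma> L"
  unfolding tsum_def by (rule arg_cong[of _ _ sum_list]) (use assms in auto)

context cqg_alg
begin

text \<open>The left radical \<open>{b. \<forall>c. h (c * b) = 0}\<close> is a left ideal and is stable under slicing the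
  coproduct, so that \<open>eps b = h (S_inv b\<^sub>2 * b\<^sub>1) = 0\<close> on it, which makes it zero.\<close>

lemma invariant_nondegenerate_left:
  assumes h: "invariant h" and b: "\<And>c. h (c * b) = 0"
  shows "b = 0"
proof -
  have hf: "functional h" "h 1 = 1" using h by (simp_all add: invariant_def)
  \<comment> \<open>Strong invariance: \<open>(h \<otimes> S)((c \<otimes> 1) \<Delta> b) = (h
    \<otimes> id)(\<Delta> c (b \<otimes> 1))\<close>. For \<open>b = u i j\<close> it is invariance
    at \<open>c * u i k\<close>, the surplus factor of \<open>u\<close> being cancelled by its
    antipode.\<close>
  have shift: "cs b (\<lambda>x y. scl (h (c * x)) (S y)) = cs c (\<lambda>x y. scl (h (x * b)) y)" for b c
  proof (rule linmap_eq_on_coefficients[where F = "\<lambda>b. cs b (\<lambda>x y. scl (h (c * x)) (S y))"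
        and G = "\<lambda>b. cs c (\<lambda>x y. scl (h (x * b)) y)"])
    have bil: "bilin H H scl (\<lambda>x y. scl (h (c * x)) (S y))"
      using hf(1) by (simp add: bilin_def linmap_def distrib_left sc_mult_right sc_add_left sc_add_right S_add S_sc sc_sc mult.commute)
    show "linmap H scl (\<lambda>b. cs b (\<lambda>x y. scl (h (c * x)) (S y)))"
      by (rule cs_linmap[OF vs.vector_space_axioms bil])
    have tsc: "tsum (\<lambda>x y. scl k (\<gamma> x y)) L = scl k (tsum \<gamma> L)" for k \<gamma> and L :: "('a \<times> 'a) list"
      by (induction L) (auto simp: sc_add_right)
    show "linmap H scl (\<lambda>b. cs c (\<lambda>x y. scl (h (x * b)) y))"
      unfolding linmap_def tsum_add[symmetric] tsc[symmetric]
      by (intro conjI allI tsum_cong)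
        (simp_all add: distrib_left sc_mult_right linmap_add[OF hf(1)] linmap_sc[OF hf(1)] sc_add_left sc_sc)
    fix d u i j assume u: "unitary_rep H d u" and ij: "i < d" "j < d"
    have co: "corep H {..<d} u" using u by (simp add: unitary_rep_def is_corep_iff)
    note U = invertible_corepD[OF unitary_invertible[OF u]]
    have inv: "(\<Sum>m<d. cs c (\<lambda>x y. scl (h (x * u i m)) y) * u m k) = scl (h (c * u i k)) 1" if "k < d" for k
    proof -
      have bk: "bilin H H scl (\<lambda>a b. scl (h (x * a)) (y * b))" for x y
        using hf(1) by (simp add: bilin_def linmap_def distrib_left sc_mult_right sc_add_left sc_add_right sc_sc mult.commute)
      have "scl (h (c * u i k)) 1 = cs (c * u i k) (\<lambda>x y. scl (h x) y)" using h by (simp add: invariant_def)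
      also have "\<dots> = cs c (\<lambda>x y. \<Sum>m<d. scl (h (x * u i m)) (y * u m k))"
        using ij that by (simp add: cs_mult[OF bilin_left_slice[OF hf(1)]] cs_corep[OF co bk])
      also have "\<dots> = (\<Sum>m<d. cs c (\<lambda>x y. scl (h (x * u i m)) y) * u m k)"
        by (simp add: tsum_sum sc_mult_left flip: tsum_mult_right)
      finally show ?thesis by simp
    qed
    have "cs (u i j) (\<lambda>x y. scl (h (c * x)) (S y)) = (\<Sum>k<d. scl (h (c * u i k)) 1 * S (u k j))"
      using cs_corep[OF co bil, of i j] ij by (simp add: sc_mult_left)
    also have "\<dots> = (\<Sum>k<d. (\<Sum>m<d. cs c (\<lambda>x y. scl (h (x * u i m)) y) * u m k) * S (u k j))"
      by (intro sum.cong refl) (simp add: inv)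
    also have "\<dots> = cs c (\<lambda>x y. scl (h (x * u i j)) y)"
      by (rule mat_cancel_right) (use U(5) ij in auto)
    finally show "cs (u i j) (\<lambda>x y. scl (h (c * x)) (S y)) = cs c (\<lambda>x y. scl (h (x * u i j)) y)" .
  qed
  define J where "J = {b. \<forall>c. h (c * b) = 0}"
  have slice: "cs b (\<lambda>x y. scl (f y) x) \<in> J" if "b \<in> J" and f: "functional f" for b f
  proof -
    have "h (c * cs b (\<lambda>x y. scl (f y) x)) = 0" for c
    proof -
      have "cs c (\<lambda>x y. scl (h (x * b)) y) = cs c (\<lambda>x y. 0)"
        by (rule tsum_cong) (use \<open>b \<in> J\<close> in \<open>simp add: J_def\<close>)
      then have "cs b (\<lambda>x y. scl (h (c * x)) (S y)) = 0"
        by (simp only: shift tsum_0)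
      \<comment> \<open>The antipode is undone on the second leg, after which any functional can be
        applied there.\<close>
      then have "S_inv (cs b (\<lambda>x y. scl (h (c * x)) (S y))) = 0"
        by (simp add: linmap_0[OF S_inv_linmap])
      then have "cs b (\<lambda>x y. scl (h (c * x)) y) = 0"
        by (simp add: linmap_tsum[OF S_inv_linmap] linmap_sc[OF S_inv_linmap] S_inv_S)
      then have "f (cs b (\<lambda>x y. scl (h (c * x)) y)) = 0" by (simp add: linmap_0[OF f])
      then have "cs b (\<lambda>x y. h (c * x) * f y) = 0" by (simp add: linmap_tsum[OF f] linmap_sc[OF f])
      then show ?thesis
        by (simp add: linmap_tsum[OF hf(1)] linmap_sc[OF hf(1)] sc_mult_right mult.commute flip: tsum_mult_left)
    qed
    then show ?thesis by (simp add: J_def)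
  qed
  have eps0: "eps b = 0" if "b \<in> J" for b
  proof -
    \<comment> \<open>The factor \<open>S_inv y\<close> varies with the term of the coproduct.
      Expanding \<open>y\<close> in coordinates replaces it by finitely many fixed
      \<open>S_inv e\<close>, each multiplying a slice of \<open>b\<close> that lies in
      \<open>J\<close>.\<close>
    obtain B \<phi> where \<phi>: "\<And>e. functional (\<phi> e)"
      and exp: "\<And>y. y \<in> snd ` set (cop H b) \<Longrightarrow> (\<Sum>e\<in>B. scl (\<phi> e y) e) = y"
      by (rule finite_coordinates[OF finite_imageI[OF finite_set, of snd "cop H b"]]) (rule that)
    have "eps b = h (cs b (\<lambda>x y. S_inv y * x))"
      using linmap_sc[OF hf(1), of "eps b" 1] by (simp add: cs_S_inv hf)
    also have "\<dots> = cs b (\<lambda>x y. h (S_inv y * x))" by (rule linmap_tsum[OF hf(1)])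
    also have "\<dots> = cs b (\<lambda>x y. \<Sum>e\<in>B. h (S_inv e * scl (\<phi> e y) x))"
    proof (rule tsum_cong)
      fix x y assume "(x, y) \<in> set (cop H b)"
      then have y: "(\<Sum>e\<in>B. scl (\<phi> e y) e) = y" by (intro exp) force
      have "S_inv (\<Sum>e\<in>B. scl (\<phi> e y) e) * x = (\<Sum>e\<in>B. S_inv e * scl (\<phi> e y) x)"
        by (simp add: linmap_sum[OF S_inv_linmap] linmap_sc[OF S_inv_linmap] sum_distrib_right sc_mult_left sc_mult_right)
      then show "h (S_inv y * x) = (\<Sum>e\<in>B. h (S_inv e * scl (\<phi> e y) x))"
        by (simp only: y linmap_sum[OF hf(1)])
    qed
    also have "\<dots> = (\<Sum>e\<in>B. h (S_inv e * cs b (\<lambda>x y. scl (\<phi> e y) x)))"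
      by (simp add: tsum_sum linmap_tsum[OF hf(1)] flip: tsum_mult_left)
    also have "\<dots> = 0" using slice[OF that \<phi>] by (simp add: J_def)
    finally show ?thesis .
  qed
  have "b \<in> J" using b by (simp add: J_def)
  show ?thesis
  proof (rule separating)
    fix f assume f: "functional f"
    \<comment> \<open>\<open>f b\<close> is the counit of the slice of \<open>b\<close> by
      \<open>f\<close>, and that slice stays in \<open>J\<close>.\<close>
    have "f b = f (cs b (\<lambda>x y. scl (eps x) y))" by (simp add: cs_eps_left)
    also have "\<dots> = eps (cs b (\<lambda>x y. scl (f y) x))"
      by (simp add: linmap_tsum[OF f] linmap_sc[OF f] linmap_tsum[OF eps_functional] linmap_sc[OF eps_functional] mult.commute)
    also have "\<dots> = 0" by (rule eps0[OF slice[OF \<open>b \<in> J\<close> f]])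
    finally show "f b = 0" .
  qed
qed

text \<open>\<open>star\<close> exchanges the two sides, as \<open>h\<close> is hermitian.\<close>

lemma invariant_nondegenerate_right:
  assumes h: "invariant h" and b: "\<And>c. h (b * c) = 0"
  shows "b = 0"
proof -
  have "h (c * star b) = 0" for c
    using invariant_star[OF h, of "b * star c"] b[of "star c"] by (simp add: star_mult star_star)
  then have "star b = 0" by (rule invariant_nondegenerate_left[OF h])
  then show ?thesis using star_star[of b] by (simp add: star_0)
qed

text \<open>Writing \<open>x = \<Sum>\<^sub>j \<eta>\<^sub>j X\<^sub>j\<close> with \<open>X\<^sub>j = \<Sum>\<^sub>i \<xi>\<^sub>i u\<^sub>i\<^sub>j\<close>, the matrix \<open>Y = (h (X\<^sub>j\<^sup>* X\<^sub>l))\<close> is hermitian and commutes with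
  \<open>u\<close>. If it had a negative eigenvalue \<open>m\<close>, the projection \<open>T\<close> onto the eigenspace would commute with \<open>u\<close> too. For each
  intertwiner \<open>R\<close> from a unitary \<open>v\<close> to the conjugate of \<open>u\<close>, the matrix \<open>D = R R\<^sup>*\<close> is fixed by \<open>conj u \<otimes> u\<close>, so pairing
  \<open>D\<close> with \<open>T Y T = m T\<close> gives a nonnegative number, which forces \<open>R\<close> to be orthogonal to \<open>T\<close>. The intertwiners
  \<open>R = (h (u\<^sub>i\<^sub>J\<^sup>* v\<^sub>p\<^sub>q\<^sup>*))\<close> are so many that nondegeneracy of \<open>h\<close> then yields \<open>T = 0\<close>.\<close>

lemma invariant_positive:
  assumes h: "invariant h"
  shows "Im (h (star x * x)) = 0" and "0 \<le> Re (h (star x * x))"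
proof -
  have hf: "functional h" "h 1 = 1" using h by (simp_all add: invariant_def)
  have "cnj (h (star x * x)) = h (star x * x)"
    using invariant_star[OF h, of "star x * x"] by (simp add: star_mult star_star)
  then show "Im (h (star x * x)) = 0" by (simp add: complex_eq_iff)
  show "0 \<le> Re (h (star x * x))"
  proof (rule ccontr)
    assume "\<not> ?thesis"
    then have neg: "Re (h (star x * x)) < 0" by simp
    obtain d u \<xi> \<eta> where u: "unitary_rep H d u" and x: "x = (\<Sum>i<d. \<Sum>j<d. scl (\<xi> i * \<eta> j) (u i j))"
      by (rule elementary_coefficient)
    have co: "corep H {..<d} u" using u by (simp add: unitary_rep_def is_corep_iff)
    define X where "X = (\<lambda>j. \<Sum>i<d. scl (\<xi> i) (u i j))"
    define Y where "Y = (\<lambda>j l. h (star (X j) * X l))"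
    have herm: "Y l j = cnj (Y j l)" for j l
      using invariant_star[OF h, of "star (X j) * X l"] by (simp add: Y_def star_mult star_star)
    have "x = (\<Sum>j<d. scl (\<eta> j) (X j))"
      unfolding x X_def vs.scale_sum_right sc_sc by (subst sum.swap) (simp add: mult.commute)
    then have "h (star x * x) = (\<Sum>j<d. \<Sum>l<d. cnj (\<eta> j) * Y j l * \<eta> l)"
      by (simp add: star_sum star_sc sum_product sc_mult_left sc_mult_right sc_sc Y_def
          linmap_sum[OF hf(1)] linmap_sc[OF hf(1)] mult_ac)
    with neg have neg': "Re (\<Sum>j<d. \<Sum>l<d. cnj (\<eta> j) * Y j l * \<eta> l) < 0" by (simp only:)
    obtain m z where m: "m < 0" and z: "\<exists>i<d. z i \<noteq> 0"
      and eig: "\<And>i. i < d \<Longrightarrow> (\<Sum>j<d. Y i j * z j) = of_real m * z i"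
      by (rule hermitian_negative_eigenvalue[of d Y \<eta>, OF herm neg']) (rule that)
    define W where "W = {w. \<forall>i<d. (\<Sum>j<d. Y i j * w j) = of_real m * w i}"
    obtain T where TW: "\<And>j. (\<lambda>i. T i j) \<in> W"
      and Tid: "\<And>w i. w \<in> W \<Longrightarrow> i < d \<Longrightarrow> (\<Sum>j<d. T i j * w j) = w i"
      and Therm: "\<And>i j. i < d \<Longrightarrow> j < d \<Longrightarrow> T j i = cnj (T i j)"
    proof (rule orthogonal_projection_matrix[of "{..<d}" W])
      show "finite {..<d}" by simp
      show "(\<lambda>_. 0) \<in> W" by (simp add: W_def)
    next
      fix x y assume "x \<in> W" "y \<in> W"
      then show "(\<lambda>i. x i + y i) \<in> W" by (simp add: W_def distrib_left sum.distrib)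
    next
      fix c x assume "x \<in> W"
      then show "(\<lambda>i. c * x i) \<in> W" by (simp add: W_def mult.left_commute flip: sum_distrib_left)
    next
      fix T assume T: "\<And>j. (\<lambda>i. T i j) \<in> W"
        "\<And>w i. w \<in> W \<Longrightarrow> i \<in> {..<d} \<Longrightarrow> (\<Sum>j\<in>{..<d}. T i j * w j) = w i"
        "\<And>i j. i \<in> {..<d} \<Longrightarrow> j \<in> {..<d} \<Longrightarrow> T j i = cnj (T i j)"
      show thesis by (rule that[OF T[unfolded lessThan_iff]])
    qed
    have YT: "(\<Sum>k<d. Y i k * T k j) = of_real m * T i j" if "i < d" for i j
      using TW[of j] that by (simp add: W_def)
    \<comment> \<open>Invariance says \<open>u^* Y u = Y\<close>; multiplying by the unitary
      \<open>u\<close> from the left gives \<open>Y u = u Y\<close>.\<close>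
    have Yu: "(\<Sum>q<d. scl (Y r q) (u q l)) = (\<Sum>j<d. scl (Y j l) (u r j))" if rl: "r < d" "l < d" for r l
    proof -
      have Yexp: "Y p q = (\<Sum>i<d. \<Sum>k<d. (cnj (\<xi> i) * \<xi> k) * h (star (u i p) * u k q))" for p q
        by (simp add: Y_def X_def star_sum star_sc sum_product sc_mult_left sc_mult_right sc_sc
          linmap_sum[OF hf(1)] linmap_sc[OF hf(1)] mult_ac)
      have fix1: "(\<Sum>p<d. \<Sum>q<d. scl (h (star (u i p) * u k q)) (star (u p j) * u q l)) = scl (h (star (u i j) * u k l)) 1"
        if "i < d" "k < d" "j < d" for i k j
        using invariant_corep(1)[OF h corep_prod[OF corep_star[OF co] co], of "(i,k)" "(j,l)"] that rl
        by (simp add: sum.cartesian_product split_def)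
      have fixY: "(\<Sum>p<d. \<Sum>q<d. scl (Y p q) (star (u p j) * u q l)) = scl (Y j l) 1" if "j < d" for j
      proof -
        have "(\<Sum>p<d. \<Sum>q<d. scl (Y p q) (star (u p j) * u q l))
          = (\<Sum>p<d. \<Sum>q<d. \<Sum>i<d. \<Sum>k<d. scl (cnj (\<xi> i) * \<xi> k) (scl (h (star (u i p) * u k q)) (star (u p j) * u q l)))"
          by (simp add: Yexp vs.scale_sum_left sc_sc)
        also have "\<dots> = (\<Sum>p<d. \<Sum>i<d. \<Sum>k<d. \<Sum>q<d. scl (cnj (\<xi> i) * \<xi> k) (scl (h (star (u i p) * u k q)) (star (u p j) * u q l)))"
          by (intro sum.cong[OF refl] trans[OF sum.swap sum.cong[OF refl sum.swap]])
        also have "\<dots> = (\<Sum>i<d. \<Sum>k<d. \<Sum>p<d. \<Sum>q<d. scl (cnj (\<xi> i) * \<xi> k) (scl (h (star (u i p) * u k q)) (star (u p j) * u q l)))"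
          by (rule trans[OF sum.swap sum.cong[OF refl sum.swap]])
        also have "\<dots> = (\<Sum>i<d. \<Sum>k<d. scl (cnj (\<xi> i) * \<xi> k) (scl (h (star (u i j) * u k l)) 1))"
          unfolding vs.scale_sum_right[symmetric] using that
          by (intro sum.cong refl) (simp only: fix1 lessThan_iff)
        also have "\<dots> = scl (Y j l) 1" by (simp add: Yexp vs.scale_sum_left sc_sc)
        finally show ?thesis .
      qed
      have "(\<Sum>q<d. scl (Y r q) (u q l)) = (\<Sum>j<d. u r j * (\<Sum>p<d. star (u p j) * (\<Sum>q<d. scl (Y p q) (u q l))))"
        by (rule mat_cancel_left[symmetric]) (use unitary_orth[OF u] rl in auto)
      also have "\<dots> = (\<Sum>j<d. u r j * scl (Y j l) 1)"
        by (intro sum.cong refl) (simp add: sum_distrib_left sc_mult_right flip: fixY)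
      finally show ?thesis by (simp add: sc_mult_right)
    qed
    \<comment> \<open>Every matrix \<open>f(u)\<close> commutes with \<open>Y\<close> and so
      preserves the eigenspace: \<open>T f(u) T = f(u) T\<close>.\<close>
    have fTW: "(\<Sum>a<d. T r a * (\<Sum>k<d. f (u a k) * T k c)) = (\<Sum>k<d. f (u r k) * T k c)"
      if f: "functional f" and r: "r < d" for f r c
    proof (rule Tid[of "\<lambda>a. \<Sum>k<d. f (u a k) * T k c", OF _ r])
      have "(\<Sum>l<d. Y j l * (\<Sum>k<d. f (u l k) * T k c)) = of_real m * (\<Sum>k<d. f (u j k) * T k c)" if j: "j < d" for j
      proof -
        have fY: "(\<Sum>q<d. Y j q * f (u q l)) = (\<Sum>k<d. f (u j k) * Y k l)" if "l < d" for l
          using arg_cong[OF Yu[OF j that], of f] by (simp add: linmap_sum[OF f] linmap_sc[OF f] mult.commute)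
        have "(\<Sum>l<d. Y j l * (\<Sum>k<d. f (u l k) * T k c)) = (\<Sum>k<d. (\<Sum>l<d. Y j l * f (u l k)) * T k c)"
          by (simp add: sum_distrib_left sum_distrib_right mult.assoc) (rule sum.swap)
        also have "\<dots> = (\<Sum>k<d. (\<Sum>l<d. f (u j l) * Y l k) * T k c)"
          by (intro sum.cong refl) (simp add: fY)
        also have "\<dots> = (\<Sum>l<d. f (u j l) * (\<Sum>k<d. Y l k * T k c))"
          by (simp add: sum_distrib_left sum_distrib_right mult.assoc) (rule sum.swap)
        also have "\<dots> = (\<Sum>l<d. f (u j l) * (of_real m * T l c))"
          by (intro sum.cong refl) (simp add: YT)
        also have "\<dots> = of_real m * (\<Sum>k<d. f (u j k) * T k c)"
          by (simp add: sum_distrib_left mult_ac)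
        finally show ?thesis .
      qed
      then show "(\<lambda>a. \<Sum>k<d. f (u a k) * T k c) \<in> W" by (simp add: W_def)
    qed
    \<comment> \<open>Adjoints of the previous identity for \<open>sharp f\<close> give
      \<open>T f(u) T = T f(u)\<close>. Hence \<open>T\<close> commutes with every
      \<open>f(u)\<close>, and functionals separate points.\<close>
    have comm: "(\<Sum>k<d. scl (T k r) (u c k)) = (\<Sum>k<d. scl (T c k) (u k r))" if cr: "c < d" "r < d" for c r
    proof (rule separating_eq)
      fix f assume f: "functional f"
      have 1: "cnj (\<Sum>k<d. sharp f (u a k) * T k c) = (\<Sum>k<d. f (u k a) * T c k)" if "a < d" for a
        unfolding cnj_sum by (intro sum.cong refl) (use that in \<open>simp add: sharp(2)[OF f u] Therm[OF _ cr(1)]\<close>)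
      have 2: "cnj (\<Sum>a<d. T r a * g a) = (\<Sum>a<d. T a r * cnj (g a))" for g
        unfolding cnj_sum by (intro sum.cong refl) (simp add: Therm[OF cr(2)])
      have "(\<Sum>a<d. T a r * (\<Sum>k<d. f (u k a) * T c k))
          = cnj (\<Sum>a<d. T r a * (\<Sum>k<d. sharp f (u a k) * T k c))"
        unfolding 2 by (intro sum.cong refl) (simp only: 1 lessThan_iff)
      also have "\<dots> = cnj (\<Sum>k<d. sharp f (u r k) * T k c)"
        by (simp only: fTW[OF sharp(1)[OF f] cr(2)])
      also have "\<dots> = (\<Sum>k<d. f (u k r) * T c k)" by (rule 1[OF cr(2)])
      finally have "(\<Sum>a<d. T a r * (\<Sum>k<d. f (u k a) * T c k)) = (\<Sum>k<d. f (u k r) * T c k)" .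
      moreover have "(\<Sum>a<d. T a r * (\<Sum>k<d. f (u k a) * T c k)) = (\<Sum>k<d. T c k * (\<Sum>a<d. f (u k a) * T a r))"
        unfolding sum_distrib_left by (subst sum.swap) (simp add: mult_ac)
      ultimately have "(\<Sum>k<d. f (u c k) * T k r) = (\<Sum>k<d. f (u k r) * T c k)"
        using fTW[OF f cr(1), of r] by simp
      then show "f (\<Sum>k<d. scl (T k r) (u c k)) = f (\<Sum>k<d. scl (T c k) (u k r))"
        by (simp add: linmap_sum[OF f] linmap_sc[OF f] mult.commute)
    qed
    have RT: "(\<Sum>i<d. T i r * h (star (u i J) * star (v n q))) = 0"
      if v: "unitary_rep H e v" and J: "J < d" and q: "q < e" and n: "n < e" and r: "r < d" for e v J q n r
    proof -
      define R where "R = (\<lambda>i p. h (star (u i J) * star (v p q)))"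
      have cv: "corep H {..<e} v" using v by (simp add: unitary_rep_def is_corep_iff)
      \<comment> \<open>Invariance on the tensor product of the conjugates of \<open>u\<close> and
        \<open>v\<close>, with \<open>v\<close> moved across by unitarity.\<close>
      have Ruv: "(\<Sum>s<d. scl (R s t) (star (u i s))) = (\<Sum>p<e. scl (R i p) (v p t))" if it: "i < d" "t < e" for i t
      proof -
        have fix1: "(\<Sum>s<d. \<Sum>t<e. scl (R s t) (star (u i s) * star (v p t))) = scl (R i p) 1"
          if "p < e" for p
          using invariant_corep(2)[OF h corep_prod[OF corep_star[OF co] corep_star[OF cv]], of "(i,p)" "(J,q)"] that it J q
          by (simp add: sum.cartesian_product split_def R_def)
        have "(\<Sum>p<e. scl (R i p) (v p t)) = (\<Sum>p<e. scl (R i p) 1 * v p t)" by (simp add: sc_mult_left)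
        also have "\<dots> = (\<Sum>p<e. (\<Sum>t<e. (\<Sum>s<d. scl (R s t) (star (u i s))) * star (v p t)) * v p t)"
        proof (intro sum.cong refl)
          fix p assume "p \<in> {..<e}"
          then have "scl (R i p) 1 = (\<Sum>s<d. \<Sum>t<e. scl (R s t) (star (u i s) * star (v p t)))" by (simp add: fix1)
          also have "\<dots> = (\<Sum>t<e. (\<Sum>s<d. scl (R s t) (star (u i s))) * star (v p t))"
            unfolding sum_distrib_right sc_mult_left by (rule sum.swap)
          finally show "scl (R i p) 1 * v p t = (\<Sum>t<e. (\<Sum>s<d. scl (R s t) (star (u i s))) * star (v p t)) * v p t" by simp
        qed
        also have "\<dots> = (\<Sum>s<d. scl (R s t) (star (u i s)))"
          by (rule mat_cancel_right[where u = "\<lambda>t p. star (v p t)" and w = v]) (use unitary_orth[OF v] it in auto)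
        finally show ?thesis by simp
      qed
      define D where "D = (\<lambda>i k. \<Sum>n<e. R i n * cnj (R k n))"
      \<comment> \<open>The intertwining relation is used for \<open>R\<close> and for its adjoint;
        unitarity of \<open>v\<close> cancels the middle.\<close>
      have Dfix: "(\<Sum>j<d. \<Sum>l<d. scl (D j l) (star (u i j) * u k l)) = scl (D i k) 1" if ik: "i < d" "k < d" for i k
      proof -
        have "(\<Sum>j<d. \<Sum>l<d. scl (D j l) (star (u i j) * u k l))
          = (\<Sum>j<d. \<Sum>l<d. \<Sum>n<e. scl (R j n) (star (u i j)) * scl (cnj (R l n)) (u k l))"
          by (simp add: D_def vs.scale_sum_left sc_mult_left sc_mult_right sc_sc mult.commute)
        also have "\<dots> = (\<Sum>n<e. \<Sum>j<d. \<Sum>l<d. scl (R j n) (star (u i j)) * scl (cnj (R l n)) (u k l))"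
          by (rule trans[OF sum.cong[OF refl sum.swap] sum.swap])
        also have "\<dots> = (\<Sum>n<e. (\<Sum>s<d. scl (R s n) (star (u i s))) * star (\<Sum>s<d. scl (R s n) (star (u k s))))"
          by (simp add: sum_product star_sum star_sc star_star)
        also have "\<dots> = (\<Sum>n<e. (\<Sum>p<e. scl (R i p) (v p n)) * star (\<Sum>p<e. scl (R k p) (v p n)))"
          using ik by (intro sum.cong refl) (simp add: Ruv)
        also have "\<dots> = (\<Sum>n<e. (\<Sum>p<e. scl (R i p) 1 * v p n) * (\<Sum>p<e. star (v p n) * scl (cnj (R k p)) 1))"
          by (simp add: star_sum star_sc sc_mult_left sc_mult_right)
        also have "\<dots> = (\<Sum>n<e. \<Sum>l<e. ((\<Sum>p<e. scl (R i p) 1 * v p n) * star (v l n)) * scl (cnj (R k l)) 1)"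
          by (simp add: sum_distrib_left mult.assoc)
        also have "\<dots> = (\<Sum>l<e. (\<Sum>n<e. (\<Sum>p<e. scl (R i p) 1 * v p n) * star (v l n)) * scl (cnj (R k l)) 1)"
          unfolding sum_distrib_right by (rule sum.swap)
        also have "\<dots> = (\<Sum>l<e. scl (R i l) 1 * scl (cnj (R k l)) 1)"
        proof (intro sum.cong refl arg_cong2[where f = times])
          fix l assume "l \<in> {..<e}"
          then show "(\<Sum>n<e. (\<Sum>p<e. scl (R i p) 1 * v p n) * star (v l n)) = scl (R i l) 1"
            by (intro mat_cancel_right[where u = v and w = "\<lambda>n l. star (v l n)"]) (use unitary_orth[OF v] in auto)
        qed
        finally show ?thesis by (simp add: D_def vs.scale_sum_left sc_mult_left sc_sc)
      qed
      \<comment> \<open>Passing from \<open>\<xi>\<close> to \<open>\<zeta>\<close> compresses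
        \<open>X\<close> by \<open>T\<close>, because \<open>T\<close> commutes with
        \<open>u\<close>. The Gram matrix of \<open>X'\<close> under \<open>h\<close> is therefore
        \<open>T Y T = m T\<close>, yet it has the same shape as that of \<open>X\<close>.\<close>
      define \<zeta> where "\<zeta> = (\<lambda>i. \<Sum>k<d. \<xi> k * T k i)"
      define X' where "X' = (\<lambda>j. \<Sum>i<d. scl (\<zeta> i) (u i j))"
      have X': "X' j = (\<Sum>i<d. scl (T i j) (X i))" if "j < d" for j
      proof -
        have "X' j = (\<Sum>i<d. \<Sum>k<d. scl (\<xi> k) (scl (T k i) (u i j)))"
          by (simp add: X'_def \<zeta>_def vs.scale_sum_left sc_sc)
        also have "\<dots> = (\<Sum>k<d. scl (\<xi> k) (\<Sum>i<d. scl (T k i) (u i j)))"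
          unfolding vs.scale_sum_right by (rule sum.swap)
        also have "\<dots> = (\<Sum>k<d. scl (\<xi> k) (\<Sum>i<d. scl (T i j) (u k i)))"
          using that by (intro sum.cong refl) (simp add: comm)
        also have "\<dots> = (\<Sum>i<d. scl (T i j) (X i))"
          unfolding X_def vs.scale_sum_right by (subst sum.swap) (simp add: sc_sc mult.commute)
        finally show ?thesis .
      qed
      \<comment> \<open>The pairing of \<open>D\<close> with this Gram matrix is computed twice: the
        fixed-point property of \<open>D\<close> gives \<open>A\<close>, the eigenvalue gives
        \<open>m B\<close>. As \<open>m < 0\<close>, the signs force \<open>B = 0\<close>.\<close>
      define A where "A = (\<Sum>n<e. (cmod (\<Sum>i<d. cnj (\<zeta> i) * R i n))\<^sup>2)"
      define B where "B = (\<Sum>p<d. \<Sum>n<e. (cmod (\<Sum>j<d. R j n * T j p))\<^sup>2)"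
      have "(\<Sum>j<d. \<Sum>l<d. D j l * h (star (X' j) * X' l)) = of_real A"
      proof -
        have exp: "h (star (X' j) * X' l) = (\<Sum>i<d. \<Sum>k<d. (cnj (\<zeta> i) * \<zeta> k) * h (star (u i j) * u k l))" for j l
          by (simp add: X'_def star_sum star_sc sum_product sc_mult_left sc_mult_right sc_sc
            linmap_sum[OF hf(1)] linmap_sc[OF hf(1)] mult_ac)
        have "(\<Sum>j<d. \<Sum>l<d. D j l * h (star (X' j) * X' l))
          = (\<Sum>j<d. \<Sum>l<d. \<Sum>i<d. \<Sum>k<d. cnj (\<zeta> i) * \<zeta> k * h (scl (D j l) (star (u i j) * u k l)))"
          by (simp add: exp linmap_sc[OF hf(1)] sum_distrib_left mult_ac)
        also have "\<dots> = (\<Sum>j<d. \<Sum>i<d. \<Sum>k<d. \<Sum>l<d. cnj (\<zeta> i) * \<zeta> k * h (scl (D j l) (star (u i j) * u k l)))"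
          by (intro sum.cong[OF refl] trans[OF sum.swap sum.cong[OF refl sum.swap]])
        also have "\<dots> = (\<Sum>i<d. \<Sum>k<d. \<Sum>j<d. \<Sum>l<d. cnj (\<zeta> i) * \<zeta> k * h (scl (D j l) (star (u i j) * u k l)))"
          by (rule trans[OF sum.swap sum.cong[OF refl sum.swap]])
        also have "\<dots> = (\<Sum>i<d. \<Sum>k<d. cnj (\<zeta> i) * \<zeta> k * h (\<Sum>j<d. \<Sum>l<d. scl (D j l) (star (u i j) * u k l)))"
          by (simp add: sum_distrib_left linmap_sum[OF hf(1)])
        also have "\<dots> = (\<Sum>i<d. \<Sum>k<d. cnj (\<zeta> i) * \<zeta> k * D i k)"
          by (intro sum.cong refl) (simp add: Dfix linmap_sc[OF hf(1)] hf(2))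
        also have "\<dots> = (\<Sum>i<d. \<Sum>k<d. \<Sum>n<e. (cnj (\<zeta> i) * R i n) * cnj (cnj (\<zeta> k) * R k n))"
          by (simp add: D_def sum_distrib_left mult_ac)
        also have "\<dots> = (\<Sum>n<e. \<Sum>i<d. \<Sum>k<d. (cnj (\<zeta> i) * R i n) * cnj (cnj (\<zeta> k) * R k n))"
          by (rule trans[OF sum.cong[OF refl sum.swap] sum.swap])
        also have "\<dots> = (\<Sum>n<e. (\<Sum>i<d. cnj (\<zeta> i) * R i n) * cnj (\<Sum>i<d. cnj (\<zeta> i) * R i n))"
          unfolding cnj_sum sum_product by (rule refl)
        also have "\<dots> = of_real A"
          unfolding A_def of_real_sum by (intro sum.cong refl) (rule complex_norm_square[symmetric])
        finally show ?thesis .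
      qed
      moreover have "(\<Sum>j<d. \<Sum>l<d. D j l * h (star (X' j) * X' l)) = of_real (m * B)"
      proof -
        have hX: "h (star (X' j) * X' l) = of_real m * (\<Sum>p<d. T j p * cnj (T l p))" if "j < d" "l < d" for j l
        proof -
          have "h (star (X' j) * X' l) = (\<Sum>p<d. \<Sum>q<d. cnj (T p j) * (Y p q * T q l))"
            using that by (simp add: X' star_sum star_sc sum_product sc_mult_left sc_mult_right sc_sc Y_def
              linmap_sum[OF hf(1)] linmap_sc[OF hf(1)] mult_ac)
          also have "\<dots> = (\<Sum>p<d. cnj (T p j) * (of_real m * T p l))"
            by (intro sum.cong refl) (simp add: YT flip: sum_distrib_left)
          also have "\<dots> = (\<Sum>p<d. of_real m * (T j p * cnj (T l p)))"
          proof (intro sum.cong refl)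
            fix p assume "p \<in> {..<d}"
            then have 1: "cnj (T p j) = T j p" "cnj (T l p) = T p l"
              using Therm[of p j] Therm[of l p] that by auto
            show "cnj (T p j) * (of_real m * T p l) = of_real m * (T j p * cnj (T l p))"
              by (simp only: 1 mult_ac)
          qed
          finally show ?thesis by (simp add: sum_distrib_left)
        qed
        have "(\<Sum>j<d. \<Sum>l<d. D j l * h (star (X' j) * X' l))
          = (\<Sum>j<d. \<Sum>l<d. D j l * (of_real m * (\<Sum>p<d. T j p * cnj (T l p))))"
          by (intro sum.cong refl) (simp add: hX)
        also have "\<dots> = of_real m * (\<Sum>j<d. \<Sum>l<d. \<Sum>p<d. \<Sum>n<e. (R j n * T j p) * cnj (R l n * T l p))"
          unfolding sum_distrib_left D_def sum_distrib_right
          by (intro sum.cong refl) (simp add: mult_ac)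
        also have "(\<Sum>j<d. \<Sum>l<d. \<Sum>p<d. \<Sum>n<e. (R j n * T j p) * cnj (R l n * T l p))
          = (\<Sum>p<d. \<Sum>j<d. \<Sum>l<d. \<Sum>n<e. (R j n * T j p) * cnj (R l n * T l p))"
          by (rule trans[OF sum.cong[OF refl sum.swap] sum.swap])
        also have "\<dots> = (\<Sum>p<d. \<Sum>n<e. \<Sum>j<d. \<Sum>l<d. (R j n * T j p) * cnj (R l n * T l p))"
          by (intro sum.cong[OF refl] trans[OF sum.cong[OF refl sum.swap] sum.swap])
        also have "\<dots> = (\<Sum>p<d. \<Sum>n<e. (\<Sum>j<d. R j n * T j p) * cnj (\<Sum>j<d. R j n * T j p))"
          unfolding cnj_sum sum_product by (rule refl)
        also have "\<dots> = of_real B"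
          unfolding B_def of_real_sum by (intro sum.cong refl) (rule complex_norm_square[symmetric])
        finally show ?thesis by simp
      qed
      ultimately have "A = m * B" by (metis of_real_eq_iff)
      moreover have "A \<ge> 0" "B \<ge> 0" by (auto simp: A_def B_def intro!: sum_nonneg)
      ultimately have "B = 0" using m by (metis linorder_not_le mult_neg_pos order_antisym_conv)
      then have "(\<Sum>n<e. (cmod (\<Sum>j<d. R j n * T j r))\<^sup>2) = 0"
        unfolding B_def by (subst (asm) sum_nonneg_eq_0_iff) (use r in \<open>auto intro: sum_nonneg\<close>)
      then have "(\<Sum>j<d. R j n * T j r) = 0"
        by (subst (asm) sum_nonneg_eq_0_iff) (use n in auto)
      then show ?thesis by (simp add: R_def mult.commute)
    qed
    have "T J r = 0" if J: "J < d" and r: "r < d" for J r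
    proof -
      \<comment> \<open>Orthogonality to all the intertwiners says that
        \<open>h (y * star a)\<close> vanishes for every \<open>a\<close>; the counit of
        \<open>y\<close> recovers the entry \<open>T J r\<close>.\<close>
      define y where "y = (\<Sum>i<d. scl (T i r) (star (u i J)))"
      have y0: "h (y * star a) = 0" for a
      proof (induction a rule: coefficient_induct)
        case (coef e v n q)
        then show ?case using RT[OF coef(1) J _ _ r]
          by (simp add: y_def sum_distrib_right sc_mult_left linmap_sum[OF hf(1)] linmap_sc[OF hf(1)])
      qed (simp_all add: star_0 star_add star_sc distrib_left sc_mult_right linmap_0[OF hf(1)] linmap_add[OF hf(1)] linmap_sc[OF hf(1)])
      have "h (y * c) = 0" for c using y0[of "star c"] by (simp add: star_star)
      then have "y = 0" by (rule invariant_nondegenerate_right[OF h])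
      then have "eps y = 0" by (simp add: linmap_0[OF eps_functional])
      moreover have "eps y = (\<Sum>i<d. T i r * (if i = J then 1 else 0))"
        using J by (simp add: y_def linmap_sum[OF eps_functional] linmap_sc[OF eps_functional] eps_star
          invertible_corepD(3)[OF unitary_invertible[OF u]] cong: sum.cong if_cong)
           (intro sum.cong refl, simp add: invertible_corepD(3)[OF unitary_invertible[OF u]])
      ultimately show ?thesis using J by (simp add: sum_delta)
    qed
    moreover have "z \<in> W" using eig by (simp add: W_def)
    ultimately have "z i = 0" if "i < d" for i using Tid[OF _ that, of z] that by simp
    with z show False by blast
  qed
qed

section \<open>Identification of the Haar state\<close>

lemma haar_state_iff: "haar_state H h \<longleftrightarrow> invariant h"
  using invariant_positive[of h] by (auto simp: haar_state_def invariant_def lin_fun_iff tsum_def)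

lemma haar_invariant: "invariant (haar H)"
proof -
  obtain h where "invariant h" using invariant_exists by blast
  then have "\<exists>!h. haar_state H h" unfolding haar_state_iff using invariant_unique by blast
  from theI'[OF this] show ?thesis by (simp add: haar_def haar_state_iff)
qed

end

section \<open>Complete reducibility\<close>

text \<open>Only the inner dimension is recorded, so rectangular factors multiply without further
  bookkeeping.\<close>

definition cmat_mult :: "nat \<Rightarrow> (nat \<Rightarrow> nat \<Rightarrow> complex) \<Rightarrow> (nat \<Rightarrow> nat \<Rightarrow> complex) \<Rightarrow> nat \<Rightarrow> nat \<Rightarrow> complex" where
  "cmat_mult d X Y i j = (\<Sum>k<d. X i k * Y k j)"

lemma cmat_mult_assoc: "cmat_mult m (cmat_mult n X Y) Z = cmat_mult n X (cmat_mult m Y Z)"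
  by (intro ext) (simp add: cmat_mult_def sum_distrib_left sum_distrib_right mult.assoc, rule sum.swap)

lemma cmat_mult_cong: "(\<And>k. k < d \<Longrightarrow> X i k = X' i k) \<Longrightarrow> (\<And>k. k < d \<Longrightarrow> Y k j = Y' k j) \<Longrightarrow> cmat_mult d X Y i j = cmat_mult d X' Y' i j"
  by (simp add: cmat_mult_def)

context cqg_alg
begin

text \<open>Since \<open>E = J K\<close> commutes with \<open>v\<close> and \<open>E J = J\<close>,
  the compressions multiply: \<open>(K f(v) J)(K g(v) J) = K f(v) E g(v) J = K f(v) g(v) J\<close>.
  Functionals reduce the corepresentation law to such complex products.\<close>

lemma compression_corep:
  fixes d k :: nat
  assumes v: "invertible_corep {..<d} v"
    and comm: "\<And>i j. i < d \<Longrightarrow> j < d \<Longrightarrow> (\<Sum>k<d. scl (E i k) (v k j)) = (\<Sum>k<d. scl (E k j) (v i k))"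
    and E: "\<And>i j. i < d \<Longrightarrow> j < d \<Longrightarrow> E i j = (\<Sum>a<k. J i a * K a j)"
    and KJ: "\<And>a b. a < k \<Longrightarrow> b < k \<Longrightarrow> (\<Sum>i<d. K a i * J i b) = (if a = b then 1 else 0)"
  shows "invertible_corep {..<k} (\<lambda>a b. \<Sum>i<d. \<Sum>j<d. scl (K a i * J j b) (v i j))"
proof -
  define v' where "v' = (\<lambda>a b. \<Sum>i<d. \<Sum>j<d. scl (K a i * J j b) (v i j))"
  have fv': "f (v' a b) = cmat_mult d K (cmat_mult d (\<lambda>i j. f (v i j)) J) a b" if "functional f" for f a b
    by (simp add: v'_def cmat_mult_def linmap_sum[OF that] linmap_sc[OF that] sum_distrib_left mult_ac)
  have co: "corep H {..<d} v" by (rule invertible_corepD(1)[OF v])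
  have "cs (v' a b) (\<lambda>x y. f x * g y) = (\<Sum>c<k. f (v' a c) * g (v' c b))"
    if f: "functional f" and g: "functional g" and ab: "a < k" "b < k" for f g a b
  proof -
    let ?f = "\<lambda>i j. f (v i j)" and ?g = "\<lambda>i j. g (v i j)"
    define C where "C = (\<lambda>x. cs x (\<lambda>x y. f x * g y))"
    have C: "functional C" unfolding C_def by (rule cs_functional[OF bilin_functional_prod[OF f g]])
    have EJ: "cmat_mult d E J m b = J m b" if "m < d" for m
    proof -
      have "cmat_mult d E J m b = cmat_mult d (cmat_mult k J K) J m b"
        by (rule cmat_mult_cong) (use that E in \<open>auto simp: cmat_mult_def\<close>)
      also have "\<dots> = cmat_mult k J (cmat_mult d K J) m b" by (simp only: cmat_mult_assoc)
      also have "\<dots> = (\<Sum>a<k. J m a * (if a = b then 1 else 0))"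
        unfolding cmat_mult_def[of k] by (intro sum.cong refl) (simp add: cmat_mult_def KJ ab)
      also have "\<dots> = J m b" using ab by (simp add: sum_delta)
      finally show ?thesis .
    qed
    have JK: "cmat_mult k J (cmat_mult d K (cmat_mult d ?g J)) i b = cmat_mult d ?g J i b" if i: "i < d" for i
    proof -
      have gE: "cmat_mult d E ?g i m = cmat_mult d ?g E i m" if "m < d" for m
        using arg_cong[OF comm[OF i that], of g] by (simp add: cmat_mult_def linmap_sum[OF g] linmap_sc[OF g] mult.commute)
      have "cmat_mult k J (cmat_mult d K (cmat_mult d ?g J)) i b = cmat_mult d (cmat_mult k J K) (cmat_mult d ?g J) i b" by (simp only: cmat_mult_assoc)
      also have "\<dots> = cmat_mult d E (cmat_mult d ?g J) i b"
        by (rule cmat_mult_cong) (use i E in \<open>auto simp: cmat_mult_def\<close>)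
      also have "\<dots> = cmat_mult d (cmat_mult d E ?g) J i b" by (simp only: cmat_mult_assoc)
      also have "\<dots> = cmat_mult d (cmat_mult d ?g E) J i b" by (rule cmat_mult_cong) (simp_all only: gE)
      also have "\<dots> = cmat_mult d ?g (cmat_mult d E J) i b" by (simp only: cmat_mult_assoc)
      also have "\<dots> = cmat_mult d ?g J i b" by (rule cmat_mult_cong) (simp_all only: EJ)
      finally show ?thesis .
    qed
    have "cs (v' a b) (\<lambda>x y. f x * g y) = cmat_mult d K (cmat_mult d (\<lambda>i j. C (v i j)) J) a b"
      using fv'[OF C] by (simp add: C_def)
    also have "\<dots> = cmat_mult d K (cmat_mult d (cmat_mult d ?f ?g) J) a b"
      by (intro cmat_mult_cong refl) (use co f g in \<open>simp add: C_def cmat_mult_def corep_def\<close>)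
    also have "\<dots> = cmat_mult d K (cmat_mult d ?f (cmat_mult d ?g J)) a b" by (simp only: cmat_mult_assoc)
    also have "\<dots> = cmat_mult d K (cmat_mult d ?f (cmat_mult k J (cmat_mult d K (cmat_mult d ?g J)))) a b"
      by (intro cmat_mult_cong refl) (simp add: JK)
    also have "\<dots> = cmat_mult k (cmat_mult d K (cmat_mult d ?f J)) (cmat_mult d K (cmat_mult d ?g J)) a b"
      by (simp only: cmat_mult_assoc)
    also have "\<dots> = (\<Sum>c<k. f (v' a c) * g (v' c b))" by (simp add: cmat_mult_def[of k] fv'[OF f] fv'[OF g])
    finally show ?thesis .
  qed
  then have "corep H {..<k} v'" by (simp add: corep_def)
  moreover have "eps (v' a b) = (if a = b then 1 else 0)" if "a < k" "b < k" for a b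
  proof -
    have "eps (v' a b) = cmat_mult d K (cmat_mult d (\<lambda>i j. eps (v i j)) J) a b" by (rule fv'[OF eps_functional])
    also have "\<dots> = cmat_mult d K J a b"
    proof (intro cmat_mult_cong refl)
      fix i assume "i < d"
      then have "cmat_mult d (\<lambda>i j. eps (v i j)) J i b = (\<Sum>j<d. (if i = j then 1 else 0) * J j b)"
        unfolding cmat_mult_def by (intro sum.cong refl) (simp add: invertible_corepD(3)[OF v])
      then show "cmat_mult d (\<lambda>i j. eps (v i j)) J i b = J i b" using \<open>i < d\<close> by (simp add: sum_delta)
    qed
    finally show ?thesis using KJ that by (simp add: cmat_mult_def)
  qed
  ultimately show ?thesis by (simp add: invertible_corep_def v'_def)
qed

text \<open>\<open>Q\<close> is the average \<open>h (v P v\<^sup>-\<^sup>1)\<close>.\<close>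

lemma commuting_projection_exists:
  fixes d :: nat
  assumes v: "invertible_corep {..<d} v"
    and idem: "\<And>i j. i < d \<Longrightarrow> j < d \<Longrightarrow> (\<Sum>k<d. P i k * P k j) = P i j"
    and stable: "\<And>i j. i < d \<Longrightarrow> j < d \<Longrightarrow>
       (\<Sum>k<d. \<Sum>l<d. scl (((if i = k then 1 else 0) - P i k) * P l j) (v k l)) = 0"
  obtains Q where
    "\<And>i j. i < d \<Longrightarrow> j < d \<Longrightarrow> (\<Sum>k<d. scl (Q i k) (v k j)) = (\<Sum>k<d. scl (Q k j) (v i k))"
    "\<And>i j. i < d \<Longrightarrow> j < d \<Longrightarrow> (\<Sum>k<d. P i k * Q k j) = Q i j"
    "\<And>i j. i < d \<Longrightarrow> j < d \<Longrightarrow> (\<Sum>k<d. Q i k * P k j) = P i j"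
proof -
  obtain h where h: "invariant h" using invariant_exists by blast
  have hf: "functional h" "h 1 = 1" using h by (simp_all add: invariant_def)
  note V = invertible_corepD[OF v]
  define Q where "Q = (\<lambda>i j. \<Sum>k<d. \<Sum>l<d. P k l * h (v i k * S (v l j)))"
  have vP: "(\<Sum>k<d. \<Sum>l<d. scl (P i k * P l j) (v k l)) = (\<Sum>l<d. scl (P l j) (v i l))"
    if ij: "i < d" "j < d" for i j
  proof -
    have "(\<Sum>k<d. \<Sum>l<d. scl (((if i = k then 1 else 0) - P i k) * P l j) (v k l))
      = (\<Sum>k<d. if i = k then (\<Sum>l<d. scl (P l j) (v k l)) else 0) - (\<Sum>k<d. \<Sum>l<d. scl (P i k * P l j) (v k l))"
      unfolding sum_subtractf[symmetric]
      by (intro sum.cong refl) (auto simp: left_diff_distrib vs.scale_left_diff_distrib sum_subtractf)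
    then show ?thesis using stable[OF ij] ij by (simp add: sum.delta')
  qed
  \<comment> \<open>The relation \<open>P v P = v P\<close> is linear in the entries, so
    \<open>S\<close> carries it to the inverse matrix \<open>w = S(v)\<close>. It yields
    \<open>Q P = h(v P w P) = h(v w P) = P\<close>.\<close>
  have wP: "(\<Sum>k<d. \<Sum>l<d. scl (P i k * P l j) (S (v k l))) = (\<Sum>l<d. scl (P l j) (S (v i l)))"
    if ij: "i < d" "j < d" for i j
    using arg_cong[OF vP[OF ij], of S] by (simp add: linmap_sum[OF S_linmap] S_sc)
  show thesis
  proof (rule that)
    show "(\<Sum>k<d. scl (Q i k) (v k j)) = (\<Sum>k<d. scl (Q k j) (v i k))" if ij: "i < d" "j < d" for i j
    proof -
      have fix1: "(\<Sum>m<d. \<Sum>n<d. scl (h (v m k * S (v l n))) (v i m * S (v n r))) = scl (h (v i k * S (v l r))) 1"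
        if "k < d" "l < d" "r < d" for k l r
        using invariant_corep(2)[OF h corep_prod[OF V(1) corep_S[OF V(1)]], of "(i,r)" "(k,l)"] that ij
        by (simp add: sum.cartesian_product split_def)
      \<comment> \<open>Averaging makes \<open>v Q v^-1 = Q\<close>; multiplying by \<open>v\<close>
        from the right then gives the commutation.\<close>
      have fix2: "(\<Sum>m<d. \<Sum>n<d. scl (Q m n) (v i m * S (v n r))) = scl (Q i r) 1" if "r < d" for r
      proof -
        have "(\<Sum>m<d. \<Sum>n<d. scl (Q m n) (v i m * S (v n r)))
          = (\<Sum>m<d. \<Sum>n<d. \<Sum>k<d. \<Sum>l<d. scl (P k l) (scl (h (v m k * S (v l n))) (v i m * S (v n r))))"
          by (simp add: Q_def vs.scale_sum_left sc_sc)
        also have "\<dots> = (\<Sum>m<d. \<Sum>k<d. \<Sum>l<d. \<Sum>n<d. scl (P k l) (scl (h (v m k * S (v l n))) (v i m * S (v n r))))"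
          by (intro sum.cong[OF refl] trans[OF sum.swap sum.cong[OF refl sum.swap]])
        also have "\<dots> = (\<Sum>k<d. \<Sum>l<d. \<Sum>m<d. \<Sum>n<d. scl (P k l) (scl (h (v m k * S (v l n))) (v i m * S (v n r))))"
          by (rule trans[OF sum.swap sum.cong[OF refl sum.swap]])
        also have "\<dots> = (\<Sum>k<d. \<Sum>l<d. scl (P k l) (scl (h (v i k * S (v l r))) 1))"
          unfolding vs.scale_sum_right[symmetric] using that
          by (intro sum.cong refl) (simp only: fix1 lessThan_iff)
        also have "\<dots> = scl (Q i r) 1" by (simp add: Q_def vs.scale_sum_left sc_sc)
        finally show ?thesis .
      qed
      have "(\<Sum>r<d. scl (Q i r) (v r j)) = (\<Sum>r<d. (\<Sum>n<d. (\<Sum>m<d. scl (Q m n) (v i m)) * S (v n r)) * v r j)"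
      proof (intro sum.cong refl)
        fix r assume "r \<in> {..<d}"
        then have "scl (Q i r) 1 = (\<Sum>m<d. \<Sum>n<d. scl (Q m n) (v i m * S (v n r)))" using fix2 by simp
        also have "\<dots> = (\<Sum>n<d. (\<Sum>m<d. scl (Q m n) (v i m)) * S (v n r))"
          unfolding sum_distrib_right sc_mult_left by (rule sum.swap)
        finally have "scl (Q i r) 1 * v r j = (\<Sum>n<d. (\<Sum>m<d. scl (Q m n) (v i m)) * S (v n r)) * v r j"
          by (rule arg_cong)
        then show "scl (Q i r) (v r j) = (\<Sum>n<d. (\<Sum>m<d. scl (Q m n) (v i m)) * S (v n r)) * v r j"
          by (simp add: sc_mult_left)
      qed
      also have "\<dots> = (\<Sum>m<d. scl (Q m j) (v i m))"
        by (rule mat_cancel_right) (use V ij in auto)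
      finally show ?thesis .
    qed
    show "(\<Sum>a<d. P i a * Q a j) = Q i j" if ij: "i < d" "j < d" for i j
    proof -
      have "(\<Sum>a<d. P i a * Q a j) = (\<Sum>a<d. \<Sum>k<d. \<Sum>l<d. h (scl (P i a * P k l) (v a k) * S (v l j)))"
        by (simp add: Q_def sum_distrib_left sc_mult_left linmap_sc[OF hf(1)] mult.assoc)
      also have "\<dots> = (\<Sum>l<d. \<Sum>a<d. \<Sum>k<d. h (scl (P i a * P k l) (v a k) * S (v l j)))"
        by (rule trans[OF sum.cong[OF refl sum.swap] sum.swap])
      also have "\<dots> = (\<Sum>l<d. h ((\<Sum>a<d. \<Sum>k<d. scl (P i a * P k l) (v a k)) * S (v l j)))"
        by (simp add: sum_distrib_right linmap_sum[OF hf(1)])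
      also have "\<dots> = (\<Sum>l<d. h ((\<Sum>k<d. scl (P k l) (v i k)) * S (v l j)))"
        using ij by (intro sum.cong refl) (simp add: vP)
      also have "\<dots> = (\<Sum>l<d. \<Sum>k<d. P k l * h (v i k * S (v l j)))"
        by (simp add: sum_distrib_right linmap_sum[OF hf(1)] sc_mult_left linmap_sc[OF hf(1)])
      also have "\<dots> = Q i j" unfolding Q_def by (rule sum.swap)
      finally show ?thesis .
    qed
    show "(\<Sum>a<d. Q i a * P a j) = P i j" if ij: "i < d" "j < d" for i j
    proof -
      have "(\<Sum>a<d. Q i a * P a j) = (\<Sum>a<d. \<Sum>k<d. \<Sum>l<d. h (v i k * scl (P k l * P a j) (S (v l a))))"
        unfolding Q_def sum_distrib_right
        by (intro sum.cong refl) (simp add: sc_mult_right linmap_sc[OF hf(1)] mult_ac)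
      also have "\<dots> = (\<Sum>k<d. \<Sum>l<d. \<Sum>a<d. h (v i k * scl (P k l * P a j) (S (v l a))))"
        by (rule trans[OF sum.swap sum.cong[OF refl sum.swap]])
      also have "\<dots> = (\<Sum>k<d. h (v i k * (\<Sum>l<d. \<Sum>a<d. scl (P k l * P a j) (S (v l a)))))"
        by (simp add: sum_distrib_left linmap_sum[OF hf(1)])
      also have "\<dots> = (\<Sum>k<d. h (v i k * (\<Sum>l<d. scl (P l j) (S (v k l)))))"
        using ij by (intro sum.cong refl) (simp add: wP)
      also have "\<dots> = h (\<Sum>k<d. v i k * (\<Sum>l<d. S (v k l) * scl (P l j) 1))"
        by (simp add: linmap_sum[OF hf(1)] sc_mult_right)
      also have "(\<Sum>k<d. v i k * (\<Sum>l<d. S (v k l) * scl (P l j) 1)) = scl (P i j) 1"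
        by (rule mat_cancel_left) (use V ij in auto)
      finally show ?thesis by (simp add: linmap_sc[OF hf(1)] hf(2))
    qed
  qed
qed

text \<open>Strong induction on the dimension. A reducible \<open>v\<close> commutes with an
  idempotent \<open>Q\<close> other than 0 and 1, and the entries of \<open>Q v\<close> and
  \<open>(1 - Q) v\<close> are combinations of coefficients of smaller corepresentations.\<close>

lemma irreducible_induct [case_names zero irreducible add scale]:
  assumes zero: "P 0" and irr: "\<And>d u i j. irreducible_rep H d u \<Longrightarrow> i < d \<Longrightarrow> j < d \<Longrightarrow> P (u i j)"
    and add: "\<And>x y. P x \<Longrightarrow> P y \<Longrightarrow> P (x + y)" and scale: "\<And>c x. P x \<Longrightarrow> P (scl c x)"
  shows "P a"
proof -
  have sum: "P (\<Sum>i\<in>I. g i)" if "\<And>i. i \<in> I \<Longrightarrow> P (g i)" for I :: "nat set" and g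
    using that by (induction I rule: infinite_finite_induct) (auto intro: zero add)
  have "P (v i j)" if "invertible_corep {..<d} v" "i < d" "j < d" for d :: nat and v i j
    using that
  proof (induction d arbitrary: v i j rule: less_induct)
    case (less d)
    note v = less.prems(1)
    have rep: "representation H d v" using v by (simp add: representation_iff)
    \<comment> \<open>With \<open>E = J K\<close> and \<open>w = K v J\<close> one has
      \<open>J w K = E v E = E v\<close>.\<close>
    have part: "P (\<Sum>k<d. scl (E i k) (v k j))"
      if comm: "\<And>i j. i < d \<Longrightarrow> j < d \<Longrightarrow> (\<Sum>k<d. scl (E i k) (v k j)) = (\<Sum>k<d. scl (E k j) (v i k))"
        and idem: "\<And>i j. i < d \<Longrightarrow> j < d \<Longrightarrow> (\<Sum>k<d. E i k * E k j) = E i j"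
        and not1: "\<exists>i<d. \<exists>j<d. E i j \<noteq> (if i = j then 1 else 0)" for E
    proof -
      obtain k J K where k: "k < d" and E: "\<And>i j. i < d \<Longrightarrow> j < d \<Longrightarrow> E i j = (\<Sum>a<k. J i a * K a j)"
        and KJ: "\<And>a b. a < k \<Longrightarrow> b < k \<Longrightarrow> (\<Sum>i<d. K a i * J i b) = (if a = b then 1 else 0)"
      proof (rule idempotent_rank_factorization[of d E])
        show "(\<Sum>k<d. E i k * E k j) = E i j" if "i < d" "j < d" for i j by (rule idem[OF that])
      next
        fix k J K
        assume *: "k < d" "\<And>i j. i < d \<Longrightarrow> j < d \<Longrightarrow> E i j = (\<Sum>a<k. J i a * K a j)"
          "\<And>a b. a < k \<Longrightarrow> b < k \<Longrightarrow> (\<Sum>i<d. K a i * J i b) = (if a = b then 1 else 0)"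
        show thesis by (rule that[OF *])
      qed (rule not1)
      define w where "w = (\<lambda>a b. \<Sum>i<d. \<Sum>j<d. scl (K a i * J j b) (v i j))"
      have w: "invertible_corep {..<k} w"
        unfolding w_def by (rule compression_corep[OF v comm E KJ])
      have "(\<Sum>a<k. \<Sum>b<k. scl (J i a * K b j) (w a b)) = (\<Sum>a<k. \<Sum>b<k. \<Sum>l<d. \<Sum>m<d. scl ((J i a * K a l) * (J m b * K b j)) (v l m))"
        by (simp add: w_def vs.scale_sum_right sc_sc mult_ac)
      also have "\<dots> = (\<Sum>a<k. \<Sum>l<d. \<Sum>m<d. \<Sum>b<k. scl ((J i a * K a l) * (J m b * K b j)) (v l m))"
        by (intro sum.cong[OF refl] trans[OF sum.swap sum.cong[OF refl sum.swap]])
      also have "\<dots> = (\<Sum>l<d. \<Sum>m<d. \<Sum>a<k. \<Sum>b<k. scl ((J i a * K a l) * (J m b * K b j)) (v l m))"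
        by (rule trans[OF sum.swap sum.cong[OF refl sum.swap]])
      also have "\<dots> = (\<Sum>l<d. \<Sum>m<d. scl (E i l * E m j) (v l m))"
        using less.prems by (intro sum.cong refl) (simp add: E sum_product vs.scale_sum_left)
      also have "\<dots> = (\<Sum>l<d. scl (E i l) (\<Sum>m<d. scl (E m j) (v l m)))"
        by (simp add: vs.scale_sum_right sc_sc)
      also have "\<dots> = (\<Sum>l<d. scl (E i l) (\<Sum>m<d. scl (E l m) (v m j)))"
        using less.prems by (intro sum.cong refl) (simp add: comm)
      also have "\<dots> = (\<Sum>m<d. scl (\<Sum>l<d. E i l * E l m) (v m j))"
        unfolding vs.scale_sum_right vs.scale_sum_left sc_sc by (rule sum.swap)
      also have "\<dots> = (\<Sum>m<d. scl (E i m) (v m j))"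
        using less.prems by (intro sum.cong refl) (simp add: idem)
      finally have eq: "(\<Sum>a<k. \<Sum>b<k. scl (J i a * K b j) (w a b)) = (\<Sum>m<d. scl (E i m) (v m j))" .
      show ?thesis unfolding eq[symmetric] by (intro sum scale) (simp add: less.IH[OF k w])
    qed
    show ?case
    proof (cases "irreducible_rep H d v")
      case True
      then show ?thesis using irr less.prems by blast
    next
      case False
      moreover have "0 < d" using less.prems by simp
      ultimately obtain P0 where P0: "\<forall>i<d. \<forall>j<d. (\<Sum>k<d. P0 i k * P0 k j) = P0 i j"
        "\<forall>i<d. \<forall>j<d. (\<Sum>k<d. \<Sum>l<d. scl (((if i = k then 1 else 0) - P0 i k) * P0 l j) (v k l)) = 0"
        "\<not> ((\<forall>i<d. \<forall>j<d. P0 i j = 0) \<or> (\<forall>i<d. \<forall>j<d. P0 i j = (if i = j then 1 else 0)))"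
        using rep unfolding irreducible_rep_def not_all not_imp de_Morgan_conj by auto
      have idem: "(\<Sum>k<d. P0 i k * P0 k j) = P0 i j" if "i < d" "j < d" for i j
        using P0(1) that by blast
      have stable: "(\<Sum>k<d. \<Sum>l<d. scl (((if i = k then 1 else 0) - P0 i k) * P0 l j) (v k l)) = 0"
        if "i < d" "j < d" for i j
        using P0(2) that by blast
      have ne: "\<exists>i<d. \<exists>j<d. P0 i j \<noteq> 0" "\<exists>i<d. \<exists>j<d. P0 i j \<noteq> (if i = j then 1 else 0)"
        using P0(3) by blast+
      obtain Q where comm: "\<And>i j. i < d \<Longrightarrow> j < d \<Longrightarrow> (\<Sum>k<d. scl (Q i k) (v k j)) = (\<Sum>k<d. scl (Q k j) (v i k))"
        and PQ: "\<And>i j. i < d \<Longrightarrow> j < d \<Longrightarrow> (\<Sum>k<d. P0 i k * Q k j) = Q i j"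
        and QP: "\<And>i j. i < d \<Longrightarrow> j < d \<Longrightarrow> (\<Sum>k<d. Q i k * P0 k j) = P0 i j"
      proof (rule commuting_projection_exists[OF v, of P0])
        show "(\<Sum>k<d. P0 i k * P0 k j) = P0 i j" if "i < d" "j < d" for i j by (rule idem[OF that])
        show "(\<Sum>k<d. \<Sum>l<d. scl (((if i = k then 1 else 0) - P0 i k) * P0 l j) (v k l)) = 0"
          if "i < d" "j < d" for i j by (rule stable[OF that])
      next
        fix Q
        assume *: "\<And>i j. i < d \<Longrightarrow> j < d \<Longrightarrow> (\<Sum>k<d. scl (Q i k) (v k j)) = (\<Sum>k<d. scl (Q k j) (v i k))"
          "\<And>i j. i < d \<Longrightarrow> j < d \<Longrightarrow> (\<Sum>k<d. P0 i k * Q k j) = Q i j"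
          "\<And>i j. i < d \<Longrightarrow> j < d \<Longrightarrow> (\<Sum>k<d. Q i k * P0 k j) = P0 i j"
        show thesis by (rule that[OF *])
      qed
      have QQ: "(\<Sum>k<d. Q i k * Q k j) = Q i j" if "i < d" "j < d" for i j
      proof -
        have "cmat_mult d Q Q i j = cmat_mult d Q (cmat_mult d P0 Q) i j" by (intro cmat_mult_cong refl) (use that PQ in \<open>simp add: cmat_mult_def\<close>)
        also have "\<dots> = cmat_mult d (cmat_mult d Q P0) Q i j" by (simp only: cmat_mult_assoc)
        also have "\<dots> = cmat_mult d P0 Q i j" by (intro cmat_mult_cong refl) (use that QP in \<open>simp add: cmat_mult_def\<close>)
        finally show ?thesis using PQ that by (simp add: cmat_mult_def)
      qed
      \<comment> \<open>\<open>Q = 1\<close> would turn \<open>P0 Q = Q\<close> into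
        \<open>P0 = 1\<close>; likewise \<open>Q = 0\<close> would turn \<open>Q P0 = P0\<close>
        into \<open>P0 = 0\<close>.\<close>
      have Q1: "\<exists>i<d. \<exists>j<d. Q i j \<noteq> (if i = j then 1 else 0)"
      proof (rule ccontr)
        assume "\<not> ?thesis"
        then have Q: "Q i j = (if i = j then 1 else 0)" if "i < d" "j < d" for i j using that by blast
        have "P0 i j = (if i = j then 1 else 0)" if "i < d" "j < d" for i j
        proof -
          have "(\<Sum>k<d. P0 i k * Q k j) = (\<Sum>k<d. P0 i k * (if k = j then 1 else 0))"
            using that by (intro sum.cong refl) (simp add: Q)
          then show ?thesis using PQ[OF that] Q[OF that] that by (simp add: sum_delta)
        qed
        with ne(2) show False by blast
      qed
      have Q0: "\<exists>i<d. \<exists>j<d. (if i = j then 1 else 0) - Q i j \<noteq> (if i = j then 1 else 0)"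
      proof (rule ccontr)
        assume "\<not> ?thesis"
        then have Q: "Q i j = 0" if "i < d" "j < d" for i j using that by fastforce
        have "P0 i j = 0" if "i < d" "j < d" for i j
          using QP[OF that] Q that by simp
        with ne(1) show False by blast
      qed
      have delta: "(\<Sum>k<d. scl (if i = k then 1 else 0) (v k j)) = v i j"
        "(\<Sum>k<d. scl (if k = j then 1 else 0) (v i k)) = v i j" if "i < d" "j < d" for i j
      proof -
        have "scl (if b then 1 else 0) x = (if b then x else 0)" for b x by (simp add: sc_1)
        then show "(\<Sum>k<d. scl (if i = k then 1 else 0) (v k j)) = v i j"
          "(\<Sum>k<d. scl (if k = j then 1 else 0) (v i k)) = v i j" using that by simp_all
      qed
      have 1: "P (\<Sum>k<d. scl (Q i k) (v k j))" by (rule part[OF comm QQ Q1])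
      have 2: "P (\<Sum>k<d. scl ((if i = k then 1 else 0) - Q i k) (v k j))"
      proof (rule part[OF _ _ Q0])
        fix i j assume ij: "i < d" "j < d"
        show "(\<Sum>k<d. scl ((if i = k then 1 else 0) - Q i k) (v k j)) = (\<Sum>k<d. scl ((if k = j then 1 else 0) - Q k j) (v i k))"
          using ij by (simp add: vs.scale_left_diff_distrib sum_subtractf delta comm)
        show "(\<Sum>k<d. ((if i = k then 1 else 0) - Q i k) * ((if k = j then 1 else 0) - Q k j)) = (if i = j then 1 else 0) - Q i j"
          using ij by (simp add: left_diff_distrib right_diff_distrib sum_subtractf sum_delta QQ)
      qed
      have "v i j = (\<Sum>k<d. scl (Q i k) (v k j)) + (\<Sum>k<d. scl ((if i = k then 1 else 0) - Q i k) (v k j))"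
        using less.prems by (simp add: vs.scale_left_diff_distrib sum_subtractf delta)
      with add[OF 1 2] show ?thesis by simp
    qed
  qed
  then show ?thesis
    by (induction a rule: coefficient_induct) (auto intro: zero add scale dest: unitary_invertible)
qed

end

section \<open>Normal and a-normal quantum subgroups\<close>

lemma tsum_ad_l: "tsum \<beta> (ad_l H a) = tsum (\<lambda>x y. tsum (\<lambda>x1 x2. \<beta> x2 (x1 * ant H y)) (cop H x)) (cop H a)"
  and tsum_ad_r: "tsum \<beta> (ad_r H a) = tsum (\<lambda>x y. tsum (\<lambda>x1 x2. \<beta> x2 (ant H x1 * y)) (cop H x)) (cop H a)"
proof -
  have 1: "tsum \<beta> (map (\<lambda>(a1, a2, a3). (f a1 a2 a3, g a1 a2 a3)) (concat (map (\<lambda>(x, y). map (\<lambda>(x1, x2). (x1, x2, y)) (M x)) L)))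
      = tsum (\<lambda>x y. tsum (\<lambda>x1 x2. \<beta> (f x1 x2 y) (g x1 x2 y)) (M x)) L" for f g M L
  proof (induction L)
    case (Cons a L)
    have "tsum \<beta> (map ((\<lambda>(a1, a2, a3). (f a1 a2 a3, g a1 a2 a3)) \<circ> (\<lambda>(x1, x2). (x1, x2, y))) K)
      = tsum (\<lambda>x1 x2. \<beta> (f x1 x2 y) (g x1 x2 y)) K" for y K
      by (induction K) auto
    with Cons show ?case by (cases a) (simp add: tsum_append)
  qed simp
  show "tsum \<beta> (ad_l H a) = tsum (\<lambda>x y. tsum (\<lambda>x1 x2. \<beta> x2 (x1 * ant H y)) (cop H x)) (cop H a)"
    "tsum \<beta> (ad_r H a) = tsum (\<lambda>x y. tsum (\<lambda>x1 x2. \<beta> x2 (ant H x1 * y)) (cop H x)) (cop H a)"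
    by (simp_all only: ad_l_def ad_r_def cop3_def 1)
qed

context hopf_alg
begin

definition trilin :: "(complex \<Rightarrow> 'c \<Rightarrow> 'c) \<Rightarrow> ('a \<Rightarrow> 'a \<Rightarrow> 'a \<Rightarrow> 'c::ab_group_add) \<Rightarrow> bool" where
  "trilin s F \<longleftrightarrow> (\<forall>y. bilin H H s (\<lambda>x1 x2. F x1 x2 y)) \<and> (\<forall>x1 x2. linmap H s (F x1 x2))"

lemma tsum_scale: "vector_space s \<Longrightarrow> tsum (\<lambda>x y. s c (\<beta> x y)) L = s c (tsum \<beta> L)"
proof -
  assume "vector_space s"
  then interpret V: vector_space s .
  show ?thesis by (induction L) (auto simp: V.scale_right_distrib)
qed

lemma trilin_bilin:
  assumes s: "vector_space s" and F: "trilin s F"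
  shows "bilin H H s (\<lambda>x y. cs x (\<lambda>x1 x2. F x1 x2 y))"
  unfolding bilin_def
proof (intro conjI allI)
  show "linmap H s (\<lambda>x. cs x (\<lambda>x1 x2. F x1 x2 y))" for y
    by (rule cs_linmap[OF s]) (use F in \<open>simp add: trilin_def\<close>)
  show "linmap H s (\<lambda>y. cs x (\<lambda>x1 x2. F x1 x2 y))" for x
    using F by (simp add: trilin_def linmap_def tsum_add tsum_scale[OF s])
qed

lemma cs3_corep:
  assumes s: "vector_space s" and F: "trilin s F" and v: "corep H I v" and ij: "i \<in> I" "j \<in> I"
  shows "cs (v i j) (\<lambda>x y. cs x (\<lambda>x1 x2. F x1 x2 y)) = (\<Sum>k\<in>I. \<Sum>l\<in>I. F (v i l) (v l k) (v k j))"
proof -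
  have b: "bilin H H s (\<lambda>x1 x2. F x1 x2 y)" for y using F by (simp add: trilin_def)
  show ?thesis using ij by (simp add: cs_corep[OF v trilin_bilin[OF s F]] cs_corep[OF v b])
qed

end

section \<open>Quantum subgroups and the pulled-back Haar state\<close>

locale quantum_subgroup_pair = G: cqg_alg G + N: cqg_alg N
  for G :: "('a::ring_1) hopf_data" and N :: "('b::ring_1) hopf_data" +
  fixes p :: "'a \<Rightarrow> 'b"
  assumes qs: "quantum_subgroup G N p"
begin

lemma p_surj: "surj p"
  and p_add: "p (x + y) = p x + p y" and p_sc: "p (G.scl c x) = N.scl c (p x)"
  and p_mult: "p (x * y) = p x * p y" and p_1: "p 1 = 1"
  and p_cop: "teq2 N N (map (\<lambda>(a, b). (p a, p b)) (cop G x)) (cop N (p x))"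
  using qs by (auto simp: quantum_subgroup_def)

lemma p_linmap: "linmap G N.scl p"
  by (simp add: linmap_def p_add p_sc)

lemma p_corep:
  assumes "corep G I v"
  shows "corep N I (\<lambda>i j. p (v i j))"
proof -
  have "N.cs (p (v i j)) (\<lambda>x y. f x * g y) = (\<Sum>k\<in>I. f (p (v i k)) * g (p (v k j)))"
    if "i \<in> I" "j \<in> I" and f: "N.functional f" and g: "N.functional g" for i j f g
  proof -
    have fp: "G.functional (\<lambda>x. f (p x))" "G.functional (\<lambda>x. g (p x))"
      using f g by (simp_all add: linmap_def p_add p_sc)
    have "N.cs (p (v i j)) (\<lambda>x y. f x * g y) = tsum (\<lambda>x y. f x * g y) (map (\<lambda>(a, b). (p a, p b)) (cop G (v i j)))"
      using p_cop[of "v i j"] f g by (simp add: teq2_tsum)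
    also have "\<dots> = G.cs (v i j) (\<lambda>x y. f (p x) * g (p y))" by (rule tsum_map)
    also have "\<dots> = (\<Sum>k\<in>I. f (p (v i k)) * g (p (v k j)))"
      by (rule G.cs_corep[OF assms G.bilin_functional_prod[OF fp] that(1,2)])
    finally show ?thesis .
  qed
  then show ?thesis using corep_finite[OF assms] by (simp add: corep_def)
qed

definition hp :: "'a \<Rightarrow> complex" where "hp x = haar N (p x)"

lemma haar_functional: "N.functional (haar N)" "haar N 1 = 1"
  using N.haar_invariant by (simp_all add: N.invariant_def)

lemma hp_functional: "G.functional hp" and hp_1: "hp 1 = 1"
  using haar_functional by (simp_all add: hp_def[abs_def] linmap_def p_add p_sc p_1)

text \<open>The Haar state of N is idempotent under convolution.\<close>

lemma hp_idempotent:
  assumes "corep G I v" "i \<in> I" "j \<in> I"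
  shows "(\<Sum>k\<in>I. hp (v i k) * hp (v k j)) = hp (v i j)"
  using N.invariant_corep_functional(1)[OF N.haar_invariant p_corep[OF assms(1)] assms(2,3) haar_functional(1)]
  by (simp add: hp_def haar_functional)

lemma p_average:
  assumes "corep G I v" "i \<in> I" "j \<in> I"
  shows "p (\<Sum>k\<in>I. G.scl (hp (v i k)) (v k j)) = p (G.scl (hp (v i j)) 1)"
    and "p (\<Sum>k\<in>I. G.scl (hp (v k j)) (v i k)) = p (G.scl (hp (v i j)) 1)"
  using N.invariant_corep[OF N.haar_invariant p_corep[OF assms(1)] assms(2,3)]
  by (simp_all add: linmap_sum[OF p_linmap] p_sc p_1 hp_def)

section \<open>The maps \<Theta>\<close>

text \<open>The map \<Theta> of the overview is the case \<open>c = 1\<close>. The extra factor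
  feeds the nondegeneracy of the Haar state; in \<open>Theta_r\<close> it stands on the
  right.\<close>

definition Theta_l :: "'a \<Rightarrow> 'a \<Rightarrow> 'a" where
  "Theta_l c a = tsum (\<lambda>x y. G.scl (hp (c * x)) y) (ad_l G a)"

definition Theta_r :: "'a \<Rightarrow> 'a \<Rightarrow> 'a" where
  "Theta_r c a = tsum (\<lambda>x y. G.scl (hp (x * c)) y) (ad_r G a)"

lemma trilin_l: "G.trilin G.scl (\<lambda>x1 x2 y. G.scl (hp (c * x2)) (x1 * G.S y))"
  and trilin_r: "G.trilin G.scl (\<lambda>x1 x2 y. G.scl (hp (x2 * c)) (G.S x1 * y))"
  using hp_functional
  by (simp_all add: G.trilin_def bilin_def linmap_def distrib_left distrib_right G.S_add G.S_sc
      G.sc_mult_left G.sc_mult_right G.sc_sc G.sc_add_left G.sc_add_right mult.commute)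

lemma Theta_l_linmap: "linmap G G.scl (Theta_l c)"
  and Theta_r_linmap: "linmap G G.scl (Theta_r c)"
  using G.cs_linmap[OF G.vs.vector_space_axioms G.trilin_bilin[OF G.vs.vector_space_axioms trilin_l]]
    G.cs_linmap[OF G.vs.vector_space_axioms G.trilin_bilin[OF G.vs.vector_space_axioms trilin_r]]
  by (simp_all add: Theta_l_def[abs_def] Theta_r_def[abs_def] tsum_ad_l tsum_ad_r)

lemma Theta_corep:
  assumes "corep G I v" "i \<in> I" "j \<in> I"
  shows "Theta_l c (v i j) = (\<Sum>k\<in>I. \<Sum>l\<in>I. G.scl (hp (c * v l k)) (v i l * G.S (v k j)))"
    and "Theta_r c (v i j) = (\<Sum>k\<in>I. \<Sum>l\<in>I. G.scl (hp (v l k * c)) (G.S (v i l) * v k j))"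
  using G.cs3_corep[OF G.vs.vector_space_axioms trilin_l assms] G.cs3_corep[OF G.vs.vector_space_axioms trilin_r assms]
  by (simp_all add: Theta_l_def Theta_r_def tsum_ad_l tsum_ad_r)

lemma Theta_left_linmap: "linmap G G.scl (\<lambda>c. Theta_l c a)" "linmap G G.scl (\<lambda>c. Theta_r c a)"
proof -
  show "linmap G G.scl (\<lambda>c. Theta_l c a)"
    unfolding linmap_def Theta_l_def tsum_add[symmetric] G.tsum_scale[OF G.vs.vector_space_axioms, symmetric]
    by (intro conjI allI tsum_cong) (simp_all add: distrib_right G.sc_mult_left linmap_add[OF hp_functional]
        linmap_sc[OF hp_functional] G.sc_add_left G.sc_sc)
  show "linmap G G.scl (\<lambda>c. Theta_r c a)"
    unfolding linmap_def Theta_r_def tsum_add[symmetric] G.tsum_scale[OF G.vs.vector_space_axioms, symmetric]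
    by (intro conjI allI tsum_cong) (simp_all add: distrib_left G.sc_mult_right linmap_add[OF hp_functional]
        linmap_sc[OF hp_functional] G.sc_add_left G.sc_sc)
qed

text \<open>The trivial representation, through which values at \<open>1\<close> follow from the
  formulas for corepresentations.\<close>

lemma one_corep: "corep G {0::nat} (\<lambda>_ _. 1)"
  by (simp add: corep_def G.cs_1[OF G.bilin_functional_prod])

lemma S_1: "G.S 1 = 1"
  using G.corep_counit(2)[OF one_corep, of 0 0] by (simp add: G.eps_1 G.sc_1)

lemma Theta_1: "Theta_l 1 1 = 1" "Theta_r 1 1 = 1"
  using Theta_corep[OF one_corep, of 0 0 1] by (simp_all add: hp_1 G.sc_1 S_1)

section \<open>Tensors with first leg in the kernel\<close>

lemma in_ker_tensorD:
  assumes "in_ker_tensor G p L"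
  shows "tsum (\<lambda>x y. G.scl (hp x) y) L = 0"
proof (rule G.separating)
  fix g assume g: "G.functional g"
  obtain M where M: "\<forall>(x, y) \<in> set M. p x = 0" "teq2 G G L M" using assms by (auto simp: in_ker_tensor_def)
  have "g (tsum (\<lambda>x y. G.scl (hp x) y) L) = tsum (\<lambda>x y. hp x * g y) L"
    by (simp add: linmap_tsum[OF g] linmap_sc[OF g])
  also have "\<dots> = tsum (\<lambda>x y. hp x * g y) M" using M(2) g hp_functional by (simp add: teq2_tsum)
  also have "\<dots> = tsum (\<lambda>x y. 0) M"
    by (rule tsum_cong) (use M(1) in \<open>auto simp: hp_def linmap_0[OF haar_functional(1)]\<close>)
  finally show "g (tsum (\<lambda>x y. G.scl (hp x) y) L) = 0" by (simp add: tsum_0)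
qed

text \<open>The kernel of \<open>p \<otimes> id\<close> is \<open>ker p \<otimes> A\<close>: with a
  linear right inverse \<open>s\<close> of \<open>p\<close>, each \<open>x\<close> is replaced by
  \<open>x - s (p x)\<close>, which lies in the kernel, and the removed terms add up to the zero
  tensor.\<close>

lemma in_ker_tensorI:
  assumes 0: "\<And>g. G.functional g \<Longrightarrow> tsum (\<lambda>x y. N.scl (g y) (p x)) L = 0"
  shows "in_ker_tensor G p L"
proof -
  interpret VP: vector_space_pair G.scl N.scl ..
  have "Vector_Spaces.linear G.scl N.scl p"
    by unfold_locales (simp_all add: p_add p_sc)
  from VP.linear_surjective_right_inverse[OF this p_surj]
  obtain s where s: "Vector_Spaces.linear N.scl G.scl s" "p \<circ> s = id" by blast
  interpret s: Vector_Spaces.linear N.scl G.scl s by fact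
  have ps: "p (s b) = b" for b using s(2) by (metis comp_apply id_apply)
  define M where "M = map (\<lambda>(x, y). (x - s (p x), y)) L"
  have "\<forall>(x, y) \<in> set M. p x = 0"
    by (auto simp: M_def linmap_diff[OF p_linmap] ps)
  moreover have "teq2 G G L M"
    unfolding teq2_tsum
  proof (intro allI impI)
    fix f g assume f: "G.functional f" and g: "G.functional g"
    have fs: "N.functional (\<lambda>b. f (s b))"
      using f by (simp add: linmap_def s.add s.scale)
    have "tsum (\<lambda>x y. f (s (p x)) * g y) L = f (s (tsum (\<lambda>x y. N.scl (g y) (p x)) L))"
      by (simp add: linmap_tsum[OF fs] linmap_sc[OF fs] mult.commute)
    also have "\<dots> = 0" by (simp add: 0[OF g] linmap_0[OF f])
    finally have z: "tsum (\<lambda>x y. f (s (p x)) * g y) L = 0" .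
    have "tsum (\<lambda>x y. f x * g y) L = tsum (\<lambda>x y. f (x - s (p x)) * g y + f (s (p x)) * g y) L"
      by (rule tsum_cong) (simp add: linmap_diff[OF f] algebra_simps)
    also have "\<dots> = tsum (\<lambda>x y. f x * g y) M" by (simp add: tsum_add z M_def tsum_map)
    finally show "tsum (\<lambda>x y. f x * g y) L = tsum (\<lambda>x y. f x * g y) M" .
  qed
  ultimately show ?thesis unfolding in_ker_tensor_def by blast
qed

text \<open>Nondegeneracy of the Haar state of N tests a slice against all of N, and surjectivity of
  \<open>p\<close> lets the test elements come from G.\<close>

lemma in_ker_tensor_left:
  assumes "\<And>c. tsum (\<lambda>x y. G.scl (hp (c * x)) y) L = 0"
  shows "in_ker_tensor G p L"
proof (rule in_ker_tensorI)
  fix g assume g: "G.functional g"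
  show "tsum (\<lambda>x y. N.scl (g y) (p x)) L = 0"
  proof (rule N.invariant_nondegenerate_left[OF N.haar_invariant])
    fix c obtain c' where c: "c = p c'" using p_surj by blast
    have "haar N (c * tsum (\<lambda>x y. N.scl (g y) (p x)) L) = tsum (\<lambda>x y. haar N (c * N.scl (g y) (p x))) L"
      by (simp add: linmap_tsum[OF haar_functional(1)] flip: tsum_mult_left)
    also have "\<dots> = g (tsum (\<lambda>x y. G.scl (hp (c' * x)) y) L)"
      by (simp add: linmap_tsum[OF g] linmap_sc[OF g] N.sc_mult_right linmap_sc[OF haar_functional(1)]
          hp_def p_mult c mult.commute)
    finally show "haar N (c * tsum (\<lambda>x y. N.scl (g y) (p x)) L) = 0" by (simp add: assms linmap_0[OF g])
  qed
qed

lemma in_ker_tensor_right: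
  assumes "\<And>c. tsum (\<lambda>x y. G.scl (hp (x * c)) y) L = 0"
  shows "in_ker_tensor G p L"
proof (rule in_ker_tensorI)
  fix g assume g: "G.functional g"
  show "tsum (\<lambda>x y. N.scl (g y) (p x)) L = 0"
  proof (rule N.invariant_nondegenerate_right[OF N.haar_invariant])
    fix c obtain c' where c: "c = p c'" using p_surj by blast
    have "haar N (tsum (\<lambda>x y. N.scl (g y) (p x)) L * c) = tsum (\<lambda>x y. haar N (N.scl (g y) (p x) * c)) L"
      by (simp add: linmap_tsum[OF haar_functional(1)] flip: tsum_mult_right)
    also have "\<dots> = g (tsum (\<lambda>x y. G.scl (hp (x * c')) y) L)"
      by (simp add: linmap_tsum[OF g] linmap_sc[OF g] N.sc_mult_left linmap_sc[OF haar_functional(1)]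
          hp_def p_mult c mult.commute)
    finally show "haar N (tsum (\<lambda>x y. N.scl (g y) (p x)) L * c) = 0" by (simp add: assms linmap_0[OF g])
  qed
qed

text \<open>With \<open>P = (hp (v i j))\<close>, \<open>Theta\<close> sends \<open>v\<close> to \<open>v P v\<^sup>-\<^sup>1\<close> (left) or \<open>v\<^sup>-\<^sup>1 P v\<close> (right). As \<open>P v - P\<close>
  and \<open>v P - P\<close> lie in the kernel of \<open>p\<close>, this gives \<open>P v P = P v\<close> respectively \<open>P v P = v P\<close>.\<close>

lemma left_a_normal_imp_normal:
  assumes "left_a_normal G p"
  shows "normal_qsg G N p"
  unfolding normal_qsg_def
proof (intro allI impI)
  fix d v assume irr: "irreducible_rep G d v"
  then have v: "G.invertible_corep {..<d} v" by (simp add: irreducible_rep_def G.representation_iff)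
  note V = G.invertible_corepD[OF v]
  define P where "P = (\<lambda>i j. hp (v i j))"
  have PP: "(\<Sum>k<d. P i k * P k j) = P i j" if "i < d" "j < d" for i j
    using hp_idempotent[OF V(1)] that by (simp add: P_def)
  have ker: "Theta_l 1 a = 0" if "p a = 0" for a
    using in_ker_tensorD[of "ad_l G a"] assms that by (simp add: left_a_normal_def Theta_l_def)
  have PvPw: "(\<Sum>k<d. \<Sum>l<d. G.scl (P l k) ((\<Sum>r<d. G.scl (P i r) (v r l)) * G.S (v k j))) = G.scl (P i j) 1"
    if ij: "i < d" "j < d" for i j
  proof -
    have "Theta_l 1 ((\<Sum>r<d. G.scl (P i r) (v r j)) - G.scl (P i j) 1) = 0"
      by (rule ker) (use p_average(1)[OF V(1), of i j] ij in \<open>simp add: linmap_diff[OF p_linmap] P_def\<close>)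
    then have "(\<Sum>r<d. G.scl (P i r) (Theta_l 1 (v r j))) = G.scl (P i j) 1"
      by (simp add: linmap_diff[OF Theta_l_linmap] linmap_sum[OF Theta_l_linmap] linmap_sc[OF Theta_l_linmap] Theta_1)
    moreover have "(\<Sum>r<d. G.scl (P i r) (Theta_l 1 (v r j)))
        = (\<Sum>r<d. \<Sum>k<d. \<Sum>l<d. G.scl (P l k) (G.scl (P i r) (v r l) * G.S (v k j)))"
      using ij by (intro sum.cong refl) (simp add: Theta_corep(1)[OF V(1)] P_def G.vs.scale_sum_right
        G.sc_sc G.sc_mult_left mult.commute)
    moreover have "\<dots> = (\<Sum>k<d. \<Sum>l<d. \<Sum>r<d. G.scl (P l k) (G.scl (P i r) (v r l) * G.S (v k j)))"
      by (rule trans[OF sum.swap sum.cong[OF refl sum.swap]])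
    moreover have "\<dots> = (\<Sum>k<d. \<Sum>l<d. G.scl (P l k) ((\<Sum>r<d. G.scl (P i r) (v r l)) * G.S (v k j)))"
      by (simp add: sum_distrib_right G.vs.scale_sum_right)
    ultimately show ?thesis by simp
  qed
  have PvP: "(\<Sum>r<d. \<Sum>l<d. G.scl (P i r * P l j) (v r l)) = (\<Sum>r<d. G.scl (P i r) (v r j))"
    if ij: "i < d" "j < d" for i j
  proof -
    have "(\<Sum>m<d. G.scl (P i m) (v m j)) = (\<Sum>m<d. G.scl (P i m) 1 * v m j)" by (simp add: G.sc_mult_left)
    also have "\<dots> = (\<Sum>m<d. (\<Sum>k<d. (\<Sum>l<d. G.scl (P l k) (\<Sum>r<d. G.scl (P i r) (v r l))) * G.S (v k m)) * v m j)"
      using ij by (intro sum.cong refl arg_cong2[where f = times])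
        (simp_all add: PvPw[symmetric] sum_distrib_right G.sc_mult_left)
    also have "\<dots> = (\<Sum>l<d. G.scl (P l j) (\<Sum>r<d. G.scl (P i r) (v r l)))"
      by (rule mat_cancel_right) (use V ij in auto)
    also have "\<dots> = (\<Sum>r<d. \<Sum>l<d. G.scl (P i r * P l j) (v r l))"
      unfolding G.vs.scale_sum_right G.sc_sc by (subst sum.swap) (simp add: mult.commute)
    finally show ?thesis by simp
  qed
  \<comment> \<open>\<open>P v P = P v\<close> makes the range of \<open>1 - P\<close> invariant:
    \<open>(1 - Q) v Q = P v (1 - P) = 0\<close>. So irreducibility is applied to \<open>Q\<close>;
    in the right-handed case \<open>P\<close> itself qualifies.\<close>
  define Q where "Q = (\<lambda>i j. (if i = j then 1 else 0) - P i j)"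
  have QQ: "(\<Sum>k<d. Q i k * Q k j) = Q i j" if "i < d" "j < d" for i j
    using that by (simp add: Q_def left_diff_distrib right_diff_distrib sum_subtractf sum_delta PP)
  have Qv: "(\<Sum>k<d. \<Sum>l<d. G.scl (((if i = k then 1 else 0) - Q i k) * Q l j) (v k l)) = 0" if "i < d" "j < d" for i j
  proof -
    have "(\<Sum>l<d. G.scl (P i k * Q l j) (v k l)) = G.scl (P i k) (v k j) - (\<Sum>l<d. G.scl (P i k * P l j) (v k l))"
      if "k < d" for k
    proof -
      have "G.scl (P i k * Q l j) (v k l) = (if l = j then G.scl (P i k) (v k l) else 0) - G.scl (P i k * P l j) (v k l)" for l
        by (simp add: Q_def right_diff_distrib G.vs.scale_left_diff_distrib)
      then show ?thesis using \<open>j < d\<close> by (simp add: sum_subtractf)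
    qed
    moreover have "(if i = k then 1 else 0) - Q i k = P i k" for k by (simp add: Q_def)
    ultimately show ?thesis using PvP[OF that] by (simp add: sum_subtractf)
  qed
  have haar: "haar N (p (v i j)) = (if i = j then 1 else 0) - Q i j" for i j
    by (simp add: Q_def P_def hp_def)
  have "(\<forall>i<d. \<forall>j<d. Q i j = 0) \<or> (\<forall>i<d. \<forall>j<d. Q i j = (if i = j then 1 else 0))"
    using irr QQ Qv unfolding irreducible_rep_def by blast
  then show "(\<forall>i<d. \<forall>j<d. haar N (p (v i j)) = (if i = j then 1 else 0)) \<or> (\<forall>i<d. \<forall>j<d. haar N (p (v i j)) = 0)"
    unfolding haar by auto
qed

lemma right_a_normal_imp_normal:
  assumes "right_a_normal G p"
  shows "normal_qsg G N p"
  unfolding normal_qsg_def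
proof (intro allI impI)
  fix d v assume irr: "irreducible_rep G d v"
  then have v: "G.invertible_corep {..<d} v" by (simp add: irreducible_rep_def G.representation_iff)
  note V = G.invertible_corepD[OF v]
  define P where "P = (\<lambda>i j. hp (v i j))"
  have PP: "(\<Sum>k<d. P i k * P k j) = P i j" if "i < d" "j < d" for i j
    using hp_idempotent[OF V(1)] that by (simp add: P_def)
  have ker: "Theta_r 1 a = 0" if "p a = 0" for a
    using in_ker_tensorD[of "ad_r G a"] assms that by (simp add: right_a_normal_def Theta_r_def)
  have wPvP: "(\<Sum>l<d. G.S (v i l) * (\<Sum>k<d. G.scl (P l k) (\<Sum>r<d. G.scl (P r j) (v k r)))) = G.scl (P i j) 1"
    if ij: "i < d" "j < d" for i j
  proof -
    have "Theta_r 1 ((\<Sum>r<d. G.scl (P r j) (v i r)) - G.scl (P i j) 1) = 0"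
      by (rule ker) (use p_average(2)[OF V(1), of i j] ij in \<open>simp add: linmap_diff[OF p_linmap] P_def\<close>)
    then have "(\<Sum>r<d. G.scl (P r j) (Theta_r 1 (v i r))) = G.scl (P i j) 1"
      by (simp add: linmap_diff[OF Theta_r_linmap] linmap_sum[OF Theta_r_linmap] linmap_sc[OF Theta_r_linmap] Theta_1)
    moreover have "(\<Sum>r<d. G.scl (P r j) (Theta_r 1 (v i r)))
        = (\<Sum>r<d. \<Sum>k<d. \<Sum>l<d. G.S (v i l) * G.scl (P l k) (G.scl (P r j) (v k r)))"
      using ij by (intro sum.cong refl) (simp add: Theta_corep(2)[OF V(1)] P_def G.vs.scale_sum_right
        G.sc_sc G.sc_mult_right mult.commute)
    moreover have "\<dots> = (\<Sum>l<d. \<Sum>k<d. \<Sum>r<d. G.S (v i l) * G.scl (P l k) (G.scl (P r j) (v k r)))"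
      by (rule trans[OF sum.swap trans[OF sum.cong[OF refl sum.swap] sum.swap]])
    moreover have "\<dots> = (\<Sum>l<d. G.S (v i l) * (\<Sum>k<d. G.scl (P l k) (\<Sum>r<d. G.scl (P r j) (v k r))))"
      by (simp add: sum_distrib_left G.vs.scale_sum_right)
    ultimately show ?thesis by simp
  qed
  have PvP: "(\<Sum>k<d. \<Sum>l<d. G.scl (P i k * P l j) (v k l)) = (\<Sum>m<d. G.scl (P m j) (v i m))"
    if ij: "i < d" "j < d" for i j
  proof -
    have "(\<Sum>m<d. G.scl (P m j) (v i m)) = (\<Sum>m<d. v i m * G.scl (P m j) 1)" by (simp add: G.sc_mult_right)
    also have "\<dots> = (\<Sum>m<d. v i m * (\<Sum>l<d. G.S (v m l) * (\<Sum>k<d. G.scl (P l k) (\<Sum>r<d. G.scl (P r j) (v k r)))))"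
      using ij by (intro sum.cong refl) (simp add: wPvP)
    also have "\<dots> = (\<Sum>k<d. G.scl (P i k) (\<Sum>r<d. G.scl (P r j) (v k r)))"
      by (rule mat_cancel_left) (use V ij in auto)
    also have "\<dots> = (\<Sum>k<d. \<Sum>l<d. G.scl (P i k * P l j) (v k l))"
      by (simp add: G.vs.scale_sum_right G.sc_sc)
    finally show ?thesis by simp
  qed
  have Pv: "(\<Sum>k<d. \<Sum>l<d. G.scl (((if i = k then 1 else 0) - P i k) * P l j) (v k l)) = 0" if "i < d" "j < d" for i j
  proof -
    have "(\<Sum>l<d. G.scl (((if i = k then 1 else 0) - P i k) * P l j) (v k l))
      = (if i = k then (\<Sum>l<d. G.scl (P l j) (v k l)) else 0) - (\<Sum>l<d. G.scl (P i k * P l j) (v k l))" for k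
      by (auto simp: left_diff_distrib G.vs.scale_left_diff_distrib sum_subtractf)
    then show ?thesis using PvP[OF that] that by (simp add: sum_subtractf)
  qed
  have "(\<forall>i<d. \<forall>j<d. P i j = 0) \<or> (\<forall>i<d. \<forall>j<d. P i j = (if i = j then 1 else 0))"
    using irr PP Pv unfolding irreducible_rep_def by blast
  then show "(\<forall>i<d. \<forall>j<d. haar N (p (v i j)) = (if i = j then 1 else 0)) \<or> (\<forall>i<d. \<forall>j<d. haar N (p (v i j)) = 0)"
    by (auto simp: P_def hp_def)
qed

section \<open>From normality to a-normality\<close>

text \<open>On an irreducible \<open>v\<close> the matrix \<open>P\<close> is 0 or 1, hence
  \<open>v P v^-1 = P = v^-1 P v\<close>. All maps involved are linear, so complete reducibility
  extends this to the whole algebra.\<close>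

lemma normal_Theta:
  assumes "normal_qsg G N p"
  shows "Theta_l 1 a = G.scl (hp a) 1" "Theta_r 1 a = G.scl (hp a) 1"
proof -
  have *: "Theta_l 1 a = G.scl (hp a) 1 \<and> Theta_r 1 a = G.scl (hp a) 1"
  proof (induction a rule: G.irreducible_induct)
    case (irreducible d v i j)
    then have v: "G.invertible_corep {..<d} v" by (simp add: irreducible_rep_def G.representation_iff)
    note V = G.invertible_corepD[OF v]
    have ij: "i < d" "j < d" by fact+
    consider "\<forall>i<d. \<forall>j<d. hp (v i j) = (if i = j then 1 else 0)" | "\<forall>i<d. \<forall>j<d. hp (v i j) = 0"
      using assms irreducible(1) unfolding normal_qsg_def hp_def by blast
    then show ?case
    proof cases
      case 1
      have sc_if: "G.scl (if b then 1 else 0) x = (if b then x else 0)" for b x by (simp add: G.sc_1)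
      have "Theta_l 1 (v i j) = (\<Sum>k<d. \<Sum>l<d. if l = k then v i l * G.S (v k j) else 0)"
        "Theta_r 1 (v i j) = (\<Sum>k<d. \<Sum>l<d. if l = k then G.S (v i l) * v k j else 0)"
        using ij by (auto simp: Theta_corep[OF V(1)] 1 sc_if intro!: sum.cong)
      then show ?thesis using ij V(4,5)[of i j] 1 by (simp add: sc_if)
    next
      case 2
      then show ?thesis using ij by (simp add: Theta_corep[OF V(1)])
    qed
  qed (simp_all add: linmap_0[OF Theta_l_linmap] linmap_0[OF Theta_r_linmap] linmap_add[OF Theta_l_linmap]
      linmap_add[OF Theta_r_linmap] linmap_sc[OF Theta_l_linmap] linmap_sc[OF Theta_r_linmap]
      linmap_0[OF hp_functional] linmap_add[OF hp_functional] linmap_sc[OF hp_functional] G.sc_add_left G.sc_sc)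
  then show "Theta_l 1 a = G.scl (hp a) 1" "Theta_r 1 a = G.scl (hp a) 1" by blast+
qed

text \<open>On coefficients of \<open>u\<close>, \<open>Theta_l 1 (v x y * u i j)\<close> is
  computed in the tensor product of \<open>v\<close> and \<open>u\<close>. As \<open>S\<close>
  reverses products, the entries of \<open>v\<close> end up outside those of \<open>u\<close> and
  can be cancelled on both sides.\<close>

lemma Theta_l_shift:
  assumes v: "G.invertible_corep I v" and pq: "q \<in> I" "r \<in> I"
  shows "Theta_l (v q r) a = (\<Sum>y\<in>I. (\<Sum>x\<in>I. G.S (v q x) * Theta_l 1 (v x y * a)) * v y r)"
proof (rule G.linmap_eq_on_coefficients[where F = "Theta_l (v q r)" and
      G = "\<lambda>a. \<Sum>y\<in>I. (\<Sum>x\<in>I. G.S (v q x) * Theta_l 1 (v x y * a)) * v y r", OF Theta_l_linmap])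
  note V = G.invertible_corepD[OF v]
  show "linmap G G.scl (\<lambda>a. \<Sum>y\<in>I. (\<Sum>x\<in>I. G.S (v q x) * Theta_l 1 (v x y * a)) * v y r)"
    by (simp add: linmap_def distrib_left distrib_right G.sc_mult_left G.sc_mult_right sum.distrib
        linmap_add[OF Theta_l_linmap] linmap_sc[OF Theta_l_linmap] flip: G.vs.scale_sum_right)
  fix d u i j assume u: "unitary_rep G d u" and ij: "i < d" "j < (d::nat)"
  note U = G.invertible_corepD[OF G.unitary_invertible[OF u]]
  \<comment> \<open>\<open>Theta_l (v s t) (u i j)\<close> in coordinates.\<close>
  define M where "M = (\<lambda>s t. \<Sum>k<d. \<Sum>l<d. G.scl (hp (v s t * u l k)) (u i l * G.S (u k j)))"
  have 1: "Theta_l 1 (v x y * u i j) = (\<Sum>s\<in>I. v x s * (\<Sum>t\<in>I. M s t * G.S (v t y)))" if "x \<in> I" "y \<in> I" for x y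
  proof -
    have "Theta_l 1 (v x y * u i j) = (\<Sum>(t, k)\<in>I \<times> {..<d}. \<Sum>(s, l)\<in>I \<times> {..<d}.
        G.scl (hp (v s t * u l k)) ((v x s * u i l) * G.S (v t y * u k j)))"
      using Theta_corep(1)[OF G.corep_prod[OF V(1) U(1)], of "(x,i)" "(y,j)" 1] that ij
      by (simp add: split_def)
    also have "\<dots> = (\<Sum>t\<in>I. \<Sum>k<d. \<Sum>s\<in>I. \<Sum>l<d.
        v x s * (G.scl (hp (v s t * u l k)) (u i l * G.S (u k j)) * G.S (v t y)))"
      by (simp add: G.S_mult G.sc_mult_left G.sc_mult_right mult.assoc flip: sum.cartesian_product)
    also have "\<dots> = (\<Sum>t\<in>I. \<Sum>s\<in>I. \<Sum>k<d. \<Sum>l<d.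
        v x s * (G.scl (hp (v s t * u l k)) (u i l * G.S (u k j)) * G.S (v t y)))"
      by (intro sum.cong[OF refl] sum.swap)
    also have "\<dots> = (\<Sum>s\<in>I. \<Sum>t\<in>I. v x s * (M s t * G.S (v t y)))"
      unfolding M_def sum_distrib_right sum_distrib_left by (rule sum.swap)
    finally show ?thesis by (simp add: sum_distrib_left)
  qed
  have "(\<Sum>y\<in>I. (\<Sum>x\<in>I. G.S (v q x) * Theta_l 1 (v x y * u i j)) * v y r)
    = (\<Sum>y\<in>I. (\<Sum>t\<in>I. M q t * G.S (v t y)) * v y r)"
  proof (rule sum.cong[OF refl], rule arg_cong2[where f = times, OF _ refl])
    fix y assume y: "y \<in> I"
    have "(\<Sum>x\<in>I. G.S (v q x) * Theta_l 1 (v x y * u i j))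
      = (\<Sum>x\<in>I. G.S (v q x) * (\<Sum>s\<in>I. v x s * (\<Sum>t\<in>I. M s t * G.S (v t y))))"
      using y by (intro sum.cong refl) (simp add: 1)
    also have "\<dots> = (\<Sum>t\<in>I. M q t * G.S (v t y))"
      by (rule mat_cancel_left) (use V pq in auto)
    finally show "(\<Sum>x\<in>I. G.S (v q x) * Theta_l 1 (v x y * u i j)) = (\<Sum>t\<in>I. M q t * G.S (v t y))" .
  qed
  also have "\<dots> = M q r" by (rule mat_cancel_right) (use V pq in auto)
  also have "\<dots> = Theta_l (v q r) (u i j)" using ij by (simp add: M_def Theta_corep(1)[OF U(1)])
  finally show "Theta_l (v q r) (u i j) = (\<Sum>y\<in>I. (\<Sum>x\<in>I. G.S (v q x) * Theta_l 1 (v x y * u i j)) * v y r)" by simp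
qed

text \<open>For \<open>c = v q r\<close> this is \<open>h p (a\<^sub>2 c) S(a\<^sub>1) a\<^sub>3 =
  c\<^sub>1 \<Theta>(a c\<^sub>2) S(c\<^sub>3)\<close> with the right-handed \<Theta>. Here
  \<open>u\<close> comes first in the tensor product, so that the reversal by \<open>S\<close> again
  leaves the entries of \<open>v\<close> outside.\<close>

lemma Theta_r_shift:
  assumes v: "G.invertible_corep I v" and pq: "q \<in> I" "r \<in> I"
  shows "Theta_r (v q r) a = (\<Sum>y\<in>I. (\<Sum>x\<in>I. v q x * Theta_r 1 (a * v x y)) * G.S (v y r))"
proof (rule G.linmap_eq_on_coefficients[where F = "Theta_r (v q r)" and
      G = "\<lambda>a. \<Sum>y\<in>I. (\<Sum>x\<in>I. v q x * Theta_r 1 (a * v x y)) * G.S (v y r)", OF Theta_r_linmap])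
  note V = G.invertible_corepD[OF v]
  show "linmap G G.scl (\<lambda>a. \<Sum>y\<in>I. (\<Sum>x\<in>I. v q x * Theta_r 1 (a * v x y)) * G.S (v y r))"
    by (simp add: linmap_def distrib_left distrib_right G.sc_mult_left G.sc_mult_right sum.distrib
        linmap_add[OF Theta_r_linmap] linmap_sc[OF Theta_r_linmap] flip: G.vs.scale_sum_right)
  fix d u i j assume u: "unitary_rep G d u" and ij: "i < d" "j < (d::nat)"
  note U = G.invertible_corepD[OF G.unitary_invertible[OF u]]
  define M where "M = (\<lambda>s t. \<Sum>k<d. \<Sum>l<d. G.scl (hp (u l k * v s t)) (G.S (u i l) * u k j))"
  have 1: "Theta_r 1 (u i j * v x y) = (\<Sum>s\<in>I. G.S (v x s) * (\<Sum>t\<in>I. M s t * v t y))" if "x \<in> I" "y \<in> I" for x y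
  proof -
    have "Theta_r 1 (u i j * v x y) = (\<Sum>(k, t)\<in>{..<d} \<times> I. \<Sum>(l, s)\<in>{..<d} \<times> I.
        G.scl (hp (u l k * v s t)) (G.S (u i l * v x s) * (u k j * v t y)))"
      using Theta_corep(2)[OF G.corep_prod[OF U(1) V(1)], of "(i,x)" "(j,y)" 1] that ij
      by (simp add: split_def)
    also have "\<dots> = (\<Sum>k<d. \<Sum>t\<in>I. \<Sum>l<d. \<Sum>s\<in>I.
        G.S (v x s) * (G.scl (hp (u l k * v s t)) (G.S (u i l) * u k j) * v t y))"
      by (simp add: G.S_mult G.sc_mult_left G.sc_mult_right mult.assoc flip: sum.cartesian_product)
    also have "\<dots> = (\<Sum>t\<in>I. \<Sum>k<d. \<Sum>l<d. \<Sum>s\<in>I.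
        G.S (v x s) * (G.scl (hp (u l k * v s t)) (G.S (u i l) * u k j) * v t y))"
      by (rule sum.swap)
    also have "\<dots> = (\<Sum>t\<in>I. \<Sum>s\<in>I. \<Sum>k<d. \<Sum>l<d.
        G.S (v x s) * (G.scl (hp (u l k * v s t)) (G.S (u i l) * u k j) * v t y))"
      by (intro sum.cong[OF refl] trans[OF sum.cong[OF refl sum.swap] sum.swap])
    also have "\<dots> = (\<Sum>s\<in>I. \<Sum>t\<in>I. G.S (v x s) * (M s t * v t y))"
      unfolding M_def sum_distrib_right sum_distrib_left by (rule sum.swap)
    finally show ?thesis by (simp add: sum_distrib_left)
  qed
  have "(\<Sum>y\<in>I. (\<Sum>x\<in>I. v q x * Theta_r 1 (u i j * v x y)) * G.S (v y r))
    = (\<Sum>y\<in>I. (\<Sum>t\<in>I. M q t * v t y) * G.S (v y r))"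
  proof (rule sum.cong[OF refl], rule arg_cong2[where f = times, OF _ refl])
    fix y assume y: "y \<in> I"
    have "(\<Sum>x\<in>I. v q x * Theta_r 1 (u i j * v x y))
      = (\<Sum>x\<in>I. v q x * (\<Sum>s\<in>I. G.S (v x s) * (\<Sum>t\<in>I. M s t * v t y)))"
      using y by (intro sum.cong refl) (simp add: 1)
    also have "\<dots> = (\<Sum>t\<in>I. M q t * v t y)"
      by (rule mat_cancel_left) (use V pq in auto)
    finally show "(\<Sum>x\<in>I. v q x * Theta_r 1 (u i j * v x y)) = (\<Sum>t\<in>I. M q t * v t y)" .
  qed
  also have "\<dots> = M q r" by (rule mat_cancel_right) (use V pq in auto)
  also have "\<dots> = Theta_r (v q r) (u i j)" using ij by (simp add: M_def Theta_corep(2)[OF U(1)])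
  finally show "Theta_r (v q r) (u i j) = (\<Sum>y\<in>I. (\<Sum>x\<in>I. v q x * Theta_r 1 (u i j * v x y)) * G.S (v y r))" by simp
qed

lemma normal_imp_left_a_normal:
  assumes "normal_qsg G N p"
  shows "left_a_normal G p"
  unfolding left_a_normal_def
proof (intro allI impI)
  fix a assume a: "p a = 0"
  have "Theta_l c a = 0" for c
  proof (induction c rule: G.coefficient_induct)
    case (coef d v q r)
    have "Theta_l 1 (x * a) = 0" for x
      by (simp add: normal_Theta[OF assms] hp_def p_mult a linmap_0[OF haar_functional(1)])
    then show ?case using coef by (simp add: Theta_l_shift[OF G.unitary_invertible])
  qed (simp_all add: linmap_0[OF Theta_left_linmap(1)] linmap_add[OF Theta_left_linmap(1)] linmap_sc[OF Theta_left_linmap(1)])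
  then show "in_ker_tensor G p (ad_l G a)"
    by (intro in_ker_tensor_left) (simp add: Theta_l_def)
qed

lemma normal_imp_right_a_normal:
  assumes "normal_qsg G N p"
  shows "right_a_normal G p"
  unfolding right_a_normal_def
proof (intro allI impI)
  fix a assume a: "p a = 0"
  have "Theta_r c a = 0" for c
  proof (induction c rule: G.coefficient_induct)
    case (coef d v q r)
    have "Theta_r 1 (a * x) = 0" for x
      by (simp add: normal_Theta[OF assms] hp_def p_mult a linmap_0[OF haar_functional(1)])
    then show ?case using coef by (simp add: Theta_r_shift[OF G.unitary_invertible])
  qed (simp_all add: linmap_0[OF Theta_left_linmap(2)] linmap_add[OF Theta_left_linmap(2)] linmap_sc[OF Theta_left_linmap(2)])
  then show "in_ker_tensor G p (ad_r G a)"
    by (intro in_ker_tensor_right) (simp add: Theta_r_def)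
qed

end

theorem theorem2p7:
  fixes G :: "('a::ring_1) hopf_data" and N :: "('b::ring_1) hopf_data" and p :: "'a \<Rightarrow> 'b"
  assumes "cqg_algebra G" and "cqg_algebra N" and "quantum_subgroup G N p"
  shows "(normal_qsg G N p \<longleftrightarrow> a_normal G p) \<and>
         (normal_qsg G N p \<longleftrightarrow> left_a_normal G p) \<and>
         (normal_qsg G N p \<longleftrightarrow> right_a_normal G p)"
proof -
  interpret quantum_subgroup_pair G N p
    using assms by unfold_locales (simp_all add: cqg_algebra_def)
  show ?thesis
    using normal_imp_left_a_normal normal_imp_right_a_normal left_a_normal_imp_normal right_a_normal_imp_normal
    unfolding a_normal_def by blast
qed

end
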